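(* Let $n\geqslant2$, let $\mathbb{M}^n$ and $\mathbb{M}^n_*$ be connected $n$-dimensional Riemannian manifolds with geodesic distances $d,d_*$ and volume measures $v,v_*$, let $G$ be a domain in $\mathbb{M}^n$ and $\zeta_0\in G$. Let $Q:G\to(0,\infty]$ be a function measurable with respect to the measure $v$, let $n-1<p<n$, and suppose that $\mathbb{M}^n_*$, considered as a metric space with the geodesic metric $d_*$ and measure $v_*$, is an $(n,p)$-admissible target. In addition, assume that $\mathbb{M}^n_*$ is a proper space in which the following isoperimetric inequality is fulfilled: there is a constant $c>0$ such that $$\mathcal{H}^{n-1}(\partial A)\geqslant\frac{c}{(v_*(A))^{1/n-1}}$$ for any open set $A\subset\mathbb{M}^n_*$ with compact closure and smooth boundary. Suppose that $Q\in FMO(\zeta_0)$. Then the family $\mathfrak{F}^p_{\zeta_0,Q}(G,\mathbb{M}^n_* )$ is equicontinuous at $\zeta_0$ in the sense of the space $(\mathbb{M}^n_*,d_* )$; that is, for every $\varepsilon>0$ there is $\delta>0$ such that $d_*(f(x),f(\zeta_0))<\varepsilon$ for all $x\in G$ with $d(x,\zeta_0)<\delta$ and all $f\in\mathfrak{F}^p_{\zeta_0,Q}(G,\mathbb{M}^n_* )$.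
   Context: The geodesic distance between two points of a Riemannian manifold is the infimum of lengths of piecewise smooth paths joining them. $\mathcal{H}^{n-1}$ is $(n-1)$-dimensional Hausdorff measure; the exponent in the isoperimetric inequality is $(1/n)-1$. A metric space is proper if its closed balls are compact. A domain is a nonempty open connected set. Modulus. For a family $\Gamma$ of paths in a metric measure space $(X,d,\mu)$ and $p\geqslant1$, $M_p(\Gamma)=\inf\int_X\rho^p\,d\mu$, the infimum being over all Borel $\rho:X\to[0,\infty]$ with $\int_\gamma\rho\,|dx|\geqslant1$ for every locally rectifiable $\gamma\in\Gamma$. $\Gamma(E,F,A)$ is the family of paths joining $E$ and $F$ in $A$. Ring homeomorphisms. Put $A(\zeta_0,r_1,r_2)=\{x\in\mathbb{M}^n: r_1<d(x,\zeta_0)<r_2\}$ and $S(\zeta_0,r)=\{x\in\mathbb{M}^n:d(x,\zeta_0)=r\}$. A mapping $f:G\to\mathbb{M}^n_*$ is a ring $Q$-mapping at $\zeta_0\in G$ with respect to the $p$-modulus if for some $r_0=r_0(\zeta_0)>0$ (depending only on $\zeta_0$, the same for all mappings in the family considered below) and all $0<r_1<r_2<r_0$, with $A=A(\zeta_0,r_1,r_2)$, $$M_p\big(f(\Gamma(S(\zeta_0,r_1),S(\zeta_0,r_2),A))\big)\leqslant\int_A Q(x)\,\eta^p(d(x,\zeta_0))\,dv(x)$$ for every measurable $\eta:(r_1,r_2)\to[0,\infty]$ with $\int_{r_1}^{r_2}\eta(r)\,dr\geqslant1$. ($r_0$ is small enough that $B(\zeta_0,r_0)\subset G$.) $\mathfrak{F}^p_{\zeta_0,Q}(G,\mathbb{M}^n_*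 )$ is the family of all ring $Q$-mappings $f:G\to\mathbb{M}^n_*$ at $\zeta_0$ with respect to the $p$-modulus that are homeomorphisms of $G$ onto a domain $f(G)\subset\mathbb{M}^n_*$. FMO. A function $\varphi$ on $G$ has finite mean oscillation at $\zeta_0$, $\varphi\in FMO(\zeta_0)$, if $\varphi$ is $v$-integrable over $B(\zeta_0,\varepsilon)=\{x\in G:d(x,\zeta_0)<\varepsilon\}$ for some $\varepsilon>0$ and $\limsup_{\varepsilon\to0}\frac1{v(B(\zeta_0,\varepsilon))}\int_{B(\zeta_0,\varepsilon)}|\varphi(x)-\overline{\varphi}_\varepsilon|\,dv(x)<\infty$, where $\overline\varphi_\varepsilon=\frac1{v(B(\zeta_0,\varepsilon))}\int_{B(\zeta_0,\varepsilon)}\varphi\,dv$. Admissible target. A metric measure space $(X,d,\mu)$ is Ahlfors $n$-regular if for some $C\geqslant1$, $\frac1C R^n\leqslant\mu(B(x,R))\leqslant CR^n$ for all $x\in X$ and all $R<\mathrm{diam}\,X$. A Borel function $\rho:X\to[0,\infty]$ is an upper gradient of $u:X\to\mathbb{R}$ if $|u(x)-u(y)|\leqslant\int_\gamma\rho\,|dx|$ for each rectifiable path $\gamma$ joining $x$ and $y$. $X$ admits a $(1;p)$-Poincaré inequality if there are constants $C\geqslant1$, $\tau\geqslant1$ such that $\frac1{\mu(B)}\int_B|u-u_B|\,d\mu\leqslant C(\mathrm{diam}\,B)\big(\frac1{\mu(\tau B)}\int_{\tau B}\rho^p\,d\mu\big)^{1/p}$ for all balls $B$, all bounded continuous $u$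 on $B$ and all upper gradients $\rho$ of $u$, where $u_B$ is the mean value of $u$ over $B$. An $(n,p)$-admissible target (with $n-1<p\leqslant n$) is an Ahlfors $n$-regular, path connected, locally connected, locally compact metric space which supports a $(1;p)$-Poincaré inequality. *)

theory Defs
  imports "HOL-Analysis.Analysis"
begin

section \<open>Smooth maps between Euclidean spaces\<close>

text \<open>Only used for open \<open>S\<close>; iterated directional derivatives, so that in finite dimension
  \<open>C_k_on k f S\<close> is the usual class \<open>C\<^sup>k\<close>.\<close>

primrec C_k_on :: "nat \<Rightarrow> ('a::real_normed_vector \<Rightarrow> 'b::real_normed_vector) \<Rightarrow> 'a set \<Rightarrow> bool" where
  "C_k_on 0 = (\<lambda>f S. continuous_on S f)"
| "C_k_on (Suc k) = (\<lambda>f S. (\<forall>x\<in>S. f differentiable (at x)) \<and>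
     (\<forall>v. C_k_on k (\<lambda>x. frechet_derivative f (at x) v) S))"

definition smooth_on :: "('a::real_normed_vector \<Rightarrow> 'b::real_normed_vector) \<Rightarrow> 'a set \<Rightarrow> bool" where
  "smooth_on f S \<longleftrightarrow> (\<forall>k. C_k_on k f S)"


section \<open>Riemannian manifolds\<close>

text \<open>The manifold is a whole type, carrying its manifold topology; its dimension is
  \<open>CARD('n)\<close>. A chart is a pair of a domain and a coordinate map. The metric tensor is given by
  its Gram matrix at each point with respect to the coordinates of each chart of the atlas.\<close>

type_synonym ('a, 'n) chart = "'a set \<times> ('a \<Rightarrow> real ^ 'n)"

record ('a, 'n) riemannian =
  atlas :: "('a, 'n) chart set"
  metric_tensor :: "('a, 'n) chart \<Rightarrow> 'a \<Rightarrow> real ^ 'n ^ 'n"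

text \<open>The last clause of \<open>metric_tensor_on\<close> is the tensor transformation rule
  \<open>g\<^sub>\<phi> = D\<^sup>T g\<^sub>\<psi> D\<close>, where \<open>D\<close> is the Jacobian of \<open>\<psi> \<circ> \<phi>\<^sup>-\<^sup>1\<close>.\<close>

definition smooth_atlas :: "('a::topological_space, 'n::finite) chart set \<Rightarrow> bool" where
  "smooth_atlas \<A> \<longleftrightarrow>
     (\<Union>(U, \<phi>)\<in>\<A>. U) = UNIV \<and>
     (\<forall>(U, \<phi>)\<in>\<A>. open U \<and> open (\<phi> ` U) \<and> homeomorphism U (\<phi> ` U) \<phi> (inv_into U \<phi>)) \<and>
     (\<forall>(U, \<phi>)\<in>\<A>. \<forall>(V, \<psi>)\<in>\<A>. smooth_on (\<psi> \<circ> inv_into U \<phi>) (\<phi> ` (U \<inter> V)))"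

definition metric_tensor_on ::
    "('a::topological_space, 'n::finite) chart set \<Rightarrow> (('a, 'n) chart \<Rightarrow> 'a \<Rightarrow> real ^ 'n ^ 'n) \<Rightarrow> bool" where
  "metric_tensor_on \<A> g \<longleftrightarrow>
     (\<forall>(U, \<phi>)\<in>\<A>.
        smooth_on (g (U, \<phi>) \<circ> inv_into U \<phi>) (\<phi> ` U) \<and>
        (\<forall>x\<in>U. transpose (g (U, \<phi>) x) = g (U, \<phi>) x \<and>
                (\<forall>w. w \<noteq> 0 \<longrightarrow> 0 < w \<bullet> (g (U, \<phi>) x *v w)))) \<and>
     (\<forall>(U, \<phi>)\<in>\<A>. \<forall>(V, \<psi>)\<in>\<A>. \<forall>x\<in>U \<inter> V.
        let D = matrix (frechet_derivative (\<psi> \<circ> inv_into U \<phi>) (at (\<phi> x)))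
        in g (U, \<phi>) x = transpose D ** g (V, \<psi>) x ** D)"

definition riemannian_manifold ::
    "('a::{t2_space, second_countable_topology}, 'n::finite) riemannian \<Rightarrow> bool" where
  "riemannian_manifold M \<longleftrightarrow> smooth_atlas (atlas M) \<and> metric_tensor_on (atlas M) (metric_tensor M)"

text \<open>Smoothness on a closed interval: in charts, \<open>\<gamma>\<close> is locally the restriction of a smooth map
  defined on an open interval.\<close>

definition smooth_curve_on ::
    "('a::topological_space, 'n::finite) riemannian \<Rightarrow> real set \<Rightarrow> (real \<Rightarrow> 'a) \<Rightarrow> bool" where
  "smooth_curve_on M S \<gamma> \<longleftrightarrow>
     (\<forall>t\<in>S. \<exists>(U, \<phi>)\<in>atlas M. \<exists>J h. open J \<and> t \<in> J \<and> smooth_on h J \<and>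
        (\<forall>s\<in>S \<inter> J. \<gamma> s \<in> U \<and> h s = \<phi> (\<gamma> s)))"

definition piecewise_smooth_path ::
    "('a::topological_space, 'n::finite) riemannian \<Rightarrow> (real \<Rightarrow> 'a) \<Rightarrow> bool" where
  "piecewise_smooth_path M \<gamma> \<longleftrightarrow> path \<gamma> \<and>
     (\<exists>(k::nat) t. t 0 = 0 \<and> t k = 1 \<and>
        (\<forall>i<k. t i < t (Suc i) \<and> smooth_curve_on M {t i..t (Suc i)} \<gamma>))"

text \<open>The speed does not depend on the chart chosen. At the finitely many break points
  its value is irrelevant.\<close>

definition speed ::
    "('a::topological_space, 'n::finite) riemannian \<Rightarrow> (real \<Rightarrow> 'a) \<Rightarrow> real \<Rightarrow> real" where
  "speed M \<gamma> t =
     (let c = (SOME c. c \<in> atlas M \<and> \<gamma> t \<in> fst c);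
          w = vector_derivative (snd c \<circ> \<gamma>) (at t)
      in sqrt (w \<bullet> (metric_tensor M c (\<gamma> t) *v w)))"

definition riemannian_length ::
    "('a::topological_space, 'n::finite) riemannian \<Rightarrow> (real \<Rightarrow> 'a) \<Rightarrow> ennreal" where
  "riemannian_length M \<gamma> = (\<integral>\<^sup>+t\<in>{0..1}. ennreal (speed M \<gamma> t) \<partial>lborel)"

definition geodesic_dist ::
    "('a::topological_space, 'n::finite) riemannian \<Rightarrow> 'a \<Rightarrow> 'a \<Rightarrow> real" where
  "geodesic_dist M x y =
     enn2real (INF \<gamma>\<in>{\<gamma>. piecewise_smooth_path M \<gamma> \<and> \<gamma> 0 = x \<and> \<gamma> 1 = y}. riemannian_length M \<gamma>)"

text \<open>These conditions determine the Borel measure \<open>v\<close> uniquely, and such a measure exists on every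
  Riemannian manifold: the density in local coordinates is \<open>sqrt (det g)\<close>.\<close>

definition is_volume_measure ::
    "('a::topological_space, 'n::finite) riemannian \<Rightarrow> 'a measure \<Rightarrow> bool" where
  "is_volume_measure M v \<longleftrightarrow> sets v = sets borel \<and>
     (\<forall>(U, \<phi>)\<in>atlas M. \<forall>E\<in>sets borel. E \<subseteq> U \<longrightarrow>
        emeasure v E =
          (\<integral>\<^sup>+y\<in>\<phi> ` E. ennreal (sqrt (det (metric_tensor M (U, \<phi>) (inv_into U \<phi> y)))) \<partial>lborel))"

text \<open>\<open>A\<close> lies locally on one side of its boundary, which is locally the zero set of a smooth
  function without critical points.\<close>

definition smooth_boundary ::
    "('a::topological_space, 'n::finite) riemannian \<Rightarrow> 'a set \<Rightarrow> bool" where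
  "smooth_boundary M A \<longleftrightarrow>
     (\<forall>x\<in>frontier A. \<exists>(U, \<phi>)\<in>atlas M. x \<in> U \<and>
        (\<exists>W (h :: real ^ 'n \<Rightarrow> real). open W \<and> \<phi> x \<in> W \<and> W \<subseteq> \<phi> ` U \<and> smooth_on h W \<and>
           (\<forall>y\<in>W. frechet_derivative h (at y) \<noteq> (\<lambda>_. 0)) \<and>
           (\<forall>y\<in>W. inv_into U \<phi> y \<in> A \<longleftrightarrow> h y < 0)))"


section \<open>Metric measure spaces\<close>

text \<open>Here the metric space is \<open>(UNIV, d)\<close>, and all topological notions are those of the
  metric topology.\<close>

abbreviation mtop :: "('a \<Rightarrow> 'a \<Rightarrow> real) \<Rightarrow> 'a topology" where
  "mtop d \<equiv> Metric_space.mtopology UNIV d"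

abbreviation oball :: "('a \<Rightarrow> 'a \<Rightarrow> real) \<Rightarrow> 'a \<Rightarrow> real \<Rightarrow> 'a set" where
  "oball d \<equiv> Metric_space.mball UNIV d"

definition metric_borel :: "('a \<Rightarrow> 'a \<Rightarrow> real) \<Rightarrow> 'a measure" where
  "metric_borel d = sigma UNIV {U. openin (mtop d) U}"

definition ediam :: "('a \<Rightarrow> 'a \<Rightarrow> real) \<Rightarrow> 'a set \<Rightarrow> ennreal" where
  "ediam d S = (SUP x\<in>S. SUP y\<in>S. ennreal (d x y))"

text \<open>Powers with a positive exponent.\<close>

definition epowr :: "ennreal \<Rightarrow> real \<Rightarrow> ennreal" where
  "epowr x a = (if x = top then top else ennreal (enn2real x powr a))"

text \<open>Normalised so that for integer \<open>s\<close> it is the \<open>s\<close>-dimensional volume on \<open>\<real>\<^sup>s\<close>.\<close>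

definition hausdorff_measure :: "('a \<Rightarrow> 'a \<Rightarrow> real) \<Rightarrow> real \<Rightarrow> 'a set \<Rightarrow> ennreal" where
  "hausdorff_measure d s E =
     (SUP \<delta>\<in>{0<..}. INF A\<in>{A :: nat \<Rightarrow> 'a set. E \<subseteq> (\<Union>i. A i) \<and> (\<forall>i. ediam d (A i) \<le> ennreal \<delta>)}.
        \<Sum>i. ennreal (unit_ball_vol s) * epowr (ediam d (A i) / 2) s)"

definition proper_space :: "('a \<Rightarrow> 'a \<Rightarrow> real) \<Rightarrow> bool" where
  "proper_space d \<longleftrightarrow> (\<forall>x r. compactin (mtop d) (Metric_space.mcball UNIV d x r))"


subsection \<open>Path integrals and modulus\<close>

definition curve_length :: "('a \<Rightarrow> 'a \<Rightarrow> real) \<Rightarrow> (real \<Rightarrow> 'a) \<Rightarrow> real \<Rightarrow> real \<Rightarrow> ennreal" where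
  "curve_length d \<gamma> a b =
     (SUP (k, t) \<in> {(k :: nat, t :: nat \<Rightarrow> real). (\<forall>i\<le>k. t i \<in> {a..b}) \<and> (\<forall>i<k. t i \<le> t (Suc i))}.
        \<Sum>i<k. ennreal (d (\<gamma> (t i)) (\<gamma> (t (Suc i)))))"

text \<open>Paths are parametrised by \<open>{0..1}\<close>; on a compact parameter interval locally rectifiable is the
  same as rectifiable.\<close>

definition rectifiable :: "('a \<Rightarrow> 'a \<Rightarrow> real) \<Rightarrow> (real \<Rightarrow> 'a) \<Rightarrow> bool" where
  "rectifiable d \<gamma> \<longleftrightarrow> pathin (mtop d) \<gamma> \<and> curve_length d \<gamma> 0 1 < top"

text \<open>The parametrisation by arc length; parameters \<open>t\<close> with the same value of
  \<open>curve_length d \<gamma> 0 t\<close> have the same image, so the choice is immaterial.\<close>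

definition arclength_param :: "('a \<Rightarrow> 'a \<Rightarrow> real) \<Rightarrow> (real \<Rightarrow> 'a) \<Rightarrow> real \<Rightarrow> 'a" where
  "arclength_param d \<gamma> s = \<gamma> (SOME t. t \<in> {0..1} \<and> curve_length d \<gamma> 0 t = ennreal s)"

definition path_integral :: "('a \<Rightarrow> 'a \<Rightarrow> real) \<Rightarrow> ('a \<Rightarrow> ennreal) \<Rightarrow> (real \<Rightarrow> 'a) \<Rightarrow> ennreal" where
  "path_integral d \<rho> \<gamma> =
     (\<integral>\<^sup>+s\<in>{0..enn2real (curve_length d \<gamma> 0 1)}. \<rho> (arclength_param d \<gamma> s) \<partial>lborel)"

definition modulus ::
    "('a \<Rightarrow> 'a \<Rightarrow> real) \<Rightarrow> 'a measure \<Rightarrow> real \<Rightarrow> (real \<Rightarrow> 'a) set \<Rightarrow> ennreal" where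
  "modulus d \<mu> p \<Gamma> =
     (INF \<rho>\<in>{\<rho>\<in>borel_measurable (metric_borel d). \<forall>\<gamma>\<in>\<Gamma>. rectifiable d \<gamma> \<longrightarrow> 1 \<le> path_integral d \<rho> \<gamma>}.
        \<integral>\<^sup>+x. epowr (\<rho> x) p \<partial>\<mu>)"

text \<open>Endpoints in \<open>E\<close> and \<open>F\<close>, interior of the path in \<open>A\<close> (here \<open>E\<close> and \<open>F\<close> need not meet \<open>A\<close>).\<close>

definition joining_paths ::
    "('a \<Rightarrow> 'a \<Rightarrow> real) \<Rightarrow> 'a set \<Rightarrow> 'a set \<Rightarrow> 'a set \<Rightarrow> (real \<Rightarrow> 'a) set" where
  "joining_paths d E F A =
     {\<gamma>. pathin (mtop d) \<gamma> \<and> \<gamma> 0 \<in> E \<and> \<gamma> 1 \<in> F \<and> (\<forall>t\<in>{0<..<1}. \<gamma> t \<in> A)}"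


subsection \<open>Admissible targets\<close>

definition ahlfors_regular :: "('a \<Rightarrow> 'a \<Rightarrow> real) \<Rightarrow> 'a measure \<Rightarrow> nat \<Rightarrow> bool" where
  "ahlfors_regular d \<mu> n \<longleftrightarrow>
     (\<exists>C\<ge>1. \<forall>x R. 0 < R \<and> ennreal R < ediam d UNIV \<longrightarrow>
        ennreal (R ^ n / C) \<le> emeasure \<mu> (oball d x R) \<and>
        emeasure \<mu> (oball d x R) \<le> ennreal (C * R ^ n))"

definition upper_gradient :: "('a \<Rightarrow> 'a \<Rightarrow> real) \<Rightarrow> ('a \<Rightarrow> ennreal) \<Rightarrow> ('a \<Rightarrow> real) \<Rightarrow> bool" where
  "upper_gradient d \<rho> u \<longleftrightarrow> \<rho> \<in> borel_measurable (metric_borel d) \<and>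
     (\<forall>\<gamma>. rectifiable d \<gamma> \<longrightarrow> ennreal \<bar>u (\<gamma> 0) - u (\<gamma> 1)\<bar> \<le> path_integral d \<rho> \<gamma>)"

definition poincare_inequality :: "('a \<Rightarrow> 'a \<Rightarrow> real) \<Rightarrow> 'a measure \<Rightarrow> real \<Rightarrow> bool" where
  "poincare_inequality d \<mu> p \<longleftrightarrow>
     (\<exists>C\<ge>1. \<exists>\<tau>\<ge>1. \<forall>x r u \<rho>.
        let B = oball d x r; \<tau>B = oball d x (\<tau> * r) in
        0 < r \<and> bounded (u ` B) \<and> continuous_map (subtopology (mtop d) B) euclideanreal u \<and>
        upper_gradient d \<rho> u \<longrightarrow>
        (\<integral>\<^sup>+y\<in>B. ennreal \<bar>u y - (LINT z:B|\<mu>. u z) / measure \<mu> B\<bar> \<partial>\<mu>) / emeasure \<mu> B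
        \<le> ennreal C * ediam d B *
          epowr ((\<integral>\<^sup>+y\<in>\<tau>B. epowr (\<rho> y) p \<partial>\<mu>) / emeasure \<mu> \<tau>B) (1 / p))"

definition admissible_target :: "nat \<Rightarrow> real \<Rightarrow> ('a \<Rightarrow> 'a \<Rightarrow> real) \<Rightarrow> 'a measure \<Rightarrow> bool" where
  "admissible_target n p d \<mu> \<longleftrightarrow> real n - 1 < p \<and> p \<le> real n \<and>
     Metric_space UNIV d \<and> ahlfors_regular d \<mu> n \<and>
     path_connected_space (mtop d) \<and> locally_connected_space (mtop d) \<and>
     locally_compact_space (mtop d) \<and> poincare_inequality d \<mu> p"


subsection \<open>Finite mean oscillation\<close>

text \<open>An integrable extended-real function is almost everywhere finite, so its mean and its
  oscillation are computed from its real part. Measurability with respect to \<open>v\<close> is taken in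
  the completion.\<close>

definition FMO ::
    "('a \<Rightarrow> 'a \<Rightarrow> real) \<Rightarrow> 'a measure \<Rightarrow> 'a set \<Rightarrow> ('a \<Rightarrow> ereal) \<Rightarrow> 'a \<Rightarrow> bool" where
  "FMO d v G \<phi> z \<longleftrightarrow>
     (let B = (\<lambda>\<epsilon>. {x\<in>G. d x z < \<epsilon>});
          f = (\<lambda>x. real_of_ereal (\<phi> x));
          avg = (\<lambda>\<epsilon> h. (LINT x:B \<epsilon>|completion v. h x) / measure (completion v) (B \<epsilon>))
      in (\<exists>\<epsilon>>0. (AE x in v. x \<in> B \<epsilon> \<longrightarrow> \<bar>\<phi> x\<bar> \<noteq> \<infinity>) \<and> set_integrable (completion v) (B \<epsilon>) f) \<and>
         Limsup (at_right 0) (\<lambda>\<epsilon>. ereal (avg \<epsilon> (\<lambda>x. \<bar>f x - avg \<epsilon> f\<bar>))) < \<infinity>)"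


subsection \<open>Ring mappings\<close>

definition ring_dom :: "('a \<Rightarrow> 'a \<Rightarrow> real) \<Rightarrow> 'a \<Rightarrow> real \<Rightarrow> real \<Rightarrow> 'a set" where
  "ring_dom d z r1 r2 = {x. r1 < d x z \<and> d x z < r2}"

definition msphere :: "('a \<Rightarrow> 'a \<Rightarrow> real) \<Rightarrow> 'a \<Rightarrow> real \<Rightarrow> 'a set" where
  "msphere d z r = {x. d x z = r}"

text \<open>The radius \<open>r0\<close> is an explicit parameter, since it is common to the whole family.\<close>

definition ring_Q_mapping ::
    "('a \<Rightarrow> 'a \<Rightarrow> real) \<Rightarrow> 'a measure \<Rightarrow> ('b \<Rightarrow> 'b \<Rightarrow> real) \<Rightarrow> 'b measure \<Rightarrow>
     real \<Rightarrow> 'a \<Rightarrow> real \<Rightarrow> ('a \<Rightarrow> ennreal) \<Rightarrow> ('a \<Rightarrow> 'b) \<Rightarrow> bool" where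
  "ring_Q_mapping d v d' v' r0 z p Q f \<longleftrightarrow>
     (\<forall>r1 r2. 0 < r1 \<and> r1 < r2 \<and> r2 < r0 \<longrightarrow>
        (\<forall>\<eta>\<in>borel_measurable (lebesgue_on {r1<..<r2}).
           1 \<le> (\<integral>\<^sup>+r. \<eta> r \<partial>lebesgue_on {r1<..<r2}) \<longrightarrow>
           modulus d' v' p
             ((\<lambda>\<gamma>. f \<circ> \<gamma>) ` joining_paths d (msphere d z r1) (msphere d z r2) (ring_dom d z r1 r2))
           \<le> (\<integral>\<^sup>+x\<in>ring_dom d z r1 r2. Q x * epowr (\<eta> (d x z)) p \<partial>completion v)))"

definition ring_Q_homeos ::
    "('a::topological_space \<Rightarrow> 'a \<Rightarrow> real) \<Rightarrow> 'a measure \<Rightarrow>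
     ('b::topological_space \<Rightarrow> 'b \<Rightarrow> real) \<Rightarrow> 'b measure \<Rightarrow>
     real \<Rightarrow> 'a \<Rightarrow> real \<Rightarrow> ('a \<Rightarrow> ennreal) \<Rightarrow> 'a set \<Rightarrow> ('a \<Rightarrow> 'b) set" where
  "ring_Q_homeos d v d' v' r0 z p Q G =
     {f. ring_Q_mapping d v d' v' r0 z p Q f \<and>
         open (f ` G) \<and> connected (f ` G) \<and> f ` G \<noteq> {} \<and> (\<exists>g. homeomorphism G (f ` G) f g)}"

end

theory Submission
  imports Defs "HOL-Library.Diagonal_Subsequence" "HOL-Real_Asymp.Real_Asymp"
begin

text \<open>
  Applied to \<open>A = UNIV\<close>, the isoperimetric inequality shows that the target is not
  compact; being proper, it is unbounded, so that Ahlfors regularity holds at all scales.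

  Lower bound: if \<open>E\<close> is connected, contains \<open>x\<close> and \<open>y\<close> and lies in a relatively compact open set \<open>U\<close>,
  then the paths from \<open>E\<close> to the complement of \<open>U\<close> have \<open>p\<close>-modulus at least \<open>c * d x y powr (n - p)\<close>.
  By a Vitali--Caratheodory approximation and a compactness argument for paths it suffices to consider
  bounded densities, whose potentials are Lipschitz. For a potential \<open>w\<close> with upper gradient \<open>g\<close>, the
  Poincare inequality is summed over the balls of radius \<open>2 ^ j * r\<close>, \<open>r = d x y\<close>, around each point of
  \<open>E\<close>. As \<open>p < n\<close>, the large scales contribute at most a multiple of the \<open>p\<close>-energy, so either the energy is
  large or some ball of radius \<open>R \<le> r\<close> carries energy at least \<open>c * r powr (n - p - 1) * R\<close>. The Vitali
  covering lemma, applied to the projections \<open>d x\<close> of these balls to the line, adds up these energies.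

  Upper bound: \<open>Q \<in> FMO\<close> and volume doubling make the averages of \<open>Q\<close> over balls of radius \<open>r\<close> grow at most
  like \<open>log (1 / r)\<close>. As \<open>p < n\<close>, the constant \<open>\<eta> = 2 / r\<close> on \<open>(r / 2, r)\<close> shows that the modulus of the image of
  the ring \<open>A(\<zeta>\<^sub>0, r / 2, r)\<close> tends to \<open>0\<close> along a sequence of radii, uniformly in the family.
\<close>

section \<open>Length of paths in a metric space\<close>

text \<open>The metric is an arbitrary function \<open>d\<close>, not the class operation
  \<open>dist\<close>, since the geodesic distance depends on the manifold.
  \<open>mtopology_eq\<close> identifies its topology with that of the type, so that
  \<open>path\<close>, \<open>compact\<close>, \<open>open\<close> and \<open>borel\<close> apply to
  it.\<close>

locale umetric = Metric_space "UNIV :: 'a set" d for d :: "'a::t2_space \<Rightarrow> 'a \<Rightarrow> real" +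
  assumes mtopology_eq: "mtopology = euclidean"
begin

lemma sum_le_curve_length:
  assumes "\<And>i. i \<le> k \<Longrightarrow> t i \<in> {a..b}" "\<And>i. i < k \<Longrightarrow> t i \<le> t (Suc i)"
  shows "(\<Sum>i<k. ennreal (d (\<gamma> (t i)) (\<gamma> (t (Suc i))))) \<le> curve_length d \<gamma> a b"
  unfolding curve_length_def by (rule SUP_upper2[of "(k, t)"]) (use assms in auto)

lemma curve_length_leI:
  assumes "\<And>k t. (\<And>i. i \<le> k \<Longrightarrow> t i \<in> {a..b}) \<Longrightarrow> (\<And>i. i < k \<Longrightarrow> t i \<le> t (Suc i)) \<Longrightarrow>
     (\<Sum>i<k. ennreal (d (\<gamma> (t i)) (\<gamma> (t (Suc i))))) \<le> B"
  shows "curve_length d \<gamma> a b \<le> B"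
  unfolding curve_length_def by (rule SUP_least) (use assms in auto)

lemma dist_le_curve_length:
  assumes "x \<le> y" "x \<in> {a..b}" "y \<in> {a..b}"
  shows "ennreal (d (\<gamma> x) (\<gamma> y)) \<le> curve_length d \<gamma> a b"
  using sum_le_curve_length[of 1 "\<lambda>i. if i = 0 then x else y" a b \<gamma>] assms by auto

lemma curve_length_cong:
  assumes "\<And>t. t \<in> {a..b} \<Longrightarrow> \<gamma> t = \<beta> t"
  shows "curve_length d \<gamma> a b = curve_length d \<beta> a b"
  unfolding curve_length_def by (rule SUP_cong) (auto simp: assms intro!: sum.cong)

lemma curve_length_comp_mono:
  assumes "mono_on {a..b} s" "\<And>t. t \<in> {a..b} \<Longrightarrow> s t \<in> {a'..b'}"
  shows "curve_length d (\<lambda>t. \<gamma> (s t)) a b \<le> curve_length d \<gamma> a' b'"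
proof (rule curve_length_leI)
  fix k t assume t: "\<And>i. i \<le> k \<Longrightarrow> t i \<in> {a..b}" "\<And>i. i < k \<Longrightarrow> t i \<le> t (Suc i)"
  show "(\<Sum>i<k. ennreal (d (\<gamma> (s (t i))) (\<gamma> (s (t (Suc i)))))) \<le> curve_length d \<gamma> a' b'"
    by (rule sum_le_curve_length[of k "\<lambda>i. s (t i)"])
       (use t assms in \<open>auto simp: Suc_le_eq intro!: mono_onD[OF assms(1)]\<close>)
qed

text \<open>A partition read backwards is again a partition, and \<open>d\<close> is
  symmetric.\<close>

lemma curve_length_comp_antimono:
  assumes "\<And>x y. x \<in> {a..b} \<Longrightarrow> y \<in> {a..b} \<Longrightarrow> x \<le> y \<Longrightarrow> s y \<le> s x" "\<And>t. t \<in> {a..b} \<Longrightarrow> s t \<in> {a'..b'}"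
  shows "curve_length d (\<lambda>t. \<gamma> (s t)) a b \<le> curve_length d \<gamma> a' b'"
proof (rule curve_length_leI)
  fix k t assume t: "\<And>i. i \<le> k \<Longrightarrow> t i \<in> {a..b}" "\<And>i. i < k \<Longrightarrow> t i \<le> t (Suc i)"
  have "(\<Sum>i<k. ennreal (d (\<gamma> (s (t i))) (\<gamma> (s (t (Suc i))))))
      = (\<Sum>i<k. ennreal (d (\<gamma> (s (t (k - Suc i)))) (\<gamma> (s (t (Suc (k - Suc i)))))))"
    by (rule sum.nat_diff_reindex[symmetric])
  also have "\<dots> = (\<Sum>i<k. ennreal (d (\<gamma> (s (t (k - i)))) (\<gamma> (s (t (k - Suc i))))))"
    by (rule sum.cong) (auto simp: Suc_diff_Suc commute)
  also have "\<dots> \<le> curve_length d \<gamma> a' b'"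
  proof (rule sum_le_curve_length[of k "\<lambda>i. s (t (k - i))"])
    fix i assume "i < k"
    then have "t (k - Suc i) \<le> t (k - i)" using t(2)[of "k - Suc i"] by (simp add: Suc_diff_Suc)
    then show "s (t (k - i)) \<le> s (t (k - Suc i))" by (intro assms(1) t(1)) auto
  qed (use t assms in auto)
  finally show "(\<Sum>i<k. ennreal (d (\<gamma> (s (t i))) (\<gamma> (s (t (Suc i)))))) \<le> curve_length d \<gamma> a' b'" .
qed

lemma curve_length_mono: "a \<le> a' \<Longrightarrow> b' \<le> b \<Longrightarrow> curve_length d \<gamma> a' b' \<le> curve_length d \<gamma> a b"
  using curve_length_comp_mono[of a' b' id a b \<gamma>] by (auto simp: mono_on_def)

lemma curve_length_affine:
  assumes "m > 0"
  shows "curve_length d (\<lambda>t. \<gamma> (m * t + q)) a b = curve_length d \<gamma> (m * a + q) (m * b + q)"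
proof (rule antisym)
  show "curve_length d (\<lambda>t. \<gamma> (m * t + q)) a b \<le> curve_length d \<gamma> (m * a + q) (m * b + q)"
    by (rule curve_length_comp_mono) (use assms in \<open>auto simp: mono_on_def\<close>)
  have "curve_length d (\<lambda>t. (\<lambda>t. \<gamma> (m * t + q)) ((t - q) / m)) (m * a + q) (m * b + q)
      \<le> curve_length d (\<lambda>t. \<gamma> (m * t + q)) a b"
    by (rule curve_length_comp_mono) (use assms in \<open>auto simp: mono_on_def divide_simps mult.commute\<close>)
  then show "curve_length d \<gamma> (m * a + q) (m * b + q) \<le> curve_length d (\<lambda>t. \<gamma> (m * t + q)) a b"
    using assms by simp
qed

lemma curve_length_reflect:
  "curve_length d (\<lambda>t. \<gamma> (q - t)) a b = curve_length d \<gamma> (q - b) (q - a)"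
proof (rule antisym)
  show "curve_length d (\<lambda>t. \<gamma> (q - t)) a b \<le> curve_length d \<gamma> (q - b) (q - a)"
    by (rule curve_length_comp_antimono) auto
  have "curve_length d (\<lambda>t. (\<lambda>t. \<gamma> (q - t)) (q - t)) (q - b) (q - a) \<le> curve_length d (\<lambda>t. \<gamma> (q - t)) a b"
    by (rule curve_length_comp_antimono) auto
  then show "curve_length d \<gamma> (q - b) (q - a) \<le> curve_length d (\<lambda>t. \<gamma> (q - t)) a b" by simp
qed

text \<open>Clipping at b stands in for inserting b into a partition: \<open>min\<close> and
  \<open>max\<close> send a monotone sequence to monotone sequences on either side of b. If b lies
  between x and y this is the triangle inequality through the point at b; otherwise one of the two
  summands vanishes.\<close>

lemma dist_split:
  assumes "x \<le> (y::real)"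
  shows "d (\<gamma> x) (\<gamma> y) \<le> d (\<gamma> (min x b)) (\<gamma> (min y b)) + d (\<gamma> (max x b)) (\<gamma> (max y b))"
  using assms triangle[of "\<gamma> x" "\<gamma> b" "\<gamma> y"] by (auto simp: min_def max_def)

lemma curve_length_add:
  assumes "a \<le> b" "b \<le> c"
  shows "curve_length d \<gamma> a c = curve_length d \<gamma> a b + curve_length d \<gamma> b c"
proof (rule antisym)
  show "curve_length d \<gamma> a c \<le> curve_length d \<gamma> a b + curve_length d \<gamma> b c"
  proof (rule curve_length_leI)
    fix k t assume t: "\<And>i. i \<le> k \<Longrightarrow> t i \<in> {a..c}" "\<And>i. i < k \<Longrightarrow> t i \<le> t (Suc i)"
    have "(\<Sum>i<k. ennreal (d (\<gamma> (t i)) (\<gamma> (t (Suc i))))) \<le>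
       (\<Sum>i<k. ennreal (d (\<gamma> (min (t i) b)) (\<gamma> (min (t (Suc i)) b)))
         + ennreal (d (\<gamma> (max (t i) b)) (\<gamma> (max (t (Suc i)) b))))"
      by (rule sum_mono) (use t in \<open>auto simp flip: ennreal_plus intro!: ennreal_leI dist_split\<close>)
    also have "\<dots> = (\<Sum>i<k. ennreal (d (\<gamma> (min (t i) b)) (\<gamma> (min (t (Suc i)) b))))
         + (\<Sum>i<k. ennreal (d (\<gamma> (max (t i) b)) (\<gamma> (max (t (Suc i)) b))))"
      by (rule sum.distrib)
    also have "\<dots> \<le> curve_length d \<gamma> a b + curve_length d \<gamma> b c"
      by (intro add_mono sum_le_curve_length[of k "\<lambda>i. min (t i) b"] sum_le_curve_length[of k "\<lambda>i. max (t i) b"])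
         (use t assms in \<open>fastforce simp: min_def max_def\<close>)+
    finally show "(\<Sum>i<k. ennreal (d (\<gamma> (t i)) (\<gamma> (t (Suc i))))) \<le> curve_length d \<gamma> a b + curve_length d \<gamma> b c" .
  qed
  let ?S = "\<lambda>a b. {(k :: nat, t :: nat \<Rightarrow> real). (\<forall>i\<le>k. t i \<in> {a..b}) \<and> (\<forall>i<k. t i \<le> t (Suc i))}"
  let ?f = "\<lambda>(k, t). \<Sum>i<k. ennreal (d (\<gamma> (t i)) (\<gamma> (t (Suc i))))"
  have ne: "?S a b \<noteq> {}" if "a \<le> b" for a b using that by (auto intro!: exI[of _ 0] exI[of _ "\<lambda>_. a"])
  have comb: "?f x + ?f y \<le> curve_length d \<gamma> a c" if "x \<in> ?S a b" "y \<in> ?S b c" for x y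
  proof -
    obtain k t l s where xy: "x = (k, t)" "y = (l, s)" by (cases x, cases y) auto
    let ?D = "\<lambda>r i. ennreal (d (\<gamma> (r i)) (\<gamma> (r (Suc i))))"
    \<comment> \<open>The partitions are concatenated without merging at b: the extra interval from
      \<open>t k\<close> to \<open>s 0\<close> has index k and can only increase the sum, so the
      second partition starts at index \<open>Suc k\<close>.\<close>
    define r where "r = (\<lambda>i. if i \<le> k then t i else s (i - Suc k))"
    have t: "\<forall>i\<le>k. t i \<in> {a..b}" "\<forall>i<k. t i \<le> t (Suc i)" and s: "\<forall>i\<le>l. s i \<in> {b..c}" "\<forall>i<l. s i \<le> s (Suc i)"
      using that xy by auto
    have split: "sum f {..<m+n} = sum f {..<m} + (\<Sum>i<n. f (m+i))" for f :: "nat \<Rightarrow> ennreal" and m n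
      by (induction n) (auto simp: add.assoc)
    have "?f x + ?f y = (\<Sum>i<k. ?D r i) + (\<Sum>i<l. ?D r (Suc k + i))"
      using xy by (auto simp: r_def intro!: arg_cong2[where f="(+)"] sum.cong)
    also have "\<dots> \<le> (\<Sum>i<Suc k. ?D r i) + (\<Sum>i<l. ?D r (Suc k + i))"
      by (intro add_mono) auto
    also have "\<dots> = (\<Sum>i<Suc k + l. ?D r i)" by (rule split[symmetric])
    also have "\<dots> \<le> curve_length d \<gamma> a c"
    proof (rule sum_le_curve_length)
      fix i assume i: "i \<le> Suc k + l"
      show "r i \<in> {a..c}"
      proof (cases "i \<le> k")
        case True then have "t i \<in> {a..b}" using t by blast
        then show ?thesis using True assms by (auto simp: r_def)
      next
        case False then have "s (i - Suc k) \<in> {b..c}" using s i by simp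
        then show ?thesis using False assms by (auto simp: r_def)
      qed
    next
      fix i assume i: "i < Suc k + l"
      consider "i < k" | "i = k" | "i > k" by linarith
      then show "r i \<le> r (Suc i)"
      proof cases
        case 2
        have "t k \<in> {a..b}" "s 0 \<in> {b..c}" using t s by blast+
        then show ?thesis using 2 by (auto simp: r_def)
      next
        case 3
        then have "s (i - Suc k) \<le> s (Suc (i - Suc k))" using s i by auto
        moreover have "Suc (i - Suc k) = i - k" using 3 by simp
        ultimately show ?thesis using 3 by (simp add: r_def)
      qed (use t in \<open>auto simp: r_def\<close>)
    qed
    finally show ?thesis .
  qed
  have "curve_length d \<gamma> a b + curve_length d \<gamma> b c = (SUP x\<in>?S a b. ?f x + curve_length d \<gamma> b c)"
    unfolding curve_length_def using ne[OF assms(1)] by (intro ennreal_SUP_add_left[symmetric]) auto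
  also have "\<dots> = (SUP x\<in>?S a b. SUP y\<in>?S b c. ?f x + ?f y)"
  proof -
    have "?f x + curve_length d \<gamma> b c = (SUP y\<in>?S b c. ?f x + ?f y)" for x
      unfolding curve_length_def by (rule ennreal_SUP_add_right) (rule ne[OF assms(2)])
    then show ?thesis by presburger
  qed
  also have "\<dots> \<le> curve_length d \<gamma> a c"
    by (intro SUP_least comb)
  finally show "curve_length d \<gamma> a b + curve_length d \<gamma> b c \<le> curve_length d \<gamma> a c" .
qed

text \<open>Take a partition whose sum exceeds the length minus e / 2, and a point u < b at or
  beyond all its points other than b, so near to b that the path moves by less than e / 2 between u
  and b. Clipping the partition at u loses only this distance, hence the length up to u exceeds the
  total minus e, and additivity leaves less than e for {u..b}.\<close>

lemma curve_length_small_left: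
  assumes ab: "a < b" and fin: "curve_length d \<gamma> a b < top" and e: "e > 0"
    and cont: "\<And>e. e > 0 \<Longrightarrow> \<exists>\<delta>>0. \<forall>x\<in>{a..b}. \<bar>x - b\<bar> < \<delta> \<longrightarrow> d (\<gamma> x) (\<gamma> b) < e"
  shows "\<exists>u\<in>{a..<b}. curve_length d \<gamma> u b < ennreal e"
proof -
  define L where "L = enn2real (curve_length d \<gamma> a b)"
  have L: "curve_length d \<gamma> a b = ennreal L" "0 \<le> L" using fin by (auto simp: L_def)
  obtain \<delta> where \<delta>: "\<delta> > 0" "\<And>x. x \<in> {a..b} \<Longrightarrow> \<bar>x - b\<bar> < \<delta> \<Longrightarrow> d (\<gamma> x) (\<gamma> b) < e / 2"
    using cont[of "e/2"] e by auto
  have "\<exists>k t. (\<forall>i\<le>k. t i \<in> {a..b}) \<and> (\<forall>i<k. t i \<le> t (Suc i)) \<and> L < (\<Sum>i<k. d (\<gamma> (t i)) (\<gamma> (t (Suc i)))) + e / 2"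
  proof (rule ccontr)
    assume H: "\<not> ?thesis"
    have "curve_length d \<gamma> a b \<le> ennreal (L - e / 2)"
    proof (rule curve_length_leI)
      fix k and t :: "nat \<Rightarrow> real" assume "\<And>i. i \<le> k \<Longrightarrow> t i \<in> {a..b}" "\<And>i. i < k \<Longrightarrow> t i \<le> t (Suc i)"
      then have "\<not> L < (\<Sum>i<k. d (\<gamma> (t i)) (\<gamma> (t (Suc i)))) + e / 2" using H by blast
      then show "(\<Sum>i<k. ennreal (d (\<gamma> (t i)) (\<gamma> (t (Suc i))))) \<le> ennreal (L - e / 2)"
        by (subst sum_ennreal) (auto intro!: ennreal_leI)
    qed
    then have "ennreal L \<le> ennreal (L - e / 2)" using L by simp
    \<comment> \<open>Needed because \<open>ennreal\<close> sends negative numbers to 0; the bound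
      comes from the partition without intervals.\<close>
    moreover have "L \<ge> e / 2"
      using H[simplified, rule_format, of 0 "\<lambda>_. a"] ab by auto
    ultimately show False using e by (auto simp: ennreal_le_iff)
  qed
  then obtain k t where t: "\<And>i. i\<le>k \<Longrightarrow> t i \<in> {a..b}" "\<And>i. i<k \<Longrightarrow> t i \<le> t (Suc i)"
    and tL: "L < (\<Sum>i<k. d (\<gamma> (t i)) (\<gamma> (t (Suc i)))) + e / 2" by blast
  let ?T = "insert (max a (b - \<delta>/2)) (t ` {i. i \<le> k \<and> t i < b})"
  define u where "u = Max ?T"
  have fT: "finite ?T" by auto
  have uT: "u \<in> ?T" unfolding u_def by (rule Max_in) auto
  have "max a (b - \<delta>/2) \<le> u" unfolding u_def by (rule Max_ge[OF fT]) simp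
  then have u: "u \<ge> a" "u \<ge> b - \<delta>/2" "u < b" and tu: "\<And>i. i \<le> k \<Longrightarrow> t i < b \<Longrightarrow> t i \<le> u"
    using Max_ge[OF fT, folded u_def] uT ab \<delta> by auto
  have dub: "d (\<gamma> u) (\<gamma> b) < e / 2" using \<delta> u by auto
  \<comment> \<open>To the right of u the clipped points take only the values u and b, so the sum of
    their distances telescopes and counts the step from u to b at most once.\<close>
  define f where "f = (\<lambda>w::real. if w = b then d (\<gamma> u) (\<gamma> b) else 0)"
  have w: "max (t i) u = u \<or> max (t i) u = b" if "i \<le> k" for i
    using t(1)[OF that] tu[OF that] u by (cases "t i < b") (auto simp: max_def)
  have d2: "d (\<gamma> (max (t i) u)) (\<gamma> (max (t (Suc i)) u)) = f (max (t (Suc i)) u) - f (max (t i) u)"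
    if "i < k" for i
    using w[of i] w[of "Suc i"] that t(2)[OF that] u unfolding f_def by (auto simp: max_def split: if_splits)
  have "(\<Sum>i<k. d (\<gamma> (t i)) (\<gamma> (t (Suc i)))) \<le> (\<Sum>i<k. d (\<gamma> (min (t i) u)) (\<gamma> (min (t (Suc i)) u))
          + d (\<gamma> (max (t i) u)) (\<gamma> (max (t (Suc i)) u)))"
    by (intro sum_mono dist_split) (use t in auto)
  also have "\<dots> = (\<Sum>i<k. d (\<gamma> (min (t i) u)) (\<gamma> (min (t (Suc i)) u))) + (f (max (t k) u) - f (max (t 0) u))"
    by (simp add: sum.distrib d2 sum_lessThan_telescope[of "\<lambda>i. f (max (t i) u)"])
  also have "\<dots> \<le> (\<Sum>i<k. d (\<gamma> (min (t i) u)) (\<gamma> (min (t (Suc i)) u))) + d (\<gamma> u) (\<gamma> b)"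
    unfolding f_def by auto
  finally have S: "L < (\<Sum>i<k. d (\<gamma> (min (t i) u)) (\<gamma> (min (t (Suc i)) u))) + e" (is "L < ?S + e")
    using tL dub by linarith
  have "ennreal ?S = (\<Sum>i<k. ennreal (d (\<gamma> (min (t i) u)) (\<gamma> (min (t (Suc i)) u))))"
    by (simp add: sum_ennreal)
  also have "\<dots> \<le> curve_length d \<gamma> a u"
    by (rule sum_le_curve_length[of k "\<lambda>i. min (t i) u"]) (use t u in \<open>fastforce simp: min_def\<close>)+
  finally have "ennreal ?S + curve_length d \<gamma> u b \<le> ennreal L"
    using curve_length_add[of a u b \<gamma>] u L by (metis add_right_mono less_imp_le)
  moreover have Sn: "0 \<le> ?S" by (intro sum_nonneg) auto
  moreover have "curve_length d \<gamma> u b < top"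
    using curve_length_mono[of a u b b \<gamma>] u fin by (auto intro: le_less_trans)
  then obtain l where l: "curve_length d \<gamma> u b = ennreal l" "0 \<le> l"
    by (cases "curve_length d \<gamma> u b") auto
  ultimately have "?S + l \<le> L" using L by (simp flip: ennreal_plus)
  then have "l < e" using S by linarith
  then have "curve_length d \<gamma> u b < ennreal e" using l by (simp add: ennreal_lessI e)
  then show ?thesis using u by auto
qed

lemma curve_length_small_right:
  assumes ab: "a < b" and fin: "curve_length d \<gamma> a b < top" and e: "e > 0"
    and cont: "\<And>e. e > 0 \<Longrightarrow> \<exists>\<delta>>0. \<forall>x\<in>{a..b}. \<bar>x - a\<bar> < \<delta> \<longrightarrow> d (\<gamma> x) (\<gamma> a) < e"
  shows "\<exists>u\<in>{a<..b}. curve_length d \<gamma> a u < ennreal e"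
proof -
  have "\<exists>u\<in>{a..<b}. curve_length d (\<lambda>t. \<gamma> (a + b - t)) u b < ennreal e"
  proof (rule curve_length_small_left)
    show "curve_length d (\<lambda>t. \<gamma> (a + b - t)) a b < top"
      using fin by (simp add: curve_length_reflect)
    fix e :: real assume "e > 0"
    then obtain \<delta> where \<delta>: "\<delta>>0" "\<forall>x\<in>{a..b}. \<bar>x - a\<bar> < \<delta> \<longrightarrow> d (\<gamma> x) (\<gamma> a) < e" using cont by blast
    have "d (\<gamma> (a + b - x)) (\<gamma> a) < e" if "x \<in> {a..b}" "\<bar>x - b\<bar> < \<delta>" for x
      using that \<delta>(2)[rule_format, of "a + b - x"] by auto
    then show "\<exists>\<delta>>0. \<forall>x\<in>{a..b}. \<bar>x - b\<bar> < \<delta> \<longrightarrow> d (\<gamma> (a + b - x)) (\<gamma> (a + b - b)) < e"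
      using \<delta>(1) by auto
  qed (use ab e in auto)
  then obtain u where "u\<in>{a..<b}" "curve_length d \<gamma> a (a + b - u) < ennreal e"
    by (auto simp: curve_length_reflect)
  then show ?thesis by (intro bexI[of _ "a + b - u"]) auto
qed

end

section \<open>Topology of the metric and parametrisation by arc length\<close>

context umetric begin

lemma metric_borel_eq: "metric_borel d = borel"
  unfolding metric_borel_def borel_def mtopology_eq by simp

lemma pathin_eq_path: "pathin mtopology \<gamma> \<longleftrightarrow> path \<gamma>"
  by (simp add: mtopology_eq pathin_def path_def)

lemma open_mball: "open (mball x r)"
  using openin_mball[of x r] by (simp add: mtopology_eq)

lemma closed_mcball: "closed (mcball x r)"
  using closedin_mcball[of x r] by (simp add: mtopology_eq)

lemma open_iff_mball: "open U \<longleftrightarrow> (\<forall>x\<in>U. \<exists>r>0. mball x r \<subseteq> U)"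
  using openin_mtopology[of U] by (simp add: mtopology_eq Ball_def)

lemma continuous_on_into_iff:
  fixes f :: "'b::topological_space \<Rightarrow> 'a"
  shows "continuous_on S f \<longleftrightarrow> (\<forall>x\<in>S. \<forall>e>0. \<exists>U. open U \<and> x \<in> U \<and> (\<forall>y\<in>U \<inter> S. d (f x) (f y) < e))"
proof
  assume f: "continuous_on S f"
  show "\<forall>x\<in>S. \<forall>e>0. \<exists>U. open U \<and> x \<in> U \<and> (\<forall>y\<in>U \<inter> S. d (f x) (f y) < e)"
  proof (intro ballI allI impI)
    fix x and e :: real assume "x \<in> S" "e > 0"
    then show "\<exists>U. open U \<and> x \<in> U \<and> (\<forall>y\<in>U \<inter> S. d (f x) (f y) < e)"
      using f[unfolded continuous_on_topological, rule_format, of x "mball (f x) e"] open_mball by auto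
  qed
next
  assume H: "\<forall>x\<in>S. \<forall>e>0. \<exists>U. open U \<and> x \<in> U \<and> (\<forall>y\<in>U \<inter> S. d (f x) (f y) < e)"
  show "continuous_on S f"
    unfolding continuous_on_topological
  proof (intro ballI allI impI)
    fix x B assume "x \<in> S" "open B" "f x \<in> B"
    then obtain e where "e > 0" "mball (f x) e \<subseteq> B" using open_iff_mball by blast
    then show "\<exists>A. open A \<and> x \<in> A \<and> (\<forall>y\<in>S. y \<in> A \<longrightarrow> f y \<in> B)"
      using H[rule_format, OF \<open>x \<in> S\<close> \<open>e > 0\<close>] by (auto simp: subset_eq)
  qed
qed

lemma continuous_on_into_real:
  fixes f :: "'b::metric_space \<Rightarrow> 'a"
  shows "continuous_on S f \<longleftrightarrow> (\<forall>x\<in>S. \<forall>e>0. \<exists>\<delta>>0. \<forall>y\<in>S. dist y x < \<delta> \<longrightarrow> d (f y) (f x) < e)"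
  unfolding continuous_on_into_iff
proof (intro ball_cong refl all_cong1 imp_cong iffI)
  fix x and e :: real assume "\<exists>U. open U \<and> x \<in> U \<and> (\<forall>y\<in>U \<inter> S. d (f x) (f y) < e)"
  then obtain U where U: "open U" "x \<in> U" "\<forall>y\<in>U \<inter> S. d (f x) (f y) < e" by blast
  then obtain \<delta> where "\<delta> > 0" "\<forall>y. dist y x < \<delta> \<longrightarrow> y \<in> U" using open_dist by metis
  then show "\<exists>\<delta>>0. \<forall>y\<in>S. dist y x < \<delta> \<longrightarrow> d (f y) (f x) < e"
    using U(3) by (intro exI[of _ \<delta>]) (auto simp: commute)
next
  fix x and e :: real assume "\<exists>\<delta>>0. \<forall>y\<in>S. dist y x < \<delta> \<longrightarrow> d (f y) (f x) < e"
  then obtain \<delta> where "\<delta>>0" "\<forall>y\<in>S. dist y x < \<delta> \<longrightarrow> d (f y) (f x) < e" by blast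
  then show "\<exists>U. open U \<and> x \<in> U \<and> (\<forall>y\<in>U \<inter> S. d (f x) (f y) < e)"
    by (intro exI[of _ "ball x \<delta>"]) (auto simp: commute dist_commute)
qed

lemma dist_diff_le: "\<bar>d x a - d y a\<bar> \<le> d x y"
  using triangle[of x y a] triangle[of y x a] by (auto simp: commute)

lemma continuous_on_from:
  fixes f :: "'a \<Rightarrow> real"
  assumes "\<And>x e. x \<in> S \<Longrightarrow> e > 0 \<Longrightarrow> \<exists>\<delta>>0. \<forall>y\<in>S. d x y < \<delta> \<longrightarrow> \<bar>f y - f x\<bar> < e"
  shows "continuous_on S f"
  unfolding continuous_on_topological
proof (intro ballI allI impI)
  fix x B assume x: "x \<in> S" "open B" "f x \<in> B"
  then obtain e where e: "e > 0" "\<And>z. \<bar>z - f x\<bar> < e \<Longrightarrow> z \<in> B" by (auto simp: open_real)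
  then obtain \<delta> where "\<delta>>0" "\<forall>y\<in>S. d x y < \<delta> \<longrightarrow> \<bar>f y - f x\<bar> < e" using assms x by blast
  then show "\<exists>A. open A \<and> x \<in> A \<and> (\<forall>y\<in>S. y \<in> A \<longrightarrow> f y \<in> B)"
    using open_mball e by (intro exI[of _ "mball x \<delta>"]) auto
qed

lemma continuous_on_dist: "continuous_on S (\<lambda>x. d x a)"
proof (rule continuous_on_from)
  fix x and e :: real assume "e > 0"
  then show "\<exists>\<delta>>0. \<forall>y\<in>S. d x y < \<delta> \<longrightarrow> \<bar>d y a - d x a\<bar> < e"
    using dist_diff_le[of _ a x] by (intro exI[of _ e]) (auto simp: commute intro: le_less_trans)
qed

lemma rectifiable_iff: "rectifiable d \<gamma> \<longleftrightarrow> path \<gamma> \<and> curve_length d \<gamma> 0 1 < top"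
  by (simp add: rectifiable_def pathin_eq_path)

definition arc_len :: "(real \<Rightarrow> 'a) \<Rightarrow> real \<Rightarrow> real" where
  "arc_len \<gamma> t = enn2real (curve_length d \<gamma> 0 t)"

text \<open>Clamping the argument to the range of arc length makes the parametrisation 1-Lipschitz
  on the whole line, hence Borel measurable; on the domain of integration of
  \<open>path_integral\<close> nothing changes.\<close>

definition unit_param :: "(real \<Rightarrow> 'a) \<Rightarrow> real \<Rightarrow> 'a" where
  "unit_param \<gamma> s = arclength_param d \<gamma> (max 0 (min (arc_len \<gamma> 1) s))"

lemma curve_length_trivial: "curve_length d \<gamma> a a = 0"
proof -
  have "curve_length d \<gamma> a a \<le> 0"
    by (rule curve_length_leI) auto
  then show ?thesis by simp
qed

lemma arc_0 [simp]: "arc_len \<gamma> 0 = 0"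
  by (simp add: arc_len_def curve_length_trivial)

context
  fixes \<gamma> assumes \<gamma>: "rectifiable d \<gamma>"
begin

lemma curve_length_finite: "0 \<le> a \<Longrightarrow> b \<le> 1 \<Longrightarrow> curve_length d \<gamma> a b < top"
  using curve_length_mono[of 0 a b 1 \<gamma>] \<gamma> by (auto simp: rectifiable_iff)

lemma curve_length_0_eq: "t \<le> 1 \<Longrightarrow> curve_length d \<gamma> 0 t = ennreal (arc_len \<gamma> t)"
  unfolding arc_len_def using curve_length_finite[of 0 t] by auto

lemma arc_mono: "a \<le> b \<Longrightarrow> b \<le> 1 \<Longrightarrow> arc_len \<gamma> a \<le> arc_len \<gamma> b"
  unfolding arc_len_def using curve_length_finite[of 0 b] curve_length_mono[of 0 0 a b \<gamma>]
  by (auto intro!: enn2real_mono)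

lemma curve_length_eq_arc:
  assumes "0 \<le> a" "a \<le> b" "b \<le> 1"
  shows "curve_length d \<gamma> a b = ennreal (arc_len \<gamma> b - arc_len \<gamma> a)"
proof -
  obtain l where l: "curve_length d \<gamma> a b = ennreal l" "0 \<le> l"
    using curve_length_finite[of a b] assms by (cases "curve_length d \<gamma> a b") auto
  have "ennreal (arc_len \<gamma> b) = ennreal (arc_len \<gamma> a) + ennreal l"
    using curve_length_add[of 0 a b \<gamma>] assms curve_length_0_eq[of a] curve_length_0_eq[of b] l by simp
  then have "arc_len \<gamma> b = arc_len \<gamma> a + l"
    using l by (simp add: arc_len_def flip: ennreal_plus)
  then show ?thesis using l by simp
qed

lemma dist_le_arc:
  assumes "0 \<le> a" "a \<le> b" "b \<le> 1"
  shows "d (\<gamma> a) (\<gamma> b) \<le> arc_len \<gamma> b - arc_len \<gamma> a"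
  using dist_le_curve_length[of a b a b \<gamma>] curve_length_eq_arc[OF assms] assms arc_mono[of a b]
  by (simp add: ennreal_le_iff)

lemma path_cont: 
  assumes "t \<in> {0..1}" "e > 0"
  obtains \<delta> where "\<delta> > 0" "\<And>x. x \<in> {0..1} \<Longrightarrow> \<bar>x - t\<bar> < \<delta> \<Longrightarrow> d (\<gamma> x) (\<gamma> t) < e"
proof -
  have "continuous_on {0..1} \<gamma>" using \<gamma> by (simp add: rectifiable_iff path_def)
  then show ?thesis
    using that assms unfolding continuous_on_into_real dist_real_def by meson
qed

text \<open>By the intermediate value theorem every number between 0 and the total length is then an
  arc length (\<open>arc_surj\<close>), so that the \<open>SOME\<close> in
  \<open>arclength_param\<close> denotes an actual parameter. Continuity itself says that short
  pieces on either side of a parameter have small length.\<close>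

lemma continuous_on_arc: "continuous_on {0..1} (arc_len \<gamma>)"
  unfolding continuous_on_iff
proof (intro ballI allI impI)
  fix t e :: real assume t: "t \<in> {0..1}" and e: "e > 0"
  have L: "\<exists>\<delta>>0. \<forall>x\<in>{0..1}. x \<le> t \<and> t - x < \<delta> \<longrightarrow> arc_len \<gamma> t - arc_len \<gamma> x < e"
  proof (cases "t = 0")
    case False
    have "\<exists>u\<in>{0..<t}. curve_length d \<gamma> u t < ennreal e"
    proof (rule curve_length_small_left)
      fix e :: real assume "e > 0"
      with t obtain \<delta> where "\<delta> > 0" "\<And>x. x \<in> {0..1} \<Longrightarrow> \<bar>x - t\<bar> < \<delta> \<Longrightarrow> d (\<gamma> x) (\<gamma> t) < e"
        using path_cont by metis
      with t show "\<exists>\<delta>>0. \<forall>x\<in>{0..t}. \<bar>x - t\<bar> < \<delta> \<longrightarrow> d (\<gamma> x) (\<gamma> t) < e" by auto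
    qed (use False t e curve_length_finite[of 0 t] in auto)
    then obtain u where u: "u \<in> {0..<t}" "curve_length d \<gamma> u t < ennreal e" by blast
    have "arc_len \<gamma> t - arc_len \<gamma> u < e"
      using u t e curve_length_eq_arc[of u t] by (simp add: ennreal_less_iff arc_mono)
    then show ?thesis using u t arc_mono by (intro exI[of _ "t - u"]) (auto intro: le_less_trans[rotated] simp: arc_mono)
  qed (use e in \<open>auto intro!: exI[of _ 1]\<close>)
  have R: "\<exists>\<delta>>0. \<forall>x\<in>{0..1}. t \<le> x \<and> x - t < \<delta> \<longrightarrow> arc_len \<gamma> x - arc_len \<gamma> t < e"
  proof (cases "t = 1")
    case False
    have "\<exists>u\<in>{t<..1}. curve_length d \<gamma> t u < ennreal e"
    proof (rule curve_length_small_right)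
      fix e :: real assume "e > 0"
      with t obtain \<delta> where "\<delta> > 0" "\<And>x. x \<in> {0..1} \<Longrightarrow> \<bar>x - t\<bar> < \<delta> \<Longrightarrow> d (\<gamma> x) (\<gamma> t) < e"
        using path_cont by metis
      with t show "\<exists>\<delta>>0. \<forall>x\<in>{t..1}. \<bar>x - t\<bar> < \<delta> \<longrightarrow> d (\<gamma> x) (\<gamma> t) < e" by auto
    qed (use False t e curve_length_finite[of t 1] in auto)
    then obtain u where u: "u \<in> {t<..1}" "curve_length d \<gamma> t u < ennreal e" by blast
    have "arc_len \<gamma> u - arc_len \<gamma> t < e"
      using u t e curve_length_eq_arc[of t u] by (simp add: ennreal_less_iff arc_mono)
    then show ?thesis using u t arc_mono by (intro exI[of _ "u - t"]) (auto intro: le_less_trans[rotated] simp: arc_mono)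
  qed (use e in \<open>auto intro!: exI[of _ 1]\<close>)
  from L R obtain \<delta>1 \<delta>2 where \<delta>: "\<delta>1 > 0" "\<delta>2 > 0"
    "\<forall>x\<in>{0..1}. x \<le> t \<and> t - x < \<delta>1 \<longrightarrow> arc_len \<gamma> t - arc_len \<gamma> x < e"
    "\<forall>x\<in>{0..1}. t \<le> x \<and> x - t < \<delta>2 \<longrightarrow> arc_len \<gamma> x - arc_len \<gamma> t < e" by blast
  show "\<exists>\<delta>>0. \<forall>x'\<in>{0..1}. dist x' t < \<delta> \<longrightarrow> dist (arc_len \<gamma> x') (arc_len \<gamma> t) < e"
  proof (intro exI[of _ "min \<delta>1 \<delta>2"] conjI ballI impI)
    fix x assume x: "x \<in> {0..1}" "dist x t < min \<delta>1 \<delta>2"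
    show "dist (arc_len \<gamma> x) (arc_len \<gamma> t) < e"
    proof (cases "x \<le> t")
      case True
      then show ?thesis using x \<delta>(3)[rule_format, of x] arc_mono[of x t] t by (auto simp: dist_real_def)
    next
      case False
      then show ?thesis using x \<delta>(4)[rule_format, of x] arc_mono[of t x] t by (auto simp: dist_real_def)
    qed
  qed (use \<delta> in auto)
qed

lemma arc_surj:
  assumes "s \<in> {0..arc_len \<gamma> 1}" obtains t where "t \<in> {0..1}" "arc_len \<gamma> t = s"
  using IVT'[of "arc_len \<gamma>" 0 s 1] assms continuous_on_arc by auto

text \<open>Two parameters with the same arc length bound a piece of length 0, and its chord is no
  longer than that.\<close>

lemma arclength_param_eqI:
  assumes "t \<in> {0..1}" "arc_len \<gamma> t = s" shows "arclength_param d \<gamma> s = \<gamma> t"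
proof -
  define u where "u = (SOME t. t \<in> {0..1} \<and> curve_length d \<gamma> 0 t = ennreal s)"
  have "u \<in> {0..1} \<and> curve_length d \<gamma> 0 u = ennreal s"
    unfolding u_def by (rule someI[of _ t]) (use assms curve_length_0_eq in auto)
  then have u: "u \<in> {0..1}" "arc_len \<gamma> u = s"
    using assms by (auto simp: arc_len_def)
  have "d (\<gamma> u) (\<gamma> t) \<le> 0"
    using dist_le_arc[of u t] dist_le_arc[of t u] u assms by (cases "u \<le> t") (auto simp: commute)
  then have "\<gamma> u = \<gamma> t" using mdist_pos_less[of "\<gamma> u" "\<gamma> t"] by fastforce
  then show ?thesis unfolding arclength_param_def u_def[symmetric] .
qed

lemma unit_param_eqI: "t \<in> {0..1} \<Longrightarrow> arc_len \<gamma> t = s \<Longrightarrow> unit_param \<gamma> s = \<gamma> t"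
  using arc_mono[of 0 t] arc_mono[of t 1] unfolding unit_param_def by (auto simp: arclength_param_eqI)

lemma unit_param_lipschitz: "d (unit_param \<gamma> s) (unit_param \<gamma> s') \<le> \<bar>s - s'\<bar>"
proof -
  define c where "c = (\<lambda>s. max 0 (min (arc_len \<gamma> 1) s))"
  have c: "c s \<in> {0..arc_len \<gamma> 1}" for s using arc_mono[of 0 1] by (auto simp: c_def)
  obtain t t' where t: "t \<in> {0..1}" "arc_len \<gamma> t = c s" "t' \<in> {0..1}" "arc_len \<gamma> t' = c s'"
    using arc_surj[OF c] by metis
  have "d (unit_param \<gamma> s) (unit_param \<gamma> s') = d (\<gamma> t) (\<gamma> t')"
    using arclength_param_eqI t by (simp add: unit_param_def c_def)
  also have "\<dots> \<le> \<bar>c s - c s'\<bar>"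
    using t dist_le_arc[of t t'] dist_le_arc[of t' t] by (cases "t \<le> t'") (auto simp: commute)
  also have "\<dots> \<le> \<bar>s - s'\<bar>" by (auto simp: c_def)
  finally show ?thesis .
qed

lemma continuous_on_unit_param: "continuous_on S (unit_param \<gamma>)"
  unfolding continuous_on_into_real dist_real_def
  using unit_param_lipschitz by (meson le_less_trans)

lemma measurable_unit_param [measurable]: "unit_param \<gamma> \<in> borel \<rightarrow>\<^sub>M borel"
  by (rule borel_measurable_continuous_onI[OF continuous_on_unit_param])

lemma path_integral_eq:
  "path_integral d \<rho> \<gamma> = (\<integral>\<^sup>+s\<in>{0..arc_len \<gamma> 1}. \<rho> (unit_param \<gamma> s) \<partial>lborel)"
  unfolding path_integral_def unit_param_def arc_len_def
  by (rule nn_integral_cong) (auto simp: indicator_def max_def min_def)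

end

end

section \<open>Path integrals\<close>

lemma nn_integral_Icc_split:
  fixes f :: "real \<Rightarrow> ennreal"
  assumes [measurable]: "f \<in> borel_measurable borel" and "a \<le> b" "b \<le> c"
  shows "(\<integral>\<^sup>+s\<in>{a..c}. f s \<partial>lborel) = (\<integral>\<^sup>+s\<in>{a..b}. f s \<partial>lborel) + (\<integral>\<^sup>+s\<in>{b..c}. f s \<partial>lborel)"
proof -
  have "(\<integral>\<^sup>+s\<in>{a..b}. f s \<partial>lborel) + (\<integral>\<^sup>+s\<in>{b..c}. f s \<partial>lborel)
      = (\<integral>\<^sup>+s. f s * indicator {a..b} s + f s * indicator {b..c} s \<partial>lborel)"
    by (rule nn_integral_add[symmetric]) auto
  also have "\<dots> = (\<integral>\<^sup>+s\<in>{a..c}. f s \<partial>lborel)"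
  proof (rule nn_integral_cong_AE)
    show "AE x in lborel. f x * indicator {a..b} x + f x * indicator {b..c} x = f x * indicator {a..c} x"
      using AE_lborel_singleton[of b] by eventually_elim (use assms in \<open>auto simp: indicator_def\<close>)
  qed
  finally show ?thesis by simp
qed

lemma path_affine:
  assumes "path \<gamma>" "\<And>t. t \<in> {0..1} \<Longrightarrow> m * t + q \<in> {0..1}"
  shows "path (\<lambda>t. \<gamma> (m * t + q))"
  using assms unfolding path_def
  by (auto intro!: continuous_on_compose2[of "{0..1}" \<gamma> "{0..1}" "\<lambda>t. m * t + q"] continuous_on_add
      continuous_on_mult continuous_on_const continuous_on_id)

context umetric begin

lemma rectifiable_cong:
  assumes "\<And>t. t \<in> {0..1} \<Longrightarrow> \<gamma> t = \<beta> t"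
  shows "rectifiable d \<gamma> \<longleftrightarrow> rectifiable d \<beta>"
  unfolding rectifiable_iff path_def using curve_length_cong[of 0 1 \<gamma> \<beta>] continuous_on_cong[of "{0..1}" "{0..1}" \<gamma> \<beta>] assms
  by auto

lemma arc_cong: 
  assumes "\<And>t. t \<in> {0..1} \<Longrightarrow> \<gamma> t = \<beta> t" "t \<in> {0..1}"
  shows "arc_len \<gamma> t = arc_len \<beta> t"
  unfolding arc_len_def by (subst curve_length_cong[of _ _ \<gamma> \<beta>]) (use assms in auto)

lemma path_integral_cong:
  assumes \<gamma>: "rectifiable d \<gamma>" and eq: "\<And>t. t \<in> {0..1} \<Longrightarrow> \<gamma> t = \<beta> t"
  shows "path_integral d \<rho> \<gamma> = path_integral d \<rho> \<beta>"
proof -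
  have \<beta>: "rectifiable d \<beta>" using rectifiable_cong[OF eq] \<gamma> by simp
  have "unit_param \<gamma> s = unit_param \<beta> s" if s: "s \<in> {0..arc_len \<gamma> 1}" for s
  proof -
    obtain t where t: "t \<in> {0..1}" "arc_len \<gamma> t = s" using arc_surj[OF \<gamma> s] by blast
    then show ?thesis
      using unit_param_eqI[OF \<gamma> t] unit_param_eqI[OF \<beta> t(1), of s] arc_cong[OF eq] eq by simp
  qed
  moreover have "arc_len \<gamma> 1 = arc_len \<beta> 1" by (rule arc_cong[OF eq]) auto
  ultimately show ?thesis
    unfolding path_integral_eq[OF \<gamma>] path_integral_eq[OF \<beta>]
    by (intro nn_integral_cong) (auto simp: indicator_def)
qed

text \<open>The arc length of the subpath is that of \<gamma> minus
  \<open>arc_len \<gamma> a\<close>, so the two arc-length parametrisations differ by a translation,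
  under which Lebesgue measure is invariant.\<close>

lemma
  assumes \<gamma>: "rectifiable d \<gamma>" and ab: "0 \<le> a" "a < b" "b \<le> 1"
  defines "\<beta> \<equiv> \<lambda>t. \<gamma> ((b - a) * t + a)"
  shows rectifiable_sub: "rectifiable d \<beta>"
    and path_integral_sub: "\<rho> \<in> borel_measurable borel \<Longrightarrow>
      path_integral d \<rho> \<beta> = (\<integral>\<^sup>+s\<in>{arc_len \<gamma> a..arc_len \<gamma> b}. \<rho> (unit_param \<gamma> s) \<partial>lborel)"
proof -
  have in01: "(b - a) * t + a \<in> {a..b}" if "t \<in> {0..1}" for t
  proof -
    have h: "(b - a) * t \<le> b - a" using that ab by (intro mult_left_le) auto
    have "0 \<le> (b - a) * t" using that ab by simp
    then have "a \<le> (b - a) * t + a" by linarith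
    moreover have "(b - a) * t + a \<le> b" using h by linarith
    ultimately show ?thesis by simp
  qed
  have len: "curve_length d \<beta> 0 t = curve_length d \<gamma> a ((b - a) * t + a)" for t
    unfolding \<beta>_def using curve_length_affine[of "b - a" \<gamma> a 0 t] ab by simp
  have "path \<beta>" unfolding \<beta>_def
    by (rule path_affine) (use \<gamma> in01 ab in \<open>auto simp: rectifiable_iff intro: order_trans\<close>)
  moreover have "curve_length d \<beta> 0 1 < top" using len[of 1] curve_length_finite[OF \<gamma>, of a b] ab by simp
  ultimately show \<beta>: "rectifiable d \<beta>" by (simp add: rectifiable_iff)
  have arc_len: "arc_len \<beta> t = arc_len \<gamma> ((b - a) * t + a) - arc_len \<gamma> a" if "t \<in> {0..1}" for t
    using in01[OF that] ab curve_length_eq_arc[OF \<gamma>, of a "(b - a) * t + a"]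
      arc_mono[OF \<gamma>, of a "(b - a) * t + a"] len[of t]
    by (simp add: arc_len_def[of \<beta>])
  have par: "unit_param \<beta> s = unit_param \<gamma> (arc_len \<gamma> a + s)" if s: "s \<in> {0..arc_len \<beta> 1}" for s
  proof -
    obtain t where t: "t \<in> {0..1}" "arc_len \<beta> t = s" using arc_surj[OF \<beta> s] by blast
    have "unit_param \<gamma> (arc_len \<gamma> a + s) = \<gamma> ((b - a) * t + a)"
      by (rule unit_param_eqI[OF \<gamma>]) (use in01[OF t(1)] ab t arc_len in auto)
    then show ?thesis using unit_param_eqI[OF \<beta> t] by (simp add: \<beta>_def)
  qed
  assume [measurable]: "\<rho> \<in> borel_measurable borel"
  note [measurable] = measurable_unit_param[OF \<gamma>]
  have "(\<integral>\<^sup>+s\<in>{arc_len \<gamma> a..arc_len \<gamma> b}. \<rho> (unit_param \<gamma> s) \<partial>lborel)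
      = (\<integral>\<^sup>+s. \<rho> (unit_param \<gamma> (arc_len \<gamma> a + s)) * indicator {arc_len \<gamma> a..arc_len \<gamma> b} (arc_len \<gamma> a + s) \<partial>lborel)"
    by (subst nn_integral_real_affine[where c=1 and t="arc_len \<gamma> a"]) auto
  also have "\<dots> = (\<integral>\<^sup>+s\<in>{0..arc_len \<beta> 1}. \<rho> (unit_param \<beta> s) \<partial>lborel)"
    by (rule nn_integral_cong) (use arc_len[of 1] par in \<open>auto simp: indicator_def\<close>)
  finally show "path_integral d \<rho> \<beta> = (\<integral>\<^sup>+s\<in>{arc_len \<gamma> a..arc_len \<gamma> b}. \<rho> (unit_param \<gamma> s) \<partial>lborel)"
    by (simp add: path_integral_eq[OF \<beta>])
qed

lemma path_integral_sub_le:
  assumes \<gamma>: "rectifiable d \<gamma>" and ab: "0 \<le> a" "a < b" "b \<le> 1" and \<rho>: "\<rho> \<in> borel_measurable borel"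
  shows "path_integral d \<rho> (\<lambda>t. \<gamma> ((b - a) * t + a)) \<le> path_integral d \<rho> \<gamma>"
  unfolding path_integral_sub[OF \<gamma> ab \<rho>] path_integral_eq[OF \<gamma>]
  by (rule nn_integral_mono) (use arc_mono[OF \<gamma>, of 0 a] arc_mono[OF \<gamma>, of b 1] ab in \<open>auto simp: indicator_def\<close>)

text \<open>Each half of the join is an affine copy of one of the paths. Splitting the arc-length
  interval at the value that belongs to the parameter 1/2 splits the integral into those of the two
  subpaths.\<close>

lemma
  assumes \<gamma>: "rectifiable d \<gamma>" and \<beta>: "rectifiable d \<beta>" and j: "\<gamma> 1 = \<beta> 0"
  shows rectifiable_joinpaths: "rectifiable d (\<gamma> +++ \<beta>)"
    and path_integral_joinpaths: "\<rho> \<in> borel_measurable borel \<Longrightarrow>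
      path_integral d \<rho> (\<gamma> +++ \<beta>) = path_integral d \<rho> \<gamma> + path_integral d \<rho> \<beta>"
proof -
  let ?J = "\<gamma> +++ \<beta>"
  have "path ?J" using \<gamma> \<beta> j by (intro path_join_imp) (auto simp: rectifiable_iff pathfinish_def pathstart_def)
  moreover have "curve_length d ?J 0 (1/2) = curve_length d \<gamma> 0 1"
    using curve_length_affine[of 2 \<gamma> 0 0 "1/2"]
    by (subst curve_length_cong[of 0 "1/2" ?J "\<lambda>t. \<gamma> (2 * t)"]) (auto simp: joinpaths_def)
  moreover have "?J t = \<beta> (2 * t + -1)" if "t \<in> {1/2..1}" for t
  proof (cases "t = 1/2")
    case True
    show ?thesis unfolding True using j by (simp add: joinpaths_def)
  qed (use that in \<open>auto simp: joinpaths_def\<close>)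
  then have "curve_length d ?J (1/2) 1 = curve_length d \<beta> 0 1"
    using curve_length_affine[of 2 \<beta> "-1" "1/2" 1]
    by (subst curve_length_cong[of "1/2" 1 ?J "\<lambda>t. \<beta> (2 * t + -1)"]) auto
  ultimately show J: "rectifiable d ?J"
    using curve_length_add[of 0 "1/2" 1 ?J] \<gamma> \<beta> by (simp add: rectifiable_iff)
  assume \<rho>[measurable]: "\<rho> \<in> borel_measurable borel"
  note [measurable] = measurable_unit_param[OF J]
  have "path_integral d \<rho> ?J = (\<integral>\<^sup>+s\<in>{arc_len ?J 0..arc_len ?J (1/2)}. \<rho> (unit_param ?J s) \<partial>lborel)
       + (\<integral>\<^sup>+s\<in>{arc_len ?J (1/2)..arc_len ?J 1}. \<rho> (unit_param ?J s) \<partial>lborel)"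
    unfolding path_integral_eq[OF J] arc_0
    by (rule nn_integral_Icc_split) (use arc_mono[OF J, of 0 "1/2"] arc_mono[OF J, of "1/2" 1] in auto)
  also have "\<dots> = path_integral d \<rho> (\<lambda>t. ?J ((1/2 - 0) * t + 0)) + path_integral d \<rho> (\<lambda>t. ?J ((1 - 1/2) * t + 1/2))"
    by (subst (1 2) path_integral_sub[OF J _ _ _ \<rho>]) auto
  also have "path_integral d \<rho> (\<lambda>t. ?J ((1/2 - 0) * t + 0)) = path_integral d \<rho> \<gamma>"
    by (rule path_integral_cong[symmetric, OF \<gamma>]) (auto simp: joinpaths_def)
  also have "path_integral d \<rho> (\<lambda>t. ?J ((1 - 1/2) * t + 1/2)) = path_integral d \<rho> \<beta>"
  proof (rule path_integral_cong[symmetric, OF \<beta>])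
    fix t :: real assume t: "t \<in> {0..1}"
    show "\<beta> t = ?J ((1 - 1/2) * t + 1/2)"
      using t j by (cases "t = 0") (auto simp: joinpaths_def algebra_simps)
  qed
  finally show "path_integral d \<rho> ?J = path_integral d \<rho> \<gamma> + path_integral d \<rho> \<beta>" .
qed

lemma
  assumes \<gamma>: "rectifiable d \<gamma>"
  shows rectifiable_reverse: "rectifiable d (\<lambda>t. \<gamma> (1 - t))"
    and path_integral_reverse: "\<rho> \<in> borel_measurable borel \<Longrightarrow>
      path_integral d \<rho> (\<lambda>t. \<gamma> (1 - t)) = path_integral d \<rho> \<gamma>"
proof -
  let ?\<beta> = "\<lambda>t. \<gamma> (1 - t)"
  have len: "curve_length d ?\<beta> 0 t = curve_length d \<gamma> (1 - t) 1" for t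
    using curve_length_reflect[of \<gamma> 1 0 t] by simp
  have "path (\<lambda>t. \<gamma> (-1 * t + 1))"
    by (rule path_affine) (use \<gamma> in \<open>auto simp: rectifiable_iff\<close>)
  then show \<beta>: "rectifiable d ?\<beta>" using len[of 1] \<gamma> by (simp add: rectifiable_iff)
  have arc_len: "arc_len ?\<beta> t = arc_len \<gamma> 1 - arc_len \<gamma> (1 - t)" if "t \<in> {0..1}" for t
    using that curve_length_eq_arc[OF \<gamma>, of "1 - t" 1]
      arc_mono[OF \<gamma>, of "1 - t" 1] len[of t]
    by (simp add: arc_len_def[of ?\<beta>])
  have par: "unit_param ?\<beta> s = unit_param \<gamma> (arc_len \<gamma> 1 - s)" if s: "s \<in> {0..arc_len ?\<beta> 1}" for s
  proof -
    obtain t where t: "t \<in> {0..1}" "arc_len ?\<beta> t = s" using arc_surj[OF \<beta> s] by blast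
    have "unit_param \<gamma> (arc_len \<gamma> 1 - s) = \<gamma> (1 - t)"
      by (rule unit_param_eqI[OF \<gamma>]) (use t arc_len in auto)
    then show ?thesis using unit_param_eqI[OF \<beta> t] by simp
  qed
  assume [measurable]: "\<rho> \<in> borel_measurable borel"
  note [measurable] = measurable_unit_param[OF \<gamma>]
  have "(\<integral>\<^sup>+s\<in>{0..arc_len \<gamma> 1}. \<rho> (unit_param \<gamma> s) \<partial>lborel)
      = (\<integral>\<^sup>+s. \<rho> (unit_param \<gamma> (arc_len \<gamma> 1 - s)) * indicator {0..arc_len \<gamma> 1} (arc_len \<gamma> 1 - s) \<partial>lborel)"
    by (subst nn_integral_real_affine[where c="-1" and t="arc_len \<gamma> 1"]) auto
  also have "\<dots> = (\<integral>\<^sup>+s\<in>{0..arc_len ?\<beta> 1}. \<rho> (unit_param ?\<beta> s) \<partial>lborel)"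
    by (rule nn_integral_cong) (use arc_len[of 1] par in \<open>auto simp: indicator_def\<close>)
  finally show "path_integral d \<rho> ?\<beta> = path_integral d \<rho> \<gamma>"
    by (simp add: path_integral_eq[OF \<beta>] path_integral_eq[OF \<gamma>])
qed

context
  fixes \<gamma> assumes \<gamma>: "rectifiable d \<gamma>"
begin

lemma path_integral_le:
  assumes "\<And>x. \<rho> x \<le> K"
  shows "path_integral d \<rho> \<gamma> \<le> K * ennreal (arc_len \<gamma> 1)"
proof -
  have "path_integral d \<rho> \<gamma> \<le> (\<integral>\<^sup>+s\<in>{0..arc_len \<gamma> 1}. K \<partial>lborel)"
    unfolding path_integral_eq[OF \<gamma>] by (intro nn_integral_mono mult_right_mono assms) auto
  also have "\<dots> = K * ennreal (arc_len \<gamma> 1)"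
    using arc_mono[OF \<gamma>, of 0 1] by (subst nn_integral_cmult_indicator) auto
  finally show ?thesis .
qed

text \<open>The final point is exempt because a path that leaves an open set for the first time at
  parameter 1 lies in it only before. The single arc length \<open>arc_len \<gamma> 1\<close> is a
  null set.\<close>

lemma AE_unit_param_image:
  assumes "\<And>t. t \<in> {0..<1} \<Longrightarrow> P (\<gamma> t)"
  shows "AE s in lborel. s \<in> {0..arc_len \<gamma> 1} \<longrightarrow> P (unit_param \<gamma> s)"
  using AE_lborel_singleton[of "arc_len \<gamma> 1"]
proof eventually_elim
  case (elim s)
  show ?case
  proof
    assume s: "s \<in> {0..arc_len \<gamma> 1}"
    then obtain t where t: "t \<in> {0..1}" "arc_len \<gamma> t = s" using arc_surj[OF \<gamma>] by blast
    then have "t \<noteq> 1" using elim by auto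
    then show "P (unit_param \<gamma> s)" using t assms unit_param_eqI[OF \<gamma> t] by auto
  qed
qed

lemma path_integral_mono_image:
  assumes "\<And>t. t \<in> {0..<1} \<Longrightarrow> \<rho> (\<gamma> t) \<le> \<rho>' (\<gamma> t)"
  shows "path_integral d \<rho> \<gamma> \<le> path_integral d \<rho>' \<gamma>"
  unfolding path_integral_eq[OF \<gamma>]
proof (rule nn_integral_mono_AE)
  have "AE s in lborel. s \<in> {0..arc_len \<gamma> 1} \<longrightarrow> \<rho> (unit_param \<gamma> s) \<le> \<rho>' (unit_param \<gamma> s)"
    using assms by (rule AE_unit_param_image)
  then show "AE s in lborel. \<rho> (unit_param \<gamma> s) * indicator {0..arc_len \<gamma> 1} s
      \<le> \<rho>' (unit_param \<gamma> s) * indicator {0..arc_len \<gamma> 1} s"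
    by eventually_elim (auto simp: indicator_def)
qed

lemma path_integral_ge:
  assumes "\<And>t. t \<in> {0..<1} \<Longrightarrow> k \<le> \<rho> (\<gamma> t)"
  shows "k * ennreal (arc_len \<gamma> 1) \<le> path_integral d \<rho> \<gamma>"
proof -
  have "k * ennreal (arc_len \<gamma> 1) = (\<integral>\<^sup>+s\<in>{0..arc_len \<gamma> 1}. k \<partial>lborel)"
    using arc_mono[OF \<gamma>, of 0 1] by (subst nn_integral_cmult_indicator) auto
  also have "\<dots> = path_integral d (\<lambda>_. k) \<gamma>" by (simp add: path_integral_eq[OF \<gamma>])
  also have "\<dots> \<le> path_integral d \<rho> \<gamma>" using assms by (rule path_integral_mono_image)
  finally show ?thesis .
qed

end

lemma curve_length_le_lipschitz:
  assumes "\<And>x y. x \<in> {a..b} \<Longrightarrow> y \<in> {a..b} \<Longrightarrow> d (c x) (c y) \<le> L * \<bar>x - y\<bar>" "a \<le> b" "0 \<le> L"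
  shows "curve_length d c a b \<le> ennreal (L * (b - a))"
proof (rule curve_length_leI)
  fix k and t :: "nat \<Rightarrow> real" assume t: "\<And>i. i \<le> k \<Longrightarrow> t i \<in> {a..b}" "\<And>i. i < k \<Longrightarrow> t i \<le> t (Suc i)"
  have "(\<Sum>i<k. d (c (t i)) (c (t (Suc i)))) \<le> (\<Sum>i<k. L * (t (Suc i) - t i))"
  proof (rule sum_mono)
    fix i assume i: "i \<in> {..<k}"
    have "\<bar>t i - t (Suc i)\<bar> = t (Suc i) - t i" using t(2)[of i] i by auto
    then show "d (c (t i)) (c (t (Suc i))) \<le> L * (t (Suc i) - t i)"
      using assms(1)[OF t(1) t(1), of i "Suc i"] i by simp
  qed
  also have "\<dots> = L * (t k - t 0)" by (simp add: sum_lessThan_telescope flip: sum_distrib_left)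
  also have "\<dots> \<le> L * (b - a)" using t(1)[of k] t(1)[of 0] assms by (intro mult_left_mono) auto
  finally show "(\<Sum>i<k. ennreal (d (c (t i)) (c (t (Suc i))))) \<le> ennreal (L * (b - a))"
    by (subst sum_ennreal) (auto intro!: ennreal_leI)
qed

lemma rectifiable_lipschitz:
  assumes "\<And>x y. x \<in> {0..1} \<Longrightarrow> y \<in> {0..1} \<Longrightarrow> d (c x) (c y) \<le> L * \<bar>x - y\<bar>" "0 \<le> L"
  shows "rectifiable d c"
  unfolding rectifiable_iff
proof
  have "continuous_on {0..1} c" unfolding continuous_on_into_real
  proof (intro ballI allI impI)
    fix x e :: real assume x: "x \<in> {0..1}" and e: "0 < e"
    show "\<exists>\<delta>>0. \<forall>y\<in>{0..1}. dist y x < \<delta> \<longrightarrow> d (c y) (c x) < e"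
    \<comment> \<open>\<open>L + 1\<close> instead of \<open>L\<close> avoids a division by zero
      when \<open>L = 0\<close>.\<close>
    proof (intro exI[of _ "e / (L + 1)"] conjI ballI impI)
      fix y assume y: "y \<in> {0..1}" "dist y x < e / (L + 1)"
      have "d (c y) (c x) \<le> L * \<bar>y - x\<bar>" using assms x y by auto
      also have "\<dots> \<le> (L + 1) * \<bar>y - x\<bar>" by (intro mult_right_mono) auto
      also have "\<dots> < e" using y assms(2) by (simp add: dist_real_def field_simps)
      finally show "d (c y) (c x) < e" .
    qed (use e assms in auto)
  qed
  then show "path c" by (simp add: path_def)
  show "curve_length d c 0 1 < top"
    using curve_length_le_lipschitz[of 0 1 c L] assms by (auto intro: le_less_trans)
qed

text \<open>Arc length \<open>A\<close> is only known to be Lipschitz in the parameter, so no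
  substitution rule with a continuous derivative is at hand. Instead the integral \<open>G\<close>
  in arc length is compared with \<open>H\<close>, which is L times the integral in the parameter,
  over N equal intervals: uniform continuity of h along the path makes the error on each interval at
  most 2 * L * e times its length.\<close>

lemma path_integral_lipschitz_le:
  assumes lip: "\<And>x y. x \<in> {0..1} \<Longrightarrow> y \<in> {0..1} \<Longrightarrow> d (c x) (c y) \<le> L * \<bar>x - y\<bar>" and L: "0 \<le> L"
    and h: "continuous_on UNIV h" "\<And>x. 0 \<le> h x"
  shows "path_integral d (\<lambda>x. ennreal (h x)) c \<le> ennreal (L * integral {0..1} (\<lambda>t. h (c t)))"
proof -
  have c: "rectifiable d c" using rectifiable_lipschitz lip L by blast
  define A where "A = arc_len c"
  define \<phi> where "\<phi> = (\<lambda>s. h (unit_param c s))"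
  have \<phi>c: "continuous_on S \<phi>" for S unfolding \<phi>_def
    by (intro continuous_on_compose2[OF h(1) continuous_on_unit_param[OF c]]) auto
  have \<phi>A: "h (c t) = \<phi> (A t)" if "t \<in> {0..1}" for t
    unfolding \<phi>_def A_def using unit_param_eqI[OF c that] by simp
  have Alip: "A y - A x \<le> L * (y - x)" if "0 \<le> x" "x \<le> y" "y \<le> 1" for x y
  proof -
    have "ennreal (A y - A x) \<le> ennreal (L * (y - x))"
      using curve_length_le_lipschitz[of x y c L] lip L that curve_length_eq_arc[OF c, of x y] by (auto simp: A_def)
    then show ?thesis using L that by (simp add: ennreal_le_iff)
  qed
  have Amono: "A x \<le> A y" if "x \<le> y" "y \<le> 1" for x y using arc_mono[OF c that] by (simp add: A_def)
  have A0: "A 0 = 0" by (simp add: A_def)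
  have hc: "continuous_on {0..1} (\<lambda>t. h (c t))"
    using c by (intro continuous_on_compose2[OF h(1)]) (auto simp: rectifiable_iff path_def)
  define G where "G = (\<lambda>t. integral {0..A t} \<phi>)"
  define H where "H = (\<lambda>t. L * integral {0..t} (\<lambda>t. h (c t)))"
  have \<phi>int: "\<phi> integrable_on {a..b}" for a b by (intro integrable_continuous_interval \<phi>c)
  have hint: "(\<lambda>t. h (c t)) integrable_on {a..b}" if "0 \<le> a" "b \<le> 1" for a b
    by (intro integrable_continuous_interval continuous_on_subset[OF hc]) (use that in auto)
  have main: "G 1 \<le> H 1 + 2 * L * e" if e: "e > 0" for e
  proof -
    have "uniformly_continuous_on {0..A 1} \<phi>"
      by (intro compact_uniformly_continuous \<phi>c) auto
    then obtain \<delta> where \<delta>: "\<delta> > 0" "\<And>s s'. s \<in> {0..A 1} \<Longrightarrow> s' \<in> {0..A 1} \<Longrightarrow> \<bar>s' - s\<bar> < \<delta> \<Longrightarrow> \<bar>\<phi> s' - \<phi> s\<bar> < e"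
      unfolding uniformly_continuous_on_def dist_real_def using e by metis
    obtain N :: nat where N: "N > 0" "L / N < \<delta>"
    proof -
      obtain m :: nat where "real m > L / \<delta>" using reals_Archimedean2 by blast
      then have "L < \<delta> * real (Suc m)" using \<delta>(1) by (simp add: field_simps)
      then have "L / Suc m < \<delta>" by (simp add: pos_divide_less_eq del: of_nat_Suc)
      then show ?thesis using that[of "Suc m"] by simp
    qed
    have step: "G y - G x \<le> H y - H x + 2 * L * e * (y - x)"
      if xy: "0 \<le> x" "x \<le> y" "y \<le> 1" "y - x \<le> 1 / N" for x y
    proof -
      have As: "A y - A x < \<delta>"
        using Alip[OF xy(1-3)] mult_left_mono[OF xy(4) L] N(2) by simp
      have ranA: "A s \<in> {A x..A y}" if "s \<in> {x..y}" for s using that Amono xy by auto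
      have sub: "{A x..A y} \<subseteq> {0..A 1}" using Amono[of 0 x] Amono[of y 1] A0 xy by auto
      have "G y - G x = integral {A x..A y} \<phi>"
        unfolding G_def using Henstock_Kurzweil_Integration.integral_combine[of 0 "A x" "A y" \<phi>]
          Amono[of 0 x] Amono[of x y] xy A0 \<phi>int by auto
      also have "\<dots> \<le> integral {A x..A y} (\<lambda>_. \<phi> (A x) + e)"
      proof (rule integral_le[OF \<phi>int])
        fix s assume s: "s \<in> {A x..A y}"
        then have "\<bar>s - A x\<bar> < \<delta>" "s \<in> {0..A 1}" "A x \<in> {0..A 1}" using As sub by auto
        then show "\<phi> s \<le> \<phi> (A x) + e" using \<delta>(2)[of "A x" s] by auto
      qed auto
      also have "\<dots> = (A y - A x) * (\<phi> (A x) + e)" using Amono[of x y] xy by simp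
      also have "\<dots> \<le> (L * (y - x)) * (\<phi> (A x) + e)"
        using Alip[OF xy(1-3)] h(2) e by (intro mult_right_mono) (auto simp: \<phi>_def intro: add_nonneg_nonneg)
      finally have G: "G y - G x \<le> L * (y - x) * (\<phi> (A x) + e)" .
      have "(y - x) * (\<phi> (A x) - e) = integral {x..y} (\<lambda>_. \<phi> (A x) - e)" using xy by simp
      also have "\<dots> \<le> integral {x..y} (\<lambda>t. h (c t))"
      proof (rule integral_le)
        fix s assume s: "s \<in> {x..y}"
        have "\<bar>A s - A x\<bar> < \<delta>" "A s \<in> {0..A 1}" "A x \<in> {0..A 1}" using As sub ranA[OF s] by auto
        then have "\<phi> (A x) - e \<le> \<phi> (A s)" using \<delta>(2)[of "A x" "A s"] by auto
        then show "\<phi> (A x) - e \<le> h (c s)" using \<phi>A[of s] s xy by auto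
      qed (use hint xy in auto)
      also have "\<dots> = integral {0..y} (\<lambda>t. h (c t)) - integral {0..x} (\<lambda>t. h (c t))"
        using Henstock_Kurzweil_Integration.integral_combine[of 0 x y "\<lambda>t. h (c t)"] xy hint by auto
      finally have "L * ((y - x) * (\<phi> (A x) - e)) \<le> H y - H x"
        unfolding H_def right_diff_distrib[symmetric] by (rule mult_left_mono[OF _ L])
      then show ?thesis using G by (simp add: algebra_simps)
    qed
    have "G (i / N) \<le> H (i / N) + 2 * L * e * (i / N)" if "i \<le> N" for i :: nat
      using that
    proof (induction i)
      case 0
      then show ?case by (simp add: G_def H_def A0)
    next
      case (Suc i)
      have "G (Suc i / N) - G (i / N) \<le> H (Suc i / N) - H (i / N) + 2 * L * e * (Suc i / N - i / N)"
        by (rule step) (use Suc.prems N(1) in \<open>auto simp: field_simps\<close>)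
      then show ?case using Suc by (simp add: right_diff_distrib)
    qed
    from this[of N] show ?thesis using N(1) by simp
  qed
  have "G 1 \<le> H 1"
  proof (rule field_le_epsilon)
    fix e :: real assume "e > 0"
    then have "G 1 \<le> H 1 + 2 * L * (e / (2 * (L + 1)))" using main[of "e / (2 * (L + 1))"] L by simp
    moreover have "2 * L * (e / (2 * (L + 1))) \<le> e"
    proof -
      have "2 * L * (e / (2 * (L + 1))) = e * (L / (L + 1))"
        using L by (simp add: divide_simps)
      also have "\<dots> \<le> e * 1" using \<open>e > 0\<close> L by (intro mult_left_mono) auto
      finally show ?thesis by simp
    qed
    ultimately show "G 1 \<le> H 1 + e" by linarith
  qed
  moreover have "path_integral d (\<lambda>x. ennreal (h x)) c = ennreal (G 1)"
    unfolding path_integral_eq[OF c] G_def A_def[symmetric] \<phi>_def[symmetric]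
    using nn_integral_has_integral_lebesgue'[OF _ integrable_integral[OF \<phi>int[of 0 "A 1"]]] h(2)
    by (simp add: \<phi>_def)
  ultimately show ?thesis by (simp add: H_def ennreal_leI)
qed

end

section \<open>Convergence in the metric and distance to the complement of a set\<close>

context umetric begin

lemma tendsto_iff_dist: "(f \<longlongrightarrow> l) F \<longleftrightarrow> ((\<lambda>x. d (f x) l) \<longlongrightarrow> 0) F"
  using limitin_metric_dist_null[of f l F] by (simp add: mtopology_eq)

lemma tendsto_dist_both:
  assumes "(f \<longlongrightarrow> l) F" "(g \<longlongrightarrow> m) F" shows "((\<lambda>x. d (f x) (g x)) \<longlongrightarrow> d l m) F"
proof -
  have "((\<lambda>x. d (f x) l + d (g x) m) \<longlongrightarrow> 0 + 0) F"
    by (intro tendsto_add) (use assms in \<open>auto simp: tendsto_iff_dist\<close>)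
  then have "((\<lambda>x. d (f x) l + d (g x) m) \<longlongrightarrow> 0) F" by simp
  then have "((\<lambda>x. d (f x) (g x) - d l m) \<longlongrightarrow> 0) F"
  proof (rule Lim_null_comparison[rotated])
    have "\<bar>d a b - d l m\<bar> \<le> d a l + d b m" for a b
      using dist_diff_le[of a b l] dist_diff_le[of b l m] dist_diff_le[of a l b] by (auto simp: commute)
    then show "\<forall>\<^sub>F x in F. norm (d (f x) (g x) - d l m) \<le> d (f x) l + d (g x) m" by simp
  qed
  then show ?thesis by (rule LIM_zero_cancel)
qed

text \<open>The infimum over an empty complement has no useful value, which is why
  \<open>V \<noteq> UNIV\<close> accompanies its properties.\<close>

definition dist_out :: "'a set \<Rightarrow> 'a \<Rightarrow> real" where
  "dist_out V x = (INF y\<in>-V. d x y)"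

lemma
  assumes "V \<noteq> UNIV"
  shows dist_out_nonneg: "0 \<le> dist_out V x"
    and dist_out_eq_0: "x \<notin> V \<Longrightarrow> dist_out V x = 0"
    and dist_out_pos: "open V \<Longrightarrow> x \<in> V \<Longrightarrow> 0 < dist_out V x"
    and continuous_on_dist_out: "continuous_on S (dist_out V)"
proof -
  have ne: "-V \<noteq> {}" using assms by auto
  have bdd: "bdd_below (d x ` (-V))" for x by (rule bdd_belowI[of _ 0]) auto
  show nn: "0 \<le> dist_out V x" for x unfolding dist_out_def by (rule cINF_greatest[OF ne]) auto
  show "dist_out V x = 0" if "x \<notin> V"
    using nn[of x] cINF_lower[OF bdd, of x x] that by (simp add: dist_out_def)
  show "0 < dist_out V x" if "open V" "x \<in> V"
  proof -
    obtain r where r: "r > 0" "mball x r \<subseteq> V" using \<open>open V\<close> \<open>x \<in> V\<close> open_iff_mball by blast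
    have "r \<le> dist_out V x" unfolding dist_out_def
      by (rule cINF_greatest[OF ne]) (use r in \<open>force simp: not_less[symmetric]\<close>)
    then show ?thesis using r by simp
  qed
  have le: "dist_out V x \<le> d x y + dist_out V y" for x y
  proof -
    have "dist_out V x - d x y \<le> dist_out V y"
      unfolding dist_out_def[of V y]
    proof (rule cINF_greatest[OF ne])
      fix z assume "z \<in> - V"
      then have "dist_out V x \<le> d x z" unfolding dist_out_def by (rule cINF_lower[OF bdd])
      then show "dist_out V x - d x y \<le> d y z" using triangle[of x y z] by simp
    qed
    then show ?thesis by simp
  qed
  show "continuous_on S (dist_out V)"
  proof (rule continuous_on_from)
    fix x and e :: real assume "e > 0"
    moreover have "\<bar>dist_out V y - dist_out V x\<bar> \<le> d x y" for y
      using le[of x y] le[of y x] commute[of x y] by linarith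
    ultimately show "\<exists>\<delta>>0. \<forall>y\<in>S. d x y < \<delta> \<longrightarrow> \<bar>dist_out V y - dist_out V x\<bar> < e"
      by (intro exI[of _ e]) (auto intro: le_less_trans)
  qed
qed

section \<open>Semicontinuous majorants\<close>

context
  fixes \<mu> :: "'a measure" and W :: "'a set"
  assumes sets_\<mu>: "sets \<mu> = sets borel" and W: "open W" "emeasure \<mu> W < top"
begin

lemma finite_meas_Int: "B \<in> sets borel \<Longrightarrow> emeasure \<mu> (B \<inter> W) < top"
  using emeasure_mono[of "B \<inter> W" W \<mu>] W sets_\<mu> by (auto intro: le_less_trans)

lemma decseq_small:
  assumes "\<And>n::nat. B n \<in> sets borel" "decseq B" "emeasure \<mu> ((\<Inter>n. B n) \<inter> W) < ennreal e" "e > 0"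
  shows "\<exists>n. emeasure \<mu> (B n \<inter> W) < ennreal e"
proof -
  have [measurable]: "W \<in> sets borel" using W by simp
  have "(\<lambda>n. emeasure \<mu> (B n \<inter> W)) \<longlonglongrightarrow> emeasure \<mu> (\<Inter>n. B n \<inter> W)"
  proof (rule Lim_emeasure_decseq)
    show "range (\<lambda>n. B n \<inter> W) \<subseteq> sets \<mu>" using assms(1) by (auto simp: sets_\<mu>)
    show "decseq (\<lambda>n. B n \<inter> W)" using assms(2) by (auto simp: decseq_def)
    show "emeasure \<mu> (B i \<inter> W) \<noteq> \<infinity>" for i using finite_meas_Int[OF assms(1)[of i]] by auto
  qed
  moreover have "(\<Inter>n. B n \<inter> W) = (\<Inter>n. B n) \<inter> W" by auto
  ultimately have "\<forall>\<^sub>F n in sequentially. emeasure \<mu> (B n \<inter> W) < ennreal e"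
    using assms(3) by (metis order_tendstoD(2))
  then show ?thesis by (auto simp: eventually_sequentially)
qed

text \<open>The closed and the open set are found together because the claim is then symmetric under
  complements, as the induction over the generated \<sigma>-algebra requires. Measures are taken
  inside W since finiteness, on which continuity from above depends, is known there.\<close>

lemma inner_outer_regular:
  assumes "A \<in> sets borel"
  shows "\<forall>e>0. \<exists>C T. closed C \<and> open T \<and> C \<subseteq> A \<and> A \<subseteq> T \<and> emeasure \<mu> ((T - C) \<inter> W) < ennreal e"
proof -
  have "A \<in> sigma_sets UNIV {S. open S}" using assms by (simp add: borel_def)
  then show ?thesis
  proof induction
    case (Basic A)
    then have A: "open A" by simp
    show ?case
    proof (intro allI impI)
      fix e :: real assume e: "e > 0"
      \<comment> \<open>The points of A at distance at least 1 / (n + 1) from the complement; these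
        closed sets exhaust the open set A.\<close>
      define C where "C = (\<lambda>n::nat. {x. \<forall>y\<in>-A. inverse (real (Suc n)) \<le> d x y})"
      have cl: "closed (C n)" for n
      proof -
        have "C n = (\<Inter>y\<in>-A. {x. inverse (real (Suc n)) \<le> d x y})" by (auto simp: C_def)
        then show ?thesis by (auto intro!: closed_INT closed_Collect_le continuous_on_dist continuous_intros)
      qed
      have sub: "C n \<subseteq> A" for n
      proof (rule subsetI, rule ccontr)
        fix x assume "x \<in> C n" "x \<notin> A"
        then have "inverse (real (Suc n)) \<le> d x x" unfolding C_def by blast
        then show False by simp
      qed
      have "A \<subseteq> (\<Union>n. C n)"
      proof
        fix x assume "x \<in> A"
        then obtain r where r: "r > 0" "mball x r \<subseteq> A" using A open_iff_mball by blast
        obtain n where "inverse (real (Suc n)) < r" using reals_Archimedean r by blast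
        then have "x \<in> C n" using r by (force simp: C_def not_less[symmetric])
        then show "x \<in> (\<Union>n. C n)" by blast
      qed
      then have I: "(\<Inter>n. A - C n) \<inter> W = {}" by auto
      have "\<exists>n. emeasure \<mu> ((A - C n) \<inter> W) < ennreal e"
      proof (rule decseq_small)
        show "decseq (\<lambda>n. A - C n)"
        proof (rule decseq_SucI)
          fix n
          have "inverse (real (Suc (Suc n))) \<le> inverse (real (Suc n))" by (simp add: field_simps)
          then have "C n \<subseteq> C (Suc n)" unfolding C_def by (blast intro: order_trans)
          then show "A - C (Suc n) \<subseteq> A - C n" by auto
        qed
      qed (use I e A cl in auto)
      then show "\<exists>C T. closed C \<and> open T \<and> C \<subseteq> A \<and> A \<subseteq> T \<and> emeasure \<mu> ((T - C) \<inter> W) < ennreal e"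
        using A cl sub by blast
    qed
  next
    case Empty
    show ?case
    proof (intro allI impI)
      fix e :: real assume "e > 0"
      then have "emeasure \<mu> (({} - {}) \<inter> W) < ennreal e" by simp
      then show "\<exists>C T. closed C \<and> open T \<and> C \<subseteq> {} \<and> {} \<subseteq> T \<and> emeasure \<mu> ((T - C) \<inter> W) < ennreal e"
        using closed_empty open_empty by blast
    qed
  next
    case (Compl A)
    show ?case
    proof (intro allI impI)
      fix e :: real assume "e > 0"
      from Compl.IH[rule_format, OF this]
      obtain C T where "closed C" "open T" "C \<subseteq> A" "A \<subseteq> T" and m: "emeasure \<mu> ((T - C) \<inter> W) < ennreal e"
        by (elim exE conjE)
      then have "closed (-T)" "open (-C)" "-T \<subseteq> UNIV - A" "UNIV - A \<subseteq> -C" by auto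
      moreover have "(-C) - (-T) = T - C" by auto
      ultimately show "\<exists>C T. closed C \<and> open T \<and> C \<subseteq> UNIV - A \<and> UNIV - A \<subseteq> T \<and> emeasure \<mu> ((T - C) \<inter> W) < ennreal e"
        using m by (intro exI[of _ "-T"] exI[of _ "-C"]) (simp only: simp_thms)
    qed
  next
    case (Union A)
    show ?case
    proof (intro allI impI)
      fix e :: real assume e: "e > 0"
      \<comment> \<open>The errors add up to e / 2 and not to e, because strict inequalities become
        weak ones in the infinite sum.\<close>
      have "\<forall>i. \<exists>C T. closed C \<and> open T \<and> C \<subseteq> A i \<and> A i \<subseteq> T \<and> emeasure \<mu> ((T - C) \<inter> W) < ennreal (e / 2 * (1/2) ^ Suc i)"
        using Union.IH e by auto
      then obtain C T where CT: "\<And>i. closed (C i)" "\<And>i. open (T i)" "\<And>i. C i \<subseteq> A i" "\<And>i. A i \<subseteq> T i"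
        "\<And>i. emeasure \<mu> ((T i - C i) \<inter> W) < ennreal (e / 2 * (1/2) ^ Suc i)" by metis
      let ?T = "\<Union>i. T i"
      have [measurable]: "W \<in> sets borel" "\<And>i. C i \<in> sets borel" "\<And>i. T i \<in> sets borel"
        using W CT by (auto intro: borel_closed)
      have "emeasure \<mu> ((?T - (\<Union>i. C i)) \<inter> W) \<le> emeasure \<mu> (\<Union>i. (T i - C i) \<inter> W)"
        by (rule emeasure_mono) (auto simp: sets_\<mu>)
      also have "\<dots> \<le> (\<Sum>i. emeasure \<mu> ((T i - C i) \<inter> W))"
        by (rule emeasure_subadditive_countably) (auto simp: sets_\<mu>)
      also have "\<dots> \<le> (\<Sum>i. ennreal (e / 2 * (1/2) ^ Suc i))"
        by (intro suminf_le summableI less_imp_le CT)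
      also have "\<dots> = ennreal (\<Sum>i. e / 2 * (1/2) ^ Suc i)"
        by (intro suminf_ennreal2) (use e in \<open>auto intro!: summable_mult power_half_series[THEN sums_summable]\<close>)
      also have "\<dots> = ennreal (e / 2)"
        using sums_unique[OF power_half_series] by (subst suminf_mult) (auto intro!: power_half_series[THEN sums_summable])
      also have "\<dots> < ennreal e" using e by (intro ennreal_lessI) auto
      finally have *: "emeasure \<mu> ((?T - (\<Union>i. C i)) \<inter> W) < ennreal e" .
      \<comment> \<open>The union of all \<open>C i\<close> need not be closed; finitely many of
        them suffice by continuity from above inside W.\<close>
      have "\<exists>n. emeasure \<mu> ((?T - (\<Union>i<n. C i)) \<inter> W) < ennreal e"
      proof (rule decseq_small)
        show "decseq (\<lambda>n. ?T - (\<Union>i<n. C i))" by (auto simp: decseq_def)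
        have "(\<Inter>n. ?T - (\<Union>i<n. C i)) = ?T - (\<Union>i. C i)" by auto
        then show "emeasure \<mu> ((\<Inter>n. ?T - (\<Union>i<n. C i)) \<inter> W) < ennreal e" using * by simp
      qed (use e in auto)
      then obtain n where "emeasure \<mu> ((?T - (\<Union>i<n. C i)) \<inter> W) < ennreal e" ..
      then show "\<exists>C T. closed C \<and> open T \<and> C \<subseteq> \<Union> (range A) \<and> \<Union> (range A) \<subseteq> T \<and> emeasure \<mu> ((T - C) \<inter> W) < ennreal e"
      proof -
        have "closed (\<Union>i<n. C i)" "open ?T" using CT by (auto intro!: closed_UN)
        moreover have "(\<Union>i<n. C i) \<subseteq> \<Union> (range A)" "\<Union> (range A) \<subseteq> ?T" using CT(3,4) by blast+
        ultimately show ?thesis using \<open>emeasure \<mu> ((?T - (\<Union>i<n. C i)) \<inter> W) < ennreal e\<close> by blast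
      qed
    qed
  qed
qed

lemma outer_regular_Int:
  assumes [measurable]: "A \<in> sets borel" and e: "e > 0"
  obtains T where "open T" "A \<inter> W \<subseteq> T" "T \<subseteq> W" "emeasure \<mu> T \<le> emeasure \<mu> (A \<inter> W) + ennreal e"
proof -
  obtain C T where CT: "closed C" "open T" "C \<subseteq> A" "A \<subseteq> T" "emeasure \<mu> ((T - C) \<inter> W) < ennreal e"
    using inner_outer_regular[OF assms(1)] e by meson
  have [measurable]: "W \<in> sets \<mu>" "T \<in> sets \<mu>" "C \<in> sets \<mu>" "A \<in> sets \<mu>" using CT W by (auto simp: sets_\<mu> intro: borel_closed)
  have "emeasure \<mu> (T \<inter> W) \<le> emeasure \<mu> ((A \<inter> W) \<union> ((T - C) \<inter> W))"
    using CT by (intro emeasure_mono) auto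
  also have "\<dots> \<le> emeasure \<mu> (A \<inter> W) + emeasure \<mu> ((T - C) \<inter> W)"
    by (rule emeasure_subadditive) auto
  also have "\<dots> \<le> emeasure \<mu> (A \<inter> W) + ennreal e" using CT(5) by (intro add_left_mono) auto
  finally show ?thesis using that[of "T \<inter> W"] CT W by auto
qed

text \<open>A layer-cake sum from below: every layer of height \<delta> that is counted lies
  completely under u.\<close>

lemma sum_levels_le:
  fixes u :: ennreal
  shows "(\<Sum>i<k. if ennreal (real (Suc i) * \<delta>) \<le> u then ennreal \<delta> else 0) \<le> u"
proof (cases "\<delta> \<ge> 0")
  case True
  \<comment> \<open>The bound by u alone is not inductive: a new level counts only if u is at least
    (k + 1) * \<delta>, and then the previous k levels must be known to contribute at most k *
    \<delta>.\<close>
  have "(\<Sum>i<k. if ennreal (real (Suc i) * \<delta>) \<le> u then ennreal \<delta> else 0) \<le> min u (ennreal (real k * \<delta>))"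
  proof (induction k)
    case (Suc k)
    have "ennreal (real k * \<delta>) + ennreal \<delta> = ennreal (real (Suc k) * \<delta>)"
      using True by (simp add: algebra_simps flip: ennreal_plus)
    moreover have "ennreal (real k * \<delta>) \<le> ennreal (real (Suc k) * \<delta>)"
      using True by (intro ennreal_leI mult_right_mono) auto
    ultimately show ?case using Suc add_right_mono[of _ "ennreal (real k * \<delta>)" "ennreal \<delta>"]
      by (auto intro: order_trans)
  qed simp
  then show ?thesis by simp
next
  case False
  then show ?thesis by (simp add: ennreal_neg sum.If_cases)
qed

text \<open>A quantitative form of the Vitali--Caratheodory theorem: the supremum of the \<open>h k\<close> is a lower
  semicontinuous majorant of \<open>u\<close> on \<open>W\<close>, up to \<open>\<delta>\<close>.\<close>

lemma continuous_majorants: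
  fixes u :: "'a \<Rightarrow> ennreal"
  assumes [measurable]: "u \<in> borel_measurable borel" and \<delta>: "\<delta> > 0" and W_ne: "W \<noteq> UNIV"
  obtains h :: "nat \<Rightarrow> 'a \<Rightarrow> real" where
    "\<And>k. continuous_on UNIV (h k)" "\<And>k x. 0 \<le> h k x" "\<And>k x. h k x \<le> real k * \<delta>" "\<And>k x. h k x \<le> h (Suc k) x"
    "\<And>x. x \<in> W \<Longrightarrow> u x \<le> (SUP k. ennreal (h k x + \<delta>))"
    "\<And>k. (\<integral>\<^sup>+x\<in>W. ennreal (h k x) \<partial>\<mu>) \<le> (\<integral>\<^sup>+x\<in>W. u x \<partial>\<mu>) + ennreal \<delta>"
proof -
  \<comment> \<open>Superlevel sets of u at the positive multiples of \<delta>. Inside W they are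
    enlarged to open sets \<open>T i\<close> whose excess measures 2 ^ -(i + 1) sum to 1, so that
    the layers of height \<delta> over them cost at most \<delta> more than the integral of
    u.\<close>
  define A where "A = (\<lambda>i::nat. {x. ennreal (real (Suc i) * \<delta>) \<le> u x})"
  have A[measurable]: "A i \<in> sets borel" for i unfolding A_def by measurable
  have "\<forall>i. \<exists>T. open T \<and> A i \<inter> W \<subseteq> T \<and> T \<subseteq> W \<and> emeasure \<mu> T \<le> emeasure \<mu> (A i \<inter> W) + ennreal ((1/2) ^ Suc i)"
    using outer_regular_Int[OF A] by (metis zero_less_power half_gt_zero zero_less_one)
  then obtain T where T: "\<And>i. open (T i)" "\<And>i. A i \<inter> W \<subseteq> T i" "\<And>i. T i \<subseteq> W"
    "\<And>i. emeasure \<mu> (T i) \<le> emeasure \<mu> (A i \<inter> W) + ennreal ((1/2) ^ Suc i)" by metis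
  have T_ne: "T i \<noteq> UNIV" for i using T(3) W_ne by blast
  \<comment> \<open>For growing k these continuous functions increase to the indicator of the open
    set \<open>T i\<close>; taking only i < k in the sum keeps each \<open>h k\<close>
    bounded.\<close>
  define q where "q = (\<lambda>k i x. min 1 (real k * dist_out (T i) x))"
  define h where "h = (\<lambda>k x. \<delta> * (\<Sum>i<k. q k i x))"
  have q: "0 \<le> q k i x" "q k i x \<le> 1" "q k i x \<le> q (Suc k) i x" "x \<notin> T i \<Longrightarrow> q k i x = 0" for k i x
    using dist_out_nonneg[OF T_ne, of i x] dist_out_eq_0[OF T_ne, of x i]
    by (auto simp: q_def min_def intro: order_trans mult_right_mono) (simp_all add: algebra_simps)
  have h0: "0 \<le> h k x" for k x using \<delta> q by (auto simp: h_def intro!: mult_nonneg_nonneg sum_nonneg)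
  have hk: "h k x \<le> real k * \<delta>" for k x
    using \<delta> sum_bounded_above[of "{..<k}" "\<lambda>i. q k i x" 1] q by (simp add: h_def mult.commute)
  have hS: "h k x \<le> h (Suc k) x" for k x
  proof -
    have "(\<Sum>i<k. q k i x) \<le> (\<Sum>i<k. q (Suc k) i x)" by (intro sum_mono q)
    also have "\<dots> \<le> (\<Sum>i<Suc k. q (Suc k) i x)" using q by simp
    finally show ?thesis using \<delta> by (simp add: h_def)
  qed
  have [measurable]: "W \<in> sets \<mu>" "T i \<in> sets \<mu>" "A i \<in> sets \<mu>" "u \<in> borel_measurable \<mu>" for i
    using W T A assms(1) by (auto simp: sets_\<mu> measurable_cong_sets[OF sets_\<mu> refl])
  show ?thesis
  proof (rule that)
    show "continuous_on UNIV (h k)" for k unfolding h_def q_def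
      by (intro continuous_intros continuous_on_dist_out T_ne)
    show "(\<integral>\<^sup>+x\<in>W. ennreal (h k x) \<partial>\<mu>) \<le> (\<integral>\<^sup>+x\<in>W. u x \<partial>\<mu>) + ennreal \<delta>" for k
    proof -
      have hle: "ennreal (h k x) \<le> (\<Sum>i<k. ennreal \<delta> * indicator (T i) x)" for x
      proof -
        have "ennreal (h k x) = ennreal (\<Sum>i<k. \<delta> * q k i x)" by (simp add: h_def sum_distrib_left)
        also have "\<dots> \<le> ennreal (\<Sum>i<k. \<delta> * indicator (T i) x)"
          using q \<delta> by (intro ennreal_leI sum_mono mult_left_mono) (auto simp: indicator_def)
        also have "\<dots> = (\<Sum>i<k. ennreal (\<delta> * indicator (T i) x))"
          using \<delta> by (subst sum_ennreal) auto
        also have "\<dots> = (\<Sum>i<k. ennreal \<delta> * indicator (T i) x)"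
          by (intro sum.cong) (auto simp: indicator_def)
        finally show ?thesis .
      qed
      have "(\<integral>\<^sup>+x\<in>W. ennreal (h k x) \<partial>\<mu>) \<le> (\<integral>\<^sup>+x. (\<Sum>i<k. ennreal \<delta> * indicator (T i) x) \<partial>\<mu>)"
        by (intro nn_integral_mono) (use hle in \<open>auto simp: indicator_def\<close>)
      also have "\<dots> = (\<Sum>i<k. ennreal \<delta> * emeasure \<mu> (T i))"
        by (subst nn_integral_sum) (auto simp: nn_integral_cmult_indicator)
      also have "\<dots> \<le> (\<Sum>i<k. ennreal \<delta> * (emeasure \<mu> (A i \<inter> W) + ennreal ((1/2) ^ Suc i)))"
        by (intro sum_mono mult_left_mono T) auto
      also have "\<dots> = (\<Sum>i<k. ennreal \<delta> * emeasure \<mu> (A i \<inter> W)) + (\<Sum>i<k. ennreal (\<delta> * (1/2) ^ Suc i))"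
      proof -
        have "ennreal (\<delta> * (1/2) ^ Suc i) = ennreal \<delta> * ennreal ((1/2) ^ Suc i)" for i
          using \<delta> by (intro ennreal_mult) auto
        then show ?thesis by (simp only: distrib_left sum.distrib)
      qed
      also have "\<dots> \<le> (\<integral>\<^sup>+x\<in>W. u x \<partial>\<mu>) + ennreal \<delta>"
      proof (rule add_mono)
        have "(\<Sum>i<k. ennreal \<delta> * emeasure \<mu> (A i \<inter> W)) = (\<integral>\<^sup>+x. (\<Sum>i<k. ennreal \<delta> * indicator (A i \<inter> W) x) \<partial>\<mu>)"
          by (subst nn_integral_sum) (auto simp: nn_integral_cmult_indicator)
        also have "\<dots> \<le> (\<integral>\<^sup>+x\<in>W. u x \<partial>\<mu>)"
        proof (rule nn_integral_mono)
          fix x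
          have "(\<Sum>i<k. ennreal \<delta> * indicator (A i \<inter> W) x)
             = (\<Sum>i<k. if ennreal (real (Suc i) * \<delta>) \<le> u x then ennreal \<delta> else 0) * indicator W x"
            unfolding sum_distrib_right by (intro sum.cong) (auto simp: A_def indicator_def)
          also have "\<dots> \<le> u x * indicator W x" by (intro mult_right_mono sum_levels_le) auto
          finally show "(\<Sum>i<k. ennreal \<delta> * indicator (A i \<inter> W) x) \<le> u x * indicator W x" .
        qed
        finally show "(\<Sum>i<k. ennreal \<delta> * emeasure \<mu> (A i \<inter> W)) \<le> (\<integral>\<^sup>+x\<in>W. u x \<partial>\<mu>)" .
        have "(\<Sum>i<k. ennreal (\<delta> * (1/2) ^ Suc i)) = ennreal (\<delta> * (\<Sum>i<k. (1/2) ^ Suc i))"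
          using \<delta> by (subst sum_ennreal) (auto simp: sum_distrib_left)
        also have "\<dots> \<le> ennreal (\<delta> * 1)"
        proof (intro ennreal_leI mult_left_mono)
          have "(\<Sum>i<k. (1/2::real) ^ Suc i) \<le> (\<Sum>i. (1/2) ^ Suc i)"
            by (intro sum_le_suminf) (auto intro!: power_half_series[THEN sums_summable])
          then show "(\<Sum>i<k. (1/2::real) ^ Suc i) \<le> 1" using sums_unique[OF power_half_series] by simp
        qed (use \<delta> in auto)
        finally show "(\<Sum>i<k. ennreal (\<delta> * (1/2) ^ Suc i)) \<le> ennreal \<delta>" by simp
      qed
      finally show ?thesis .
    qed
    fix x assume x: "x \<in> W"
    show "u x \<le> (SUP k. ennreal (h k x + \<delta>))"
    proof (rule ccontr)
      assume "\<not> ?thesis"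
      then have "(SUP k. ennreal (h k x + \<delta>)) < u x" by simp
      then obtain z where z: "(SUP k. ennreal (h k x + \<delta>)) < z" "z < u x" using dense by blast
      then obtain r where r: "(SUP k. ennreal (h k x + \<delta>)) < ennreal r" "ennreal r < u x" "0 \<le> r"
        by (cases z) auto
      \<comment> \<open>The first m layers contain x, as their levels do not exceed r, and yield m *
        \<delta>; what remains of r is less than \<delta>. This remainder is the origin of the term
        \<delta> in the claim.\<close>
      define m where "m = nat \<lfloor>r / \<delta>\<rfloor>"
      have m: "real m * \<delta> \<le> r" "r < real (Suc m) * \<delta>"
      proof -
        have "real m = of_int \<lfloor>r / \<delta>\<rfloor>" using \<delta> r(3) by (simp add: m_def)
        then have "real m \<le> r / \<delta>" "r / \<delta> < real (Suc m)" by linarith+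
        then show "real m * \<delta> \<le> r" "r < real (Suc m) * \<delta>"
          using \<delta> by (simp_all only: pos_le_divide_eq pos_divide_less_eq)
      qed
      have xT: "x \<in> T i" if "i < m" for i
      proof -
        have "real (Suc i) * \<delta> \<le> real m * \<delta>" using that \<delta> by (intro mult_right_mono) auto
        then have "ennreal (real (Suc i) * \<delta>) \<le> ennreal r" using m(1) by (intro ennreal_leI) linarith
        then have "x \<in> A i" using r(2) by (auto simp: A_def intro: order_trans less_imp_le)
        then show ?thesis using T(2) x by blast
      qed
      \<comment> \<open>The entry 1 keeps the minimum defined when m = 0.\<close>
      define D where "D = Min (insert 1 ((\<lambda>i. dist_out (T i) x) ` {..<m}))"
      have "D > 0" unfolding D_def using xT dist_out_pos[OF T_ne T(1)] by (subst Min_gr_iff) auto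
      then obtain k0 :: nat where "1 < real k0 * D" using reals_Archimedean3[of D] by auto
      define k where "k = max m k0"
      have "real k0 * D \<le> real k * D" using \<open>D > 0\<close> by (intro mult_right_mono) (auto simp: k_def)
      then have "1 \<le> real k * D" using \<open>1 < real k0 * D\<close> by linarith
      have q1: "q k i x = 1" if "i < m" for i
      proof -
        have "D \<le> dist_out (T i) x" unfolding D_def using that by (intro Min_le) auto
        then have "real k * D \<le> real k * dist_out (T i) x" by (intro mult_left_mono) auto
        then show ?thesis using \<open>1 \<le> real k * D\<close> by (simp add: q_def)
      qed
      have "real m = (\<Sum>i<m. q k i x)" using q1 by simp
      also have "\<dots> \<le> (\<Sum>i<k. q k i x)" by (rule sum_mono2) (use q in \<open>auto simp: k_def\<close>)
      finally have "\<delta> * real m \<le> h k x" unfolding h_def using \<delta> by (intro mult_left_mono) auto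
      moreover have "real (Suc m) * \<delta> = \<delta> * real m + \<delta>" by (simp add: algebra_simps)
      ultimately have "r < h k x + \<delta>" using m(2) by linarith
      then have "ennreal r \<le> (SUP k. ennreal (h k x + \<delta>))"
        by (intro SUP_upper2[of k] ennreal_leI) auto
      then show False using r(1) by simp
    qed
  qed (use h0 hk hS in auto)
qed

end

section \<open>Limits of paths\<close>

lemma compact_sequentially:
  fixes x :: "nat \<Rightarrow> 'a"
  assumes "compact K" "\<And>n. x n \<in> K"
  obtains l r where "l \<in> K" "strict_mono (r :: nat \<Rightarrow> nat)" "(\<lambda>n. x (r n)) \<longlonglongrightarrow> l"
proof -
  have "compactin mtopology K" using assms(1) by (simp add: mtopology_eq)
  then obtain l r where "l \<in> K" "strict_mono r" "limitin mtopology (x \<circ> r) l sequentially"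
    using assms(2) unfolding compactin_sequentially by (meson image_subsetI)
  then show ?thesis using that by (auto simp: mtopology_eq o_def)
qed

text \<open>A diagonal subsequence converges at all rational parameters. At any other parameter
  compactness yields a limit along a further subsequence, and the common Lipschitz constant, used at
  a nearby rational parameter, shows that the whole diagonal sequence converges to it.\<close>

lemma Arzela_Ascoli_lipschitz:
  fixes c :: "nat \<Rightarrow> real \<Rightarrow> 'a"
  assumes K: "compact K" "\<And>k t. t \<in> {0..1} \<Longrightarrow> c k t \<in> K"
    and lip: "\<And>k x y. x \<in> {0..1} \<Longrightarrow> y \<in> {0..1} \<Longrightarrow> d (c k x) (c k y) \<le> L * \<bar>x - y\<bar>" and L: "0 \<le> L"
  obtains s f where "strict_mono (s :: nat \<Rightarrow> nat)" "\<And>t. t \<in> {0..1} \<Longrightarrow> (\<lambda>k. c (s k) t) \<longlonglongrightarrow> f t"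
    "\<And>t. t \<in> {0..1} \<Longrightarrow> f t \<in> K"
proof -
  define D where "D = \<rat> \<inter> {0..1::real}"
  have D: "countable D" "D \<noteq> {}" unfolding D_def using countable_rat by (auto intro: exI[of _ 0])
  define q where "q = from_nat_into D"
  have q: "q n \<in> D" for n unfolding q_def using D(2) by (rule from_nat_into)
  have q01: "q n \<in> {0..1}" for n using q[of n] by (auto simp: D_def)
  interpret S: subseqs "\<lambda>n s. \<exists>l. (\<lambda>k. c (s k) (q n)) \<longlonglongrightarrow> l"
  proof
    fix n and s :: "nat \<Rightarrow> nat"
    obtain l r where "strict_mono (r :: nat \<Rightarrow> nat)" "(\<lambda>k. c (s (r k)) (q n)) \<longlonglongrightarrow> l"
      by (rule compact_sequentially[OF K(1), of "\<lambda>k. c (s k) (q n)"]) (use K(2)[OF q01] in auto)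
    then show "\<exists>r'. strict_mono r' \<and> (\<exists>l. (\<lambda>k. c ((s \<circ> r') k) (q n)) \<longlonglongrightarrow> l)" by auto
  qed
  let ?s = S.diagseq
  have qlim: "\<exists>l. (\<lambda>k. c (?s k) (q n)) \<longlonglongrightarrow> l" for n
  proof -
    have "\<exists>l. (\<lambda>k. c ((?s \<circ> ((+) (Suc n))) k) (q n)) \<longlonglongrightarrow> l"
    proof (rule S.diagseq_holds)
      fix r s :: "nat \<Rightarrow> nat" and n assume r: "strict_mono r" and "\<exists>l. (\<lambda>k. c (s k) (q n)) \<longlonglongrightarrow> l"
      then obtain l where "(\<lambda>k. c (s k) (q n)) \<longlonglongrightarrow> l" by blast
      from LIMSEQ_subseq_LIMSEQ[OF this r] show "\<exists>l. (\<lambda>k. c ((s \<circ> r) k) (q n)) \<longlonglongrightarrow> l"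
        by (auto simp: o_def)
    qed
    then obtain l where "(\<lambda>k. c (?s (k + Suc n)) (q n)) \<longlonglongrightarrow> l" by (auto simp: o_def add.commute)
    then show ?thesis using LIMSEQ_offset[of "\<lambda>k. c (?s k) (q n)" "Suc n"] by blast
  qed
  have lim: "\<exists>l\<in>K. (\<lambda>k. c (?s k) t) \<longlonglongrightarrow> l" if t: "t \<in> {0..1}" for t
  proof -
    obtain l r where l: "l \<in> K" and r: "strict_mono (r :: nat \<Rightarrow> nat)" and lr: "(\<lambda>k. c (?s (r k)) t) \<longlonglongrightarrow> l"
      by (rule compact_sequentially[OF K(1), of "\<lambda>k. c (?s k) t"]) (use K(2)[OF t] in auto)
    have "(\<lambda>k. d (c (?s k) t) l) \<longlonglongrightarrow> 0"
    proof (rule LIMSEQ_I)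
      fix e :: real assume e: "e > 0"
      have "\<exists>n. L * \<bar>t - q n\<bar> < e / 5"
      proof -
        have "\<exists>p\<in>D. \<bar>t - p\<bar> < e / (5 * (L + 1))"
        proof -
          have pos: "e / (5 * (L + 1)) > 0" using e L by auto
          show ?thesis
          proof (cases "t = 0")
            case True
            then show ?thesis using pos by (intro bexI[of _ 0]) (auto simp: D_def)
          next
            case False
            then have "max 0 (t - e / (5 * (L + 1))) < t" using t pos by auto
            from Rats_dense_in_real[OF this]
            obtain p where p: "p \<in> \<rat>" "max 0 (t - e / (5 * (L + 1))) < p" "p < t" by blast
            then have "p \<in> D" "\<bar>t - p\<bar> < e / (5 * (L + 1))" using t by (simp_all add: D_def)
            then show ?thesis by blast
          qed
        qed
        then obtain p where p: "p \<in> D" "\<bar>t - p\<bar> < e / (5 * (L + 1))" by blast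
        obtain n where "q n = p" using p(1) D from_nat_into_surj unfolding q_def by metis
        moreover have "L * \<bar>t - p\<bar> \<le> (L + 1) * \<bar>t - p\<bar>" by (intro mult_right_mono) auto
        moreover have "(L + 1) * \<bar>t - p\<bar> < e / 5" using p(2) L by (simp add: field_simps)
        ultimately show ?thesis by (intro exI[of _ n]) auto
      qed
      then obtain n where n: "L * \<bar>t - q n\<bar> < e / 5" ..
      obtain m where m: "(\<lambda>k. c (?s k) (q n)) \<longlonglongrightarrow> m" using qlim by blast
      have "\<forall>\<^sub>F k in sequentially. d (c (?s k) (q n)) m < e / 5"
        using m e unfolding tendsto_iff_dist by (intro order_tendstoD) auto
      moreover have "\<forall>\<^sub>F k in sequentially. d (c (?s (r k)) (q n)) m < e / 5"
        using LIMSEQ_subseq_LIMSEQ[OF m r] e unfolding tendsto_iff_dist o_def by (intro order_tendstoD) auto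
      moreover have "\<forall>\<^sub>F k in sequentially. d (c (?s (r k)) t) l < e / 5"
        using lr e unfolding tendsto_iff_dist by (intro order_tendstoD) auto
      ultimately have "\<forall>\<^sub>F k in sequentially. d (c (?s k) t) l < e"
      proof -
        assume 1: "\<forall>\<^sub>F k in sequentially. d (c (?s k) (q n)) m < e / 5"
          and 2: "\<forall>\<^sub>F k in sequentially. d (c (?s (r k)) (q n)) m < e / 5"
          and 3: "\<forall>\<^sub>F k in sequentially. d (c (?s (r k)) t) l < e / 5"
        \<comment> \<open>A single index j of the further subsequence links l to the limit m at the
          rational parameter; every late term at t is then compared with l through five small
          distances.\<close>
        obtain j where j: "d (c (?s (r j)) (q n)) m < e / 5" "d (c (?s (r j)) t) l < e / 5"
          using eventually_conj[OF 2 3] by (auto simp: eventually_sequentially)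
        show ?thesis using 1
        proof eventually_elim
          case (elim k)
          have a: "d (c i t) (c i (q n)) < e / 5" for i
            using lip[OF t q01, of i n] n by linarith
          have "d (c (?s k) t) l \<le> d (c (?s k) t) (c (?s k) (q n)) + d (c (?s k) (q n)) m
             + d m (c (?s (r j)) (q n)) + d (c (?s (r j)) (q n)) (c (?s (r j)) t) + d (c (?s (r j)) t) l"
            using triangle[of "c (?s k) t" "c (?s k) (q n)" l] triangle[of "c (?s k) (q n)" m l]
              triangle[of m "c (?s (r j)) (q n)" l] triangle[of "c (?s (r j)) (q n)" "c (?s (r j)) t" l] by simp
          also have "\<dots> < e" using a[of "?s k"] a[of "?s (r j)"] elim j commute[of m "c (?s (r j)) (q n)"]
            commute[of "c (?s (r j)) (q n)" "c (?s (r j)) t"] by linarith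
          finally show ?case .
        qed
      qed
      then show "\<exists>no. \<forall>n\<ge>no. norm (d (c (?s n) t) l - 0) < e" by (auto simp: eventually_sequentially)
    qed
    then show ?thesis using l by (auto simp: tendsto_iff_dist)
  qed
  define f where "f = (\<lambda>t. SOME l. l \<in> K \<and> (\<lambda>k. c (?s k) t) \<longlonglongrightarrow> l)"
  have "f t \<in> K \<and> (\<lambda>k. c (?s k) t) \<longlonglongrightarrow> f t" if "t \<in> {0..1}" for t
    unfolding f_def by (rule someI_ex) (use lim[OF that] in blast)
  then show ?thesis using that[OF S.subseq_diagseq, of f] by blast
qed

end

context umetric begin

text \<open>With constant speed on {0..1}, paths of different lengths live on the same interval, and
  the length becomes a factor that converges separately. Length 0 is treated apart because the
  scaling is then not invertible.\<close>

lemma path_integral_scaled: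
  assumes \<gamma>: "rectifiable d \<gamma>" and [measurable]: "h \<in> borel_measurable borel"
  shows "path_integral d h \<gamma> = ennreal (arc_len \<gamma> 1) * (\<integral>\<^sup>+t\<in>{0..1}. h (unit_param \<gamma> (arc_len \<gamma> 1 * t)) \<partial>lborel)"
proof -
  note [measurable] = measurable_unit_param[OF \<gamma>]
  define L where "L = arc_len \<gamma> 1"
  have L: "L \<ge> 0" using arc_mono[OF \<gamma>, of 0 1] by (simp add: L_def)
  show ?thesis
  proof (cases "L = 0")
    case True
    have "(\<integral>\<^sup>+s\<in>{0..0}. h (unit_param \<gamma> s) \<partial>lborel) = (\<integral>\<^sup>+s. 0 \<partial>(lborel :: real measure))"
      by (rule nn_integral_cong_AE, use AE_lborel_singleton[of "0::real"] in eventually_elim) auto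
    then show ?thesis using True by (simp add: path_integral_eq[OF \<gamma>] L_def)
  next
    case False
    have "path_integral d h \<gamma> = ennreal \<bar>L\<bar> * (\<integral>\<^sup>+x. h (unit_param \<gamma> (0 + L * x)) * indicator {0..L} (0 + L * x) \<partial>lborel)"
      unfolding path_integral_eq[OF \<gamma>] L_def[symmetric]
      by (rule nn_integral_real_affine) (use False in auto)
    also have "(\<integral>\<^sup>+x. h (unit_param \<gamma> (0 + L * x)) * indicator {0..L} (0 + L * x) \<partial>lborel)
       = (\<integral>\<^sup>+x. h (unit_param \<gamma> (L * x)) * indicator {0..1} x \<partial>lborel)"
      using False L by (intro nn_integral_cong) (auto simp: indicator_def zero_le_mult_iff)
    finally show ?thesis using L by (simp add: L_def)
  qed
qed

text \<open>At constant speed a subsequence converges to a path with Lipschitz constant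
  \<open>L0\<close>, the limit of the lengths. For fixed j all late densities dominate
  \<open>g j\<close>, so the length times the integral of \<open>g j\<close> along a late path is at
  most I; this passes to the limit because \<open>g j\<close> is continuous, and bounded on K. The
  limit path may be shorter than \<open>L0\<close>, and \<open>path_integral_lipschitz_le\<close>
  turns the limit inequality into one for its path integral.\<close>

lemma limit_path:
  fixes \<gamma> :: "nat \<Rightarrow> real \<Rightarrow> 'a" and g :: "nat \<Rightarrow> 'a \<Rightarrow> real"
  assumes \<gamma>: "\<And>k. rectifiable d (\<gamma> k)" "\<And>k. \<gamma> k 0 \<in> E" "\<And>k. \<gamma> k 1 \<notin> U"
      "\<And>k t. t \<in> {0..<1} \<Longrightarrow> \<gamma> k t \<in> U" "\<And>k. arc_len (\<gamma> k) 1 \<le> B"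
    and K: "compact K" "U \<subseteq> K" and E: "closed E" and U: "open U"
    and g: "\<And>j. continuous_on UNIV (g j)" "\<And>j x. 0 \<le> g j x" "\<And>j x. g j x \<le> g (Suc j) x"
    and I: "\<And>k. path_integral d (\<lambda>x. ennreal (g k x)) (\<gamma> k) \<le> ennreal I" "0 \<le> I"
  obtains c where "rectifiable d c" "c 0 \<in> E" "c 1 \<notin> U" "\<And>t. t \<in> {0..1} \<Longrightarrow> c t \<in> K"
    "\<And>j. path_integral d (\<lambda>x. ennreal (g j x)) c \<le> ennreal I"
proof -
  define L where "L = (\<lambda>k. arc_len (\<gamma> k) 1)"
  have L: "0 \<le> L k" "L k \<le> B" for k using arc_mono[OF \<gamma>(1), of 0 1 k] \<gamma>(5) by (auto simp: L_def)
  have "bounded (range L)" using L by (auto simp: bounded_iff intro!: exI[of _ B])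
  then obtain s1 L0 where s1: "strict_mono (s1 :: nat \<Rightarrow> nat)" and L0: "(\<lambda>k. L (s1 k)) \<longlonglongrightarrow> L0"
    using bounded_imp_convergent_subsequence[of L] by (auto simp: o_def)
  define c where "c = (\<lambda>k t. unit_param (\<gamma> (s1 k)) (L (s1 k) * t))"
  have c_lip: "d (c k x) (c k y) \<le> L (s1 k) * \<bar>x - y\<bar>" for k x y
    using unit_param_lipschitz[OF \<gamma>(1), of "s1 k" "L (s1 k) * x" "L (s1 k) * y"] L(1)[of "s1 k"]
    by (simp add: c_def abs_mult flip: right_diff_distrib)
  have \<gamma>K: "\<gamma> k t \<in> K" if t: "t \<in> {0..1}" for k t
  proof (cases "t = 1")
    case False
    then show ?thesis using \<gamma>(4)[of t k] K t by auto
  next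
    case True
    have clK: "closed K" using K by (simp add: compact_imp_closed)
    have "continuous_on (closure {0..<1}) (\<gamma> k)" using \<gamma>(1)[of k] by (simp add: rectifiable_iff path_def)
    moreover have "\<gamma> k ` {0..<1} \<subseteq> K" using \<gamma>(4) K by blast
    ultimately have "\<gamma> k ` closure {0..<1} \<subseteq> K" by (rule image_closure_subset[OF _ clK])
    then show ?thesis using True by auto
  qed
  have cK: "c k t \<in> K" if t: "t \<in> {0..1}" for k t
  proof -
    have "L (s1 k) * t \<in> {0..arc_len (\<gamma> (s1 k)) 1}"
      using t L(1)[of "s1 k"] by (auto simp: L_def intro: mult_left_le)
    then obtain u where u: "u \<in> {0..1}" "arc_len (\<gamma> (s1 k)) u = L (s1 k) * t" using arc_surj[OF \<gamma>(1)] by blast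
    then show ?thesis using unit_param_eqI[OF \<gamma>(1) u] \<gamma>K by (simp add: c_def)
  qed
  have c01: "c k 0 = \<gamma> (s1 k) 0" "c k 1 = \<gamma> (s1 k) 1" for k
    unfolding c_def by (rule unit_param_eqI[OF \<gamma>(1)]; simp add: L_def)+
  have B: "0 \<le> B" using L[of 0] by linarith
  have c_lipB: "d (c k x) (c k y) \<le> B * \<bar>x - y\<bar>" for k x y
  proof -
    have "L (s1 k) * \<bar>x - y\<bar> \<le> B * \<bar>x - y\<bar>" using L by (intro mult_right_mono) auto
    then show ?thesis using c_lip[of k x y] by linarith
  qed
  obtain s f where s: "strict_mono (s :: nat \<Rightarrow> nat)" and f: "\<And>t. t \<in> {0..1} \<Longrightarrow> (\<lambda>k. c (s k) t) \<longlonglongrightarrow> f t"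
    and fK: "\<And>t. t \<in> {0..1} \<Longrightarrow> f t \<in> K"
    using Arzela_Ascoli_lipschitz[of K c B] K(1) cK c_lipB B by metis
  have L0s: "(\<lambda>k. L (s1 (s k))) \<longlonglongrightarrow> L0" using LIMSEQ_subseq_LIMSEQ[OF L0 s] by (simp add: o_def)
  have L0_nn: "0 \<le> L0" using LIMSEQ_le_const[OF L0] L(1) by auto
  have f_lip: "d (f x) (f y) \<le> L0 * \<bar>x - y\<bar>" if "x \<in> {0..1}" "y \<in> {0..1}" for x y
  proof (rule LIMSEQ_le)
    show "(\<lambda>k. d (c (s k) x) (c (s k) y)) \<longlonglongrightarrow> d (f x) (f y)" using f that by (intro tendsto_dist_both) auto
    show "(\<lambda>k. L (s1 (s k)) * \<bar>x - y\<bar>) \<longlonglongrightarrow> L0 * \<bar>x - y\<bar>" by (intro tendsto_mult L0s tendsto_const)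
    show "\<exists>N. \<forall>n\<ge>N. d (c (s n) x) (c (s n) y) \<le> L (s1 (s n)) * \<bar>x - y\<bar>" using c_lip by blast
  qed
  have f_rect: "rectifiable d f" using f_lip L0_nn by (rule rectifiable_lipschitz)
  have f0: "f 0 \<in> E"
    by (rule Lim_in_closed_set[OF E _ _ f]) (use c01 \<gamma>(2) in auto)
  have f1: "f 1 \<in> - U"
    by (rule Lim_in_closed_set[OF _ _ _ f]) (use c01 \<gamma>(3) U in \<open>auto simp: closed_Compl\<close>)
  have g_mono: "g j x \<le> g k x" if "j \<le> k" for j k x
    using that by (induction rule: dec_induct) (auto intro: order_trans g(3))
  have fin: "path_integral d (\<lambda>x. ennreal (g j x)) f \<le> ennreal I" for j
  proof -
    have gc: "continuous_on S (\<lambda>t. g j (c k t))" for k S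
      unfolding c_def
      by (intro continuous_on_compose2[OF g(1)] continuous_on_compose2[OF continuous_on_unit_param[OF \<gamma>(1)]] continuous_intros) auto
    have gi: "(\<lambda>t. g j (c k t)) integrable_on {0..1}" for k
      by (intro integrable_continuous_interval gc)
    have 1: "L (s1 k) * integral {0..1} (\<lambda>t. g j (c k t)) \<le> I" if "j \<le> s1 k" for k
    proof -
      have "ennreal (L (s1 k)) * ennreal (integral {0..1} (\<lambda>t. g j (c k t)))
         = ennreal (L (s1 k)) * (\<integral>\<^sup>+t\<in>{0..1}. ennreal (g j (c k t)) \<partial>lborel)"
        using nn_integral_has_integral_lebesgue'[OF _ integrable_integral[OF gi[of k]]] g(2) by simp
      also have "\<dots> = path_integral d (\<lambda>x. ennreal (g j x)) (\<gamma> (s1 k))"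
        using path_integral_scaled[OF \<gamma>(1), of "\<lambda>x. ennreal (g j x)" "s1 k"] borel_measurable_continuous_onI[OF g(1), of j]
        by (simp add: c_def L_def)
      also have "\<dots> \<le> path_integral d (\<lambda>x. ennreal (g (s1 k) x)) (\<gamma> (s1 k))"
        by (rule path_integral_mono_image[OF \<gamma>(1)]) (intro ennreal_leI g_mono that)
      also have "\<dots> \<le> ennreal I" by (rule I)
      finally show ?thesis using L(1) I(2) g(2) 
        by (simp add: ennreal_le_iff flip: ennreal_mult' )
    qed
    obtain M where M: "\<And>x. x \<in> K \<Longrightarrow> g j x \<le> M"
    proof -
      have "compact (g j ` K)" by (intro compact_continuous_image continuous_on_subset[OF g(1)] K(1)) auto
      then have "bdd_above (g j ` K)" by (intro bounded_imp_bdd_above compact_imp_bounded)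
      then show ?thesis using that by (auto simp: bdd_above_def)
    qed
    have 2: "(\<lambda>k. integral {0..1} (\<lambda>t. g j (c (s k) t))) \<longlonglongrightarrow> integral {0..1} (\<lambda>t. g j (f t))"
    proof (rule dominated_convergence(2))
      show "(\<lambda>_. M) integrable_on {0..1::real}" by (intro integrable_continuous_interval continuous_intros)
      show "norm (g j (c (s k) x)) \<le> M" if "x \<in> {0..1}" for k x using M[OF cK[OF that]] g(2) by simp
      show "(\<lambda>k. g j (c (s k) x)) \<longlonglongrightarrow> g j (f x)" if "x \<in> {0..1}" for x
        using continuous_on_tendsto_compose[OF g(1) f[OF that]] by simp
    qed (rule gi)
    have "L0 * integral {0..1} (\<lambda>t. g j (f t)) \<le> I"
    proof (rule LIMSEQ_le_const2)
      show "(\<lambda>k. L (s1 (s k)) * integral {0..1} (\<lambda>t. g j (c (s k) t))) \<longlonglongrightarrow> L0 * integral {0..1} (\<lambda>t. g j (f t))"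
        by (intro tendsto_mult L0s 2)
      have "j \<le> s1 (s k)" if "j \<le> k" for k
        using seq_suble[OF s, of k] seq_suble[OF s1, of "s k"] that by linarith
      then show "\<exists>N. \<forall>n\<ge>N. L (s1 (s n)) * integral {0..1} (\<lambda>t. g j (c (s n) t)) \<le> I"
        using 1 by blast
    qed
    then show ?thesis
      using path_integral_lipschitz_le[OF f_lip L0_nn g(1,2), of j] by (auto intro: order_trans ennreal_leI)
  qed
  show ?thesis using that[OF f_rect f0 _ fK fin] f1 by simp
qed

end

section \<open>Energy estimates from the Poincare inequality\<close>

lemma measurable_epowr [measurable]:
  assumes [measurable]: "g \<in> borel_measurable M" shows "(\<lambda>x. epowr (g x) a) \<in> borel_measurable M"
  unfolding epowr_def by measurable

lemma epowr_ennreal: "0 \<le> z \<Longrightarrow> epowr (ennreal z) a = ennreal (z powr a)"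
  by (simp add: epowr_def)

text \<open>The data of an admissible target with fixed constants: C of Ahlfors regularity, P and
  \<tau> of the Poincare inequality. The Ahlfors bounds hold at every radius, as in an unbounded
  space; this lets balls grow without limit in \<open>telescope_up\<close>.\<close>

locale loewner_space = umetric d for d :: "'a::t2_space \<Rightarrow> 'a \<Rightarrow> real" +
  fixes \<mu> :: "'a measure" and n :: nat and p C P \<tau> :: real
  assumes sets_\<mu>: "sets \<mu> = sets borel"
    and p_gt: "real n - 1 < p" and p_lt: "p < real n" and p_gt1: "1 < p"
    and C: "C \<ge> 1" and P: "P \<ge> 1" and \<tau>: "\<tau> \<ge> 1"
    and ahlfors: "\<And>x R. 0 < R \<Longrightarrow> ennreal (R ^ n / C) \<le> emeasure \<mu> (mball x R) \<and>
        emeasure \<mu> (mball x R) \<le> ennreal (C * R ^ n)"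
    and poincare: "\<And>x r u \<rho>. 0 < r \<Longrightarrow> bounded (u ` mball x r) \<Longrightarrow>
        continuous_on (mball x r) u \<Longrightarrow> upper_gradient d \<rho> u \<Longrightarrow>
        (\<integral>\<^sup>+y\<in>mball x r. ennreal \<bar>u y - (LINT z:mball x r|\<mu>. u z) / measure \<mu> (mball x r)\<bar> \<partial>\<mu>) / emeasure \<mu> (mball x r)
        \<le> ennreal P * ediam d (mball x r) *
          epowr ((\<integral>\<^sup>+y\<in>mball x (\<tau> * r). epowr (\<rho> y) p \<partial>\<mu>) / emeasure \<mu> (mball x (\<tau> * r))) (1 / p)"
begin

lemma ball_meas:
  assumes "0 < R"
  shows "emeasure \<mu> (mball x R) < top" "R ^ n / C \<le> measure \<mu> (mball x R)" "measure \<mu> (mball x R) \<le> C * R ^ n"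
    "0 < measure \<mu> (mball x R)" "emeasure \<mu> (mball x R) = ennreal (measure \<mu> (mball x R))"
proof -
  show fin: "emeasure \<mu> (mball x R) < top" using ahlfors[OF assms, of x] by (auto intro: le_less_trans)
  then show eq: "emeasure \<mu> (mball x R) = ennreal (measure \<mu> (mball x R))"
    by (simp add: emeasure_eq_ennreal_measure less_top)
  have pos: "0 < R ^ n / C" using assms C by auto
  show le: "R ^ n / C \<le> measure \<mu> (mball x R)" 
    using ahlfors[OF assms, of x] pos unfolding eq by (simp add: ennreal_le_iff)
  show "measure \<mu> (mball x R) \<le> C * R ^ n"
    using ahlfors[OF assms, of x] assms C unfolding eq by (simp add: ennreal_le_iff)
  show "0 < measure \<mu> (mball x R)" using le pos by linarith
qed

lemma ball_sets [measurable, simp]: "mball x R \<in> sets \<mu>"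
  using open_mball[of x R] by (simp add: sets_\<mu>)

text \<open>The exponents satisfy \<open>\<beta> * p = n - p\<close> and \<open>\<theta> * p = 1 + p - n\<close>; the latter is what makes the local
  energies below proportional to the radius.\<close>

definition \<beta> where "\<beta> = real n / p - 1"
definition \<theta> where "\<theta> = (1 + p - real n) / p"
text \<open>The constant of \<open>avg_halving\<close>: \<open>C\<^sup>2 * 2 ^ n\<close> compares
  the measures of a ball and its half, another factor 2 comes from the diameter of the ball, and
  \<open>C powr (1 / p)\<close> from the lower bound for the measure of the ball of radius
  \<open>\<tau> * r\<close>.\<close>

definition K where "K = C\<^sup>2 * 2 ^ Suc n * P * C powr (1 / p)"

lemma \<beta>_pos: "0 < \<beta>" and \<theta>_pos: "0 < \<theta>" and K_pos: "0 < K"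
  using p_gt p_lt p_gt1 C P by (auto simp: \<beta>_def \<theta>_def K_def)

text \<open>Chosen so that the numbers \<open>\<kappa> * (2 powr (-\<theta>)) ^ j\<close> sum to
  1/4, half of the value 1/2 that the potential is assumed to have. \<open>S\<close> is the sum of
  the geometric series with ratio \<open>2 powr (-\<beta>)\<close>.\<close>

definition \<kappa> where "\<kappa> = (1 - 2 powr (-\<theta>)) / 4"
definition S where "S = 1 / (1 - 2 powr (-\<beta>))"

lemma powr_neg_lt1: "0 < s \<Longrightarrow> 2 powr (-s) < (1::real)"
  using powr_less_mono[of "-s" 0 2] by simp

lemma \<kappa>_pos: "0 < \<kappa>" and S_pos: "0 < S"
proof -
  show "0 < \<kappa>" unfolding \<kappa>_def
    by (rule divide_pos_pos) (simp_all only: diff_gt_0_iff_gt powr_neg_lt1[OF \<theta>_pos] zero_less_numeral)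
  show "0 < S" unfolding S_def using powr_neg_lt1[OF \<beta>_pos] by (intro divide_pos_pos) linarith+
qed

text \<open>The smaller of the constants of two cases: large total energy, and the covering
  argument, where 12 is the length of an interval of radius 6 and \<tau> the enlargement of balls in
  the Poincare inequality.\<close>

definition c0 where "c0 = min ((1 / (4 * K * S)) powr p) ((\<kappa> / K) powr p / (12 * \<tau>))"

lemma c0_pos: "0 < c0" using K_pos S_pos \<kappa>_pos \<tau> by (auto simp: c0_def)

context
  fixes w :: "'a \<Rightarrow> real" and g :: "'a \<Rightarrow> ennreal"
  assumes w_cont: "continuous_on UNIV w" and w01: "\<And>x. 0 \<le> w x" "\<And>x. w x \<le> 1"
    and ug: "upper_gradient d g w" and g_fin: "(\<integral>\<^sup>+x. epowr (g x) p \<partial>\<mu>) < top"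
begin

text \<open>As a finite measure the energy is additive over disjoint balls, which the covering
  argument uses.\<close>

definition \<nu> where "\<nu> = density \<mu> (\<lambda>x. epowr (g x) p)"

definition avg where "avg x r = (LINT z:mball x r|\<mu>. w z) / measure \<mu> (mball x r)"

lemma g_meas [measurable]: "g \<in> borel_measurable \<mu>"
  using ug by (simp add: upper_gradient_def metric_borel_eq measurable_cong_sets[OF sets_\<mu> refl])

lemma w_meas [measurable]: "w \<in> borel_measurable \<mu>"
  using borel_measurable_continuous_onI[OF w_cont] by (simp add: measurable_cong_sets[OF sets_\<mu> refl])

lemma sets_\<nu>: "sets \<nu> = sets \<mu>" by (simp add: \<nu>_def)

lemma emeasure_\<nu>: "A \<in> sets \<mu> \<Longrightarrow> emeasure \<nu> A = (\<integral>\<^sup>+x\<in>A. epowr (g x) p \<partial>\<mu>)"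
  unfolding \<nu>_def by (rule emeasure_density) auto

lemma finite_measure_\<nu>: "finite_measure \<nu>"
proof
  have "emeasure \<nu> (space \<nu>) = (\<integral>\<^sup>+x. epowr (g x) p \<partial>\<mu>)"
    by (simp add: \<nu>_def emeasure_density cong: nn_integral_cong)
  then show "emeasure \<nu> (space \<nu>) \<noteq> \<infinity>" using g_fin by auto
qed

interpretation \<nu>: finite_measure \<nu> by (rule finite_measure_\<nu>)

definition \<omega> where "\<omega> = measure \<nu> UNIV"

lemma \<nu>_le_\<omega>: "measure \<nu> A \<le> \<omega>"
  using \<nu>.bounded_measure[of A] sets_eq_imp_space_eq[OF sets_\<nu>] sets_eq_imp_space_eq[OF sets_\<mu>]
  by (simp add: \<omega>_def)

lemma w_int: "set_integrable \<mu> (mball x r) w" "set_integrable \<mu> (mball x r) (\<lambda>y. \<bar>w y - a\<bar>)"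
  "set_integrable \<mu> (mball x r) (\<lambda>y. w y - a)"
proof -
  have fin: "emeasure \<mu> (mball x r) < top" using ball_meas(1)[of r x] mball_eq_empty[of x r] by (cases "r > 0") auto
  have "set_integrable \<mu> (mball x r) h" if "h \<in> borel_measurable \<mu>" "\<And>y. \<bar>h y\<bar> \<le> 1 + \<bar>a\<bar>" for h :: "'a \<Rightarrow> real"
    unfolding set_integrable_def
    by (rule integrableI_bounded_set_indicator[where B="1 + \<bar>a\<bar>"]) (use fin that in auto)
  note S = this
  have b: "\<bar>w y\<bar> \<le> 1 + \<bar>a\<bar>" "\<bar>\<bar>w y - a\<bar>\<bar> \<le> 1 + \<bar>a\<bar>" "\<bar>w y - a\<bar> \<le> 1 + \<bar>a\<bar>" for y
    using w01[of y] by auto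
  show "set_integrable \<mu> (mball x r) w" by (rule S) (use b in auto)
  show "set_integrable \<mu> (mball x r) (\<lambda>y. \<bar>w y - a\<bar>)" by (rule S) (use b in auto)
  show "set_integrable \<mu> (mball x r) (\<lambda>y. w y - a)" by (rule S) (use b in auto)
qed

lemma poincare_real:
  assumes r: "0 < r"
  shows "(LINT y:mball x r|\<mu>. \<bar>w y - avg x r\<bar>) / measure \<mu> (mball x r)
     \<le> P * (2 * r) * (measure \<nu> (mball x (\<tau> * r)) / measure \<mu> (mball x (\<tau> * r))) powr (1 / p)"
proof -
  let ?B = "mball x r" and ?T = "mball x (\<tau> * r)"
  let ?J = "LINT y:?B|\<mu>. \<bar>w y - avg x r\<bar>"
  have J0: "0 \<le> ?J" unfolding set_lebesgue_integral_def by (intro integral_nonneg_AE) auto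
  have \<tau>r: "0 < \<tau> * r" using r \<tau> by simp
  have nn: "(\<integral>\<^sup>+y\<in>?B. ennreal \<bar>w y - avg x r\<bar> \<partial>\<mu>) = ennreal ?J"
  proof -
    have "(\<integral>\<^sup>+y\<in>?B. ennreal \<bar>w y - avg x r\<bar> \<partial>\<mu>) = (\<integral>\<^sup>+y. ennreal (indicator ?B y *\<^sub>R \<bar>w y - avg x r\<bar>) \<partial>\<mu>)"
      by (intro nn_integral_cong) (auto simp: indicator_def)
    also have "\<dots> = ennreal ?J"
      unfolding set_lebesgue_integral_def
      using w_int(2)[of x r "avg x r"] by (intro nn_integral_eq_integral) (auto simp: set_integrable_def)
    finally show ?thesis .
  qed
  have ed: "ediam d ?B \<le> ennreal (2 * r)"
    unfolding ediam_def
  proof (intro SUP_least ennreal_leI)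
    fix y z assume "y \<in> ?B" "z \<in> ?B"
    then show "d y z \<le> 2 * r" using triangle[of y x z] by (simp add: commute)
  qed
  have en: "(\<integral>\<^sup>+y\<in>?T. epowr (g y) p \<partial>\<mu>) / emeasure \<mu> ?T = ennreal (measure \<nu> ?T / measure \<mu> ?T)"
  proof -
    have "(\<integral>\<^sup>+y\<in>?T. epowr (g y) p \<partial>\<mu>) = ennreal (measure \<nu> ?T)"
      using emeasure_\<nu>[of ?T] \<nu>.emeasure_eq_measure[of ?T] by simp
    then show ?thesis using ball_meas(4,5)[OF \<tau>r, of x] by (simp only: divide_ennreal measure_nonneg)
  qed
  have bd: "bounded (w ` ?B)" using w01 by (auto simp: bounded_iff intro!: exI[of _ 1])
  have "ennreal (?J / measure \<mu> ?B) = (\<integral>\<^sup>+y\<in>?B. ennreal \<bar>w y - avg x r\<bar> \<partial>\<mu>) / emeasure \<mu> ?B"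
    unfolding nn using ball_meas(4,5)[OF r, of x] J0 by (simp add: divide_ennreal)
  also have "\<dots> \<le> ennreal P * ediam d ?B * epowr ((\<integral>\<^sup>+y\<in>?T. epowr (g y) p \<partial>\<mu>) / emeasure \<mu> ?T) (1 / p)"
    unfolding avg_def by (rule poincare[OF r bd continuous_on_subset[OF w_cont subset_UNIV] ug])
  also have "\<dots> \<le> ennreal P * ennreal (2 * r) * ennreal ((measure \<nu> ?T / measure \<mu> ?T) powr (1 / p))"
    unfolding en by (subst epowr_ennreal) (auto intro!: mult_right_mono mult_left_mono ed)
  also have "\<dots> = ennreal (P * (2 * r) * (measure \<nu> ?T / measure \<mu> ?T) powr (1 / p))"
    using P r by (simp add: ennreal_mult)
  finally show ?thesis using P r by (subst (asm) ennreal_le_iff) auto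
qed

text \<open>The means over a ball and its half differ by at most the mean oscillation over the
  larger ball times the ratio of the measures. The power of the radius is r, from the diameter,
  times \<open>r powr (- real n / p)\<close>, from normalising the energy, that is
  \<open>r powr (-\<beta>)\<close>.\<close>

lemma avg_halving:
  assumes r: "0 < r"
  shows "\<bar>avg x (r / 2) - avg x r\<bar> \<le> K * r powr (-\<beta>) * measure \<nu> (mball x (\<tau> * r)) powr (1 / p)"
proof -
  let ?B = "mball x r" and ?B' = "mball x (r / 2)" and ?T = "mball x (\<tau> * r)"
  let ?J = "LINT y:?B|\<mu>. \<bar>w y - avg x r\<bar>"
  let ?N = "measure \<nu> ?T"
  note m = ball_meas[OF r, of x] and m' = ball_meas[of "r / 2" x]
  have r2: "0 < r / 2" using r by simp
  have \<tau>r: "0 < \<tau> * r" using r \<tau> by simp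
  have J0: "0 \<le> ?J" unfolding set_lebesgue_integral_def by (intro integral_nonneg_AE) auto
  have "(LINT z:?B'|\<mu>. w z - avg x r) = (LINT z:?B'|\<mu>. w z) - measure \<mu> ?B' * avg x r"
    using set_integral_diff(2)[OF w_int(1)[of x "r/2"], of "\<lambda>_. avg x r"] m'(1)[OF r2]
    by (simp add: set_integrable_def set_lebesgue_integral_def)
  then have "avg x (r / 2) - avg x r = (LINT z:?B'|\<mu>. w z - avg x r) / measure \<mu> ?B'"
    using m'(4)[OF r2] by (simp add: avg_def[of x "r/2"] field_simps)
  then have "\<bar>avg x (r / 2) - avg x r\<bar> = \<bar>LINT z:?B'|\<mu>. w z - avg x r\<bar> / measure \<mu> ?B'"
    by (simp add: abs_divide)
  also have "\<bar>LINT z:?B'|\<mu>. w z - avg x r\<bar> \<le> (LINT z:?B'|\<mu>. \<bar>w z - avg x r\<bar>)"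
    using set_integral_norm_bound[OF w_int(3)[of x "r/2" "avg x r"]] by simp
  also have "\<dots> \<le> ?J"
    unfolding set_lebesgue_integral_def
    by (rule integral_mono)
       (use w_int(2)[of x r "avg x r"] w_int(2)[of x "r/2" "avg x r"] r in \<open>auto simp: set_integrable_def indicator_def\<close>)
  also have "?J / measure \<mu> ?B' = (?J / measure \<mu> ?B) * (measure \<mu> ?B / measure \<mu> ?B')"
    using m(4) by simp
  also have "\<dots> \<le> (P * (2 * r) * (?N / measure \<mu> ?T) powr (1 / p)) * (C\<^sup>2 * 2 ^ n)"
  proof (rule mult_mono)
    have "measure \<mu> ?B / measure \<mu> ?B' \<le> (C * r ^ n) / ((r / 2) ^ n / C)"
      using m(3) m'(2)[OF r2] r C by (intro frac_le) auto
    also have "\<dots> = C\<^sup>2 * 2 ^ n" using r C by (simp add: power_divide power2_eq_square field_simps)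
    finally show "measure \<mu> ?B / measure \<mu> ?B' \<le> C\<^sup>2 * 2 ^ n" .
  qed (use poincare_real[OF r, of x] P r in auto)
  also have "\<dots> \<le> (P * (2 * r) * (C powr (1 / p) * r powr (- real n / p) * ?N powr (1 / p))) * (C\<^sup>2 * 2 ^ n)"
  proof (intro mult_right_mono mult_left_mono)
    \<comment> \<open>As \<tau> \<ge> 1, the Ahlfors bound for the radius r serves for the enlarged
      ball too and keeps \<tau> out of \<open>K\<close>.\<close>
    have "r ^ n / C \<le> (\<tau> * r) ^ n / C"
      using r \<tau> C by (intro divide_right_mono power_mono) auto
    then have "r ^ n / C \<le> measure \<mu> ?T" using ball_meas(2)[OF \<tau>r, of x] by linarith
    then have "?N / measure \<mu> ?T \<le> ?N / (r ^ n / C)"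
      using r C ball_meas(4)[OF \<tau>r, of x] by (intro divide_left_mono mult_pos_pos) auto
    also have "\<dots> = C * r powr (- real n) * ?N" using r C by (simp add: powr_minus powr_realpow divide_simps)
    finally have "(?N / measure \<mu> ?T) powr (1 / p) \<le> (C * r powr (- real n) * ?N) powr (1 / p)"
      using p_gt1 by (intro powr_mono2) auto
    also have "\<dots> = C powr (1 / p) * r powr (- real n / p) * ?N powr (1 / p)"
      using C r by (simp add: powr_mult powr_powr)
    finally show "(?N / measure \<mu> ?T) powr (1 / p) \<le> C powr (1 / p) * r powr (- real n / p) * ?N powr (1 / p)" .
  qed (use P r in auto)
  also have "\<dots> = K * (r powr 1 * r powr (- real n / p)) * ?N powr (1 / p)"
    using r by (simp add: K_def)
  also have "r powr 1 * r powr (- real n / p) = r powr (-\<beta>)"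
    unfolding powr_add[symmetric] by (simp add: \<beta>_def)
  finally show ?thesis using m'(4)[OF r2] by (simp add: divide_right_mono)
qed

lemma avg_tendsto: "(\<lambda>j. avg x (r * (1/2) ^ j)) \<longlonglongrightarrow> w x" if r: "0 < r"
proof (rule LIMSEQ_I)
  fix e :: real assume e: "e > 0"
  obtain \<delta> where \<delta>: "\<delta> > 0" "\<And>y. d x y < \<delta> \<Longrightarrow> \<bar>w y - w x\<bar> < e / 2"
  proof -
    have "open {y. \<bar>w y - w x\<bar> < e / 2}" by (intro open_Collect_less continuous_intros w_cont)
    moreover have "x \<in> {y. \<bar>w y - w x\<bar> < e / 2}" using e by simp
    ultimately obtain \<delta> where "\<delta> > 0" "mball x \<delta> \<subseteq> {y. \<bar>w y - w x\<bar> < e / 2}"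
      using open_iff_mball by blast
    then show ?thesis using that[of \<delta>] by (auto simp: subset_eq)
  qed
  have close: "\<bar>avg x s - w x\<bar> \<le> e / 2" if s: "0 < s" "s < \<delta>" for s
  proof -
    note m = ball_meas[OF s(1), of x]
    have "(LINT z:mball x s|\<mu>. w z - w x) = (LINT z:mball x s|\<mu>. w z) - measure \<mu> (mball x s) * w x"
      using set_integral_diff(2)[OF w_int(1)[of x s], of "\<lambda>_. w x"] m(1)
      by (simp add: set_integrable_def set_lebesgue_integral_def)
    then have "avg x s - w x = (LINT z:mball x s|\<mu>. w z - w x) / measure \<mu> (mball x s)"
      using m(4) by (simp add: avg_def field_simps)
    then have "\<bar>avg x s - w x\<bar> = \<bar>LINT z:mball x s|\<mu>. w z - w x\<bar> / measure \<mu> (mball x s)"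
      by (simp add: abs_divide)
    also have "\<bar>LINT z:mball x s|\<mu>. w z - w x\<bar> \<le> (LINT z:mball x s|\<mu>. \<bar>w z - w x\<bar>)"
      using set_integral_norm_bound[OF w_int(3)[of x s "w x"]] by simp
    also have "\<dots> \<le> (LINT z:mball x s|\<mu>. e / 2)"
      unfolding set_lebesgue_integral_def
    proof (rule integral_mono)
      show "indicator (mball x s) y *\<^sub>R \<bar>w y - w x\<bar> \<le> indicator (mball x s) y *\<^sub>R (e / 2)" for y
        using \<delta>(2)[of y] s by (auto simp: indicator_def)
    qed (use w_int(2)[of x s "w x"] m(1) in \<open>auto simp: set_integrable_def\<close>)
    also have "\<dots> = e / 2 * measure \<mu> (mball x s)" by (simp add: set_lebesgue_integral_def)
    finally show ?thesis using m(4) by (simp add: divide_right_mono pos_divide_le_eq)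
  qed
  have "(\<lambda>j. r * (1/2) ^ j) \<longlonglongrightarrow> r * 0" by (intro tendsto_intros LIMSEQ_power_zero) auto
  then have "\<forall>\<^sub>F j in sequentially. r * (1/2) ^ j < \<delta>" using \<delta>(1) by (intro order_tendstoD) auto
  then obtain N where N: "\<And>j. j \<ge> N \<Longrightarrow> r * (1/2) ^ j < \<delta>" by (auto simp: eventually_sequentially)
  show "\<exists>no. \<forall>j\<ge>no. norm (avg x (r * (1/2) ^ j) - w x) < e"
  proof (intro exI[of _ N] allI impI)
    fix j assume "N \<le> j"
    then have "\<bar>avg x (r * (1/2) ^ j) - w x\<bar> \<le> e / 2" using N r by (intro close) auto
    then show "norm (avg x (r * (1/2) ^ j) - w x) < e" using e by simp
  qed
qed

lemma geometric_le: "0 \<le> q \<Longrightarrow> q < 1 \<Longrightarrow> (\<Sum>j<N. q ^ j) \<le> 1 / (1 - (q::real))"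
  using sum_le_suminf[of "\<lambda>j. q ^ j" "{..<N}"] suminf_geometric[of q] by simp

text \<open>By continuity w x is the limit of the means over shrinking balls. The assumed bounds on
  the halving steps sum to at most 1/4, so of the value 1/2 at least 1/4 survives at radius
  r.\<close>

lemma telescope_down:
  assumes r: "0 < r" and wx: "1/2 \<le> w x"
    and small: "\<And>j::nat. K * (r * (1/2)^j) powr (-\<beta>) * measure \<nu> (mball x (\<tau> * (r * (1/2)^j))) powr (1/p) < \<kappa> * (2 powr (-\<theta>)) ^ j"
  shows "1/4 \<le> avg x r"
proof -
  let ?a = "\<lambda>j. avg x (r * (1/2) ^ j)"
  have step: "?a (Suc j) - ?a j \<le> \<kappa> * (2 powr (-\<theta>)) ^ j" for j
    using avg_halving[of "r * (1/2)^j" x] small[of j] r by (simp add: mult.commute mult.left_commute)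
  have tele: "?a N - ?a 0 \<le> 1/4" for N
  proof -
    have "?a N - ?a 0 = (\<Sum>j<N. ?a (Suc j) - ?a j)" by (rule sum_lessThan_telescope[symmetric])
    also have "\<dots> \<le> (\<Sum>j<N. \<kappa> * (2 powr (-\<theta>)) ^ j)" by (intro sum_mono step)
    also have "\<dots> = \<kappa> * (\<Sum>j<N. (2 powr (-\<theta>)) ^ j)" by (simp add: sum_distrib_left)
    also have "\<dots> \<le> \<kappa> * (1 / (1 - 2 powr (-\<theta>)))"
      using \<kappa>_pos powr_neg_lt1[OF \<theta>_pos] by (intro mult_left_mono geometric_le) auto
    also have "\<dots> = 1/4"
    proof -
      have "\<kappa> * (1 / (1 - q)) = 1/4" if "q < 1" "\<kappa> = (1 - q) / 4" for q using that by simp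
      then show ?thesis using powr_neg_lt1[OF \<theta>_pos] \<kappa>_def by blast
    qed
    finally show ?thesis .
  qed
  have "?a N \<le> avg x r + 1/4" for N
    using tele[of N] by simp
  then have "w x \<le> avg x r + 1/4" using avg_tendsto[OF r, of x] by (intro LIMSEQ_le_const2) auto
  then show ?thesis using wx by simp
qed

text \<open>Each doubling of the radius costs at most a term of a geometric series with ratio
  \<open>2 powr (-\<beta>)\<close>, as the energy of a ball is at most the total. The means over
  ever larger balls tend to 0, since w vanishes off a bounded set while the volume grows like
  \<open>R ^ n\<close>; the mean at radius r is thus at most the sum of these costs.\<close>

lemma telescope_up:
  assumes r: "0 < r" and U: "mbounded U" "\<And>y. y \<notin> U \<Longrightarrow> w y = 0"
  shows "avg x r \<le> K * S * r powr (-\<beta>) * \<omega> powr (1/p)"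
proof -
  let ?b = "\<lambda>j. avg x (r * 2 ^ j)"
  let ?c = "K * r powr (-\<beta>) * \<omega> powr (1/p)"
  have step: "?b j - ?b (Suc j) \<le> ?c * (2 powr (-\<beta>)) ^ j" for j
  proof -
    have "?b j - ?b (Suc j) \<le> K * (r * 2 ^ Suc j) powr (-\<beta>) * measure \<nu> (mball x (\<tau> * (r * 2 ^ Suc j))) powr (1/p)"
      using avg_halving[of "r * 2 ^ Suc j" x] r by simp
    also have "\<dots> \<le> K * (r * 2 ^ Suc j) powr (-\<beta>) * \<omega> powr (1/p)"
      using K_pos p_gt1 by (intro mult_left_mono powr_mono2 \<nu>_le_\<omega>) auto
    also have "(r * 2 ^ Suc j) powr (-\<beta>) \<le> (r * 2 ^ j) powr (-\<beta>)"
      using r \<beta>_pos by (intro powr_mono2') auto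
    also have "(r * 2 ^ j) powr (-\<beta>) = r powr (-\<beta>) * (2 powr (-\<beta>)) ^ j"
      using r by (simp add: powr_mult powr_power powr_realpow[symmetric] powr_powr mult.commute)
    finally show ?thesis using K_pos by (simp add: mult_ac mult_left_mono mult_right_mono)
  qed
  have up: "avg x r \<le> ?b N + K * S * r powr (-\<beta>) * \<omega> powr (1/p)" for N
  proof -
    have "?b 0 - ?b N = (\<Sum>j<N. ?b j - ?b (Suc j))"
      by (induction N) auto
    also have "\<dots> \<le> (\<Sum>j<N. ?c * (2 powr (-\<beta>)) ^ j)" by (intro sum_mono step)
    also have "\<dots> = ?c * (\<Sum>j<N. (2 powr (-\<beta>)) ^ j)" by (simp add: sum_distrib_left)
    also have "\<dots> \<le> ?c * S" unfolding S_def
      using K_pos powr_neg_lt1[OF \<beta>_pos] by (intro mult_left_mono geometric_le) auto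
    finally show ?thesis by (simp add: algebra_simps)
  qed
  obtain R0 where R0: "0 < R0" "U \<subseteq> mball x R0"
  proof -
    obtain a B where "U \<subseteq> mcball a B" using U(1) by (auto simp: mbounded_def)
    have "U \<subseteq> mball x (\<bar>d x a + B\<bar> + 1)"
    proof
      fix y assume "y \<in> U"
      then have "d a y \<le> B" using \<open>U \<subseteq> mcball a B\<close> by auto
      then show "y \<in> mball x (\<bar>d x a + B\<bar> + 1)" using triangle[of x a y] by auto
    qed
    then show ?thesis using that[of "\<bar>d x a + B\<bar> + 1"] by auto
  qed
  have bN: "?b N \<le> (C * R0 ^ n) * C * (1 / (r * 2 ^ N) ^ n)" for N
  proof -
    let ?R = "r * 2 ^ N"
    have R: "0 < ?R" using r by simp
    note m = ball_meas[OF R, of x]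
    have "(LINT z:mball x ?R|\<mu>. w z) \<le> (LINT z|\<mu>. indicator (mball x R0) z)"
      unfolding set_lebesgue_integral_def
    proof (rule integral_mono)
      show "indicator (mball x ?R) z *\<^sub>R w z \<le> indicator (mball x R0) z" for z
        using U(2)[of z] subsetD[OF R0(2), of z] w01[of z] by (auto simp: indicator_def)
      show "integrable \<mu> (\<lambda>z. indicator (mball x ?R) z *\<^sub>R w z)" using w_int(1)[of x ?R] by (simp add: set_integrable_def)
      show "integrable \<mu> (indicator (mball x R0) :: 'a \<Rightarrow> real)"
        using ball_meas(1)[OF R0(1), of x] by simp
    qed
    also have "\<dots> = measure \<mu> (mball x R0)" by simp
    also have "\<dots> \<le> C * R0 ^ n" by (rule ball_meas(3)[OF R0(1)])
    finally have "?b N \<le> (C * R0 ^ n) / measure \<mu> (mball x ?R)"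
      unfolding avg_def using m(4) by (intro divide_right_mono) auto
    also have "\<dots> \<le> (C * R0 ^ n) / (?R ^ n / C)"
      using m(2,4) R C R0 by (intro divide_left_mono) auto
    finally show ?thesis by simp
  qed
  have "(\<lambda>N. (C * R0 ^ n) * C * (1 / (r * 2 ^ N) ^ n)) \<longlonglongrightarrow> (C * R0 ^ n) * C * 0"
  proof (intro tendsto_mult tendsto_const)
    have n: "n > 0" using p_lt p_gt1 by (cases n) auto
    have L: "(\<lambda>N. (1 / r * (1/2) ^ N) ^ n) \<longlonglongrightarrow> (1 / r * 0) ^ n"
      by (intro tendsto_intros LIMSEQ_power_zero) auto
    have e: "(1 / r * (1/2) ^ N) ^ n = 1 / (r * 2 ^ N) ^ n" for N by (simp add: power_divide)
    have z: "(1 / r * 0) ^ n = 0" using n by simp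
    show "(\<lambda>N. 1 / (r * 2 ^ N) ^ n) \<longlonglongrightarrow> 0" using L unfolding e z .
  qed
  then have "(\<lambda>N. (C * R0 ^ n) * C * (1 / (r * 2 ^ N) ^ n) + K * S * r powr (-\<beta>) * \<omega> powr (1/p))
    \<longlonglongrightarrow> 0 + K * S * r powr (-\<beta>) * \<omega> powr (1/p)"
    by (intro tendsto_add tendsto_const) simp
  then have "avg x r \<le> 0 + K * S * r powr (-\<beta>) * \<omega> powr (1/p)"
    by (rule LIMSEQ_le_const) (use bN up in \<open>meson add_le_cancel_right order_trans\<close>)
  then show ?thesis by simp
qed

text \<open>If all halving steps below r are small, going down and up from radius r yields
  \<open>1/4 \<le> K * S * r powr (-\<beta>) * \<omega> powr (1/p)\<close>. Otherwise the bound
  fails at some \<open>R = r * (1/2) ^ j\<close>, where \<open>(2 powr (-\<theta>)) ^ j\<close> is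
  \<open>(R / r) powr \<theta>\<close>; after raising to the power p the exponent of R is
  \<open>\<theta> * p + \<beta> * p = 1\<close>.\<close>

lemma energy_dichotomy:
  assumes r: "0 < r" and U: "mbounded U" "\<And>y. y \<notin> U \<Longrightarrow> w y = 0" and wx: "1/2 \<le> w x"
  shows "(1 / (4 * K * S)) powr p * r powr (real n - p) \<le> \<omega> \<or>
    (\<exists>R. 0 < R \<and> R \<le> r \<and> (\<kappa> / K) powr p * r powr (real n - p - 1) * R \<le> measure \<nu> (mball x (\<tau> * R)))"
proof (cases "\<forall>j::nat. K * (r * (1/2)^j) powr (-\<beta>) * measure \<nu> (mball x (\<tau> * (r * (1/2)^j))) powr (1/p) < \<kappa> * (2 powr (-\<theta>)) ^ j")
  case True
  then have "1/4 \<le> K * S * r powr (-\<beta>) * \<omega> powr (1/p)"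
    using telescope_down[OF r wx] telescope_up[OF r U, of x] by fastforce
  then have "1 / (4 * K * S) * r powr \<beta> \<le> \<omega> powr (1/p)"
    using K_pos S_pos r by (simp add: powr_minus field_simps)
  then have "(1 / (4 * K * S) * r powr \<beta>) powr p \<le> (\<omega> powr (1/p)) powr p"
    using K_pos S_pos p_gt1 by (intro powr_mono2) auto
  also have "(\<omega> powr (1/p)) powr p = \<omega>" using p_gt1 by (simp add: powr_powr \<omega>_def)
  also have "(1 / (4 * K * S) * r powr \<beta>) powr p = (1 / (4 * K * S)) powr p * r powr (real n - p)"
  proof -
    have "\<beta> * p = real n - p" using p_gt1 by (simp add: \<beta>_def field_simps)
    then show ?thesis using K_pos S_pos by (subst powr_mult) (auto simp: powr_powr)
  qed
  finally show ?thesis by blast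
next
  case False
  then obtain j :: nat where j: "\<kappa> * (2 powr (-\<theta>)) ^ j \<le> K * (r * (1/2)^j) powr (-\<beta>) * measure \<nu> (mball x (\<tau> * (r * (1/2)^j))) powr (1/p)"
    by (auto simp: not_less)
  define R where "R = r * (1/2) ^ j"
  have R: "0 < R" "R \<le> r" using r by (auto simp: R_def power_le_one mult_left_le)
  have q: "(2 powr (-\<theta>)) ^ j = (R / r) powr \<theta>"
    using r by (simp add: R_def powr_power powr_minus powr_powr power_divide powr_divide powr_realpow[symmetric] inverse_eq_divide mult.commute)
  have "\<kappa> / K * ((R / r) powr \<theta> * R powr \<beta>) \<le> measure \<nu> (mball x (\<tau> * R)) powr (1/p)"
    using j K_pos R unfolding q R_def[symmetric] by (simp add: powr_minus field_simps)
  then have "(\<kappa> / K * ((R / r) powr \<theta> * R powr \<beta>)) powr p \<le> (measure \<nu> (mball x (\<tau> * R)) powr (1/p)) powr p"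
    using K_pos \<kappa>_pos p_gt1 by (intro powr_mono2) auto
  also have "(measure \<nu> (mball x (\<tau> * R)) powr (1/p)) powr p = measure \<nu> (mball x (\<tau> * R))"
    using p_gt1 by (simp add: powr_powr)
  also have "(\<kappa> / K * ((R / r) powr \<theta> * R powr \<beta>)) powr p = (\<kappa> / K) powr p * ((R / r) powr (1 + p - real n) * R powr (real n - p))"
  proof -
    have e: "\<beta> * p = real n - p" "\<theta> * p = 1 + p - real n" using p_gt1 by (simp_all add: \<beta>_def \<theta>_def field_simps)
    have "(\<kappa> / K * ((R / r) powr \<theta> * R powr \<beta>)) powr p = (\<kappa> / K) powr p * (((R / r) powr \<theta>) powr p * (R powr \<beta>) powr p)"
      using K_pos \<kappa>_pos by (subst powr_mult, simp, simp, subst powr_mult) auto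
    then show ?thesis by (simp only: powr_powr e)
  qed
  also have "(R / r) powr (1 + p - real n) * R powr (real n - p) = r powr (real n - p - 1) * R"
  proof -
    have "(R / r) powr (1 + p - real n) = R powr (1 + p - real n) * r powr (real n - p - 1)"
    proof -
      have "real n - p - 1 = - (1 + p - real n)" by simp
      then show ?thesis using R r by (simp only: powr_divide less_imp_le) (simp only: powr_minus divide_inverse)
    qed
    then have "(R / r) powr (1 + p - real n) * R powr (real n - p)
        = r powr (real n - p - 1) * (R powr (1 + p - real n) * R powr (real n - p))" by simp
    also have "R powr (1 + p - real n) * R powr (real n - p) = R"
      unfolding powr_add[symmetric] using R by simp
    finally show ?thesis .
  qed
  finally show ?thesis using R by (intro disjI2 exI[of _ R]) (simp add: mult_ac)
qed

text \<open>If the total energy is not already large, every point of E is the centre of a ball with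
  energy proportional to its radius. Connectedness makes the distances from x0 fill {0..r}, so
  intervals with the same radii around these distances cover {0..r}. By the covering lemma a
  disjoint subfamily has total radius comparable to r, and the balls over disjoint intervals are
  disjoint because the distance from x0 is 1-Lipschitz.\<close>

lemma energy_lower_bound:
  assumes E: "connected E" "x0 \<in> E" "y0 \<in> E" "x0 \<noteq> y0" and wE: "\<And>x. x \<in> E \<Longrightarrow> 1/2 \<le> w x"
    and U: "mbounded U" "\<And>y. y \<notin> U \<Longrightarrow> w y = 0"
  shows "c0 * d x0 y0 powr (real n - p) \<le> \<omega>"
proof -
  define r where "r = d x0 y0"
  have r: "0 < r" using E by (simp add: r_def)
  show ?thesis
  proof (cases "(1 / (4 * K * S)) powr p * r powr (real n - p) \<le> \<omega>")
    case True
    have "c0 * r powr (real n - p) \<le> (1 / (4 * K * S)) powr p * r powr (real n - p)"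
      by (intro mult_right_mono) (auto simp: c0_def)
    then show ?thesis using True by (simp add: r_def)
  next
    case False
    let ?c = "(\<kappa> / K) powr p * r powr (real n - p - 1)"
    have c: "0 < ?c" using \<kappa>_pos K_pos r by simp
    \<comment> \<open>The radii are those of the enlarged balls, \<open>s = \<tau> * R\<close>,
      since these must be disjoint for their energies to add up; this explains the division by
      \<tau>.\<close>
    have "\<exists>x s. x \<in> E \<and> d x x0 = t \<and> 0 < s \<and> s \<le> \<tau> * r \<and> ?c * s / \<tau> \<le> measure \<nu> (mball x s)" if t: "t \<in> {0..r}" for t
    proof -
      have "connected ((\<lambda>x. d x x0) ` E)" by (intro connected_continuous_image continuous_on_dist E)
      moreover have "0 \<in> (\<lambda>x. d x x0) ` E" using E by (auto intro: image_eqI[of _ _ x0])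
      moreover have "r \<in> (\<lambda>x. d x x0) ` E" using E by (auto simp: r_def commute intro: image_eqI[of _ _ y0])
      ultimately have "t \<in> (\<lambda>x. d x x0) ` E" using t connected_contains_Icc[of _ 0 r] by blast
      then obtain x where x: "x \<in> E" "d x x0 = t" by auto
      obtain R where R: "0 < R" "R \<le> r" "?c * R \<le> measure \<nu> (mball x (\<tau> * R))"
        using energy_dichotomy[OF r U wE[OF x(1)]] False by blast
      then show ?thesis using x \<tau> by (intro exI[of _ x] exI[of _ "\<tau> * R"]) (auto simp: field_simps)
    qed
    then obtain X s where Xs: "\<And>t. t \<in> {0..r} \<Longrightarrow> d (X t) x0 = t \<and> 0 < s t \<and> s t \<le> \<tau> * r \<and> ?c * s t / \<tau> \<le> measure \<nu> (mball (X t) (s t))"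
      by metis
    obtain D where D: "countable D" "D \<subseteq> {0..r}" "pairwise (\<lambda>i j. disjnt (cball i (s i)) (cball j (s j))) D"
      "{0..r} \<subseteq> (\<Union>i\<in>D. cball i (5 * s i))"
    proof (rule Vitali_covering_lemma_cballs[where S="{0..r}" and K="{0..r}" and a="\<lambda>t. t" and r=s and B="\<tau> * r"])
      show "{0..r} \<subseteq> (\<Union>i\<in>{0..r}. cball i (s i))" using Xs by (force simp: less_imp_le)
    qed (use Xs in auto)
    \<comment> \<open>The factor 6 in place of 5 gives open intervals, from which compactness
      extracts a finite subfamily.\<close>
    have "{0..r} \<subseteq> (\<Union>i\<in>D. ball i (6 * s i))"
    proof
      fix t assume "t \<in> {0..r}"
      then obtain i where i: "i \<in> D" "t \<in> cball i (5 * s i)" using D(4) by blast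
      moreover have "0 < s i" using Xs i(1) D(2) by auto
      ultimately show "t \<in> (\<Union>i\<in>D. ball i (6 * s i))" by (force simp: dist_real_def)
    qed
    then obtain F where F: "F \<subseteq> D" "finite F" "{0..r} \<subseteq> (\<Union>i\<in>F. ball i (6 * s i))"
      using compactE_image[of "{0..r}" D "\<lambda>i. ball i (6 * s i)"] by auto
    have sF: "0 < s i" "?c * s i / \<tau> \<le> measure \<nu> (mball (X i) (s i))" "d (X i) x0 = i" if "i \<in> F" for i
      using Xs F D that by blast+
    have "r = measure lborel {0..r}" using r by simp
    also have "\<dots> \<le> measure lborel (\<Union>i\<in>F. ball i (6 * s i))"
      using F by (intro measure_mono_fmeasurable fmeasurable.finite_UN) (auto simp: fmeasurable_def emeasure_lborel_ball_finite[unfolded infinity_ennreal_def])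
    also have "\<dots> \<le> (\<Sum>i\<in>F. measure lborel (ball i (6 * s i)))"
      by (rule measure_UNION_le) (use F in auto)
    also have "\<dots> = (\<Sum>i\<in>F. 12 * s i)"
    proof (intro sum.cong refl)
      fix i assume "i \<in> F"
      then show "measure lborel (ball i (6 * s i)) = 12 * s i"
        using sF(1)[of i] by (simp add: ball_eq_greaterThanLessThan)
    qed
    also have "\<dots> \<le> (\<Sum>i\<in>F. 12 * (\<tau> / ?c) * measure \<nu> (mball (X i) (s i)))"
    proof (intro sum_mono)
      fix i assume "i \<in> F"
      then have "s i \<le> \<tau> / ?c * measure \<nu> (mball (X i) (s i))" using sF(2)[of i] c \<tau> by (simp add: field_simps)
      then show "12 * s i \<le> 12 * (\<tau> / ?c) * measure \<nu> (mball (X i) (s i))" by simp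
    qed
    also have "\<dots> = 12 * (\<tau> / ?c) * (\<Sum>i\<in>F. measure \<nu> (mball (X i) (s i)))" by (simp add: sum_distrib_left)
    also have "(\<Sum>i\<in>F. measure \<nu> (mball (X i) (s i))) = measure \<nu> (\<Union>i\<in>F. mball (X i) (s i))"
    proof (rule \<nu>.finite_measure_finite_Union[symmetric])
      show "disjoint_family_on (\<lambda>i. mball (X i) (s i)) F"
        unfolding disjoint_family_on_def
      proof (intro ballI impI)
        fix i j assume ij: "i \<in> F" "j \<in> F" "i \<noteq> j"
        then have dj: "disjnt (cball i (s i)) (cball j (s j))" using D(3) F(1) by (auto simp: pairwise_def)
        show "mball (X i) (s i) \<inter> mball (X j) (s j) = {}"
        proof (rule ccontr)
          assume "\<not> ?thesis"
          then obtain y where y: "d (X i) y < s i" "d (X j) y < s j" by auto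
          \<comment> \<open>A common point of two balls would project into both intervals.\<close>
          have "d y x0 \<in> cball i (s i)" "d y x0 \<in> cball j (s j)"
            using dist_diff_le[of "X i" x0 y] dist_diff_le[of "X j" x0 y] y sF(3)[OF ij(1)] sF(3)[OF ij(2)]
            by (auto simp: dist_real_def)
          then show False using dj by (auto simp: disjnt_def)
        qed
      qed
    qed (use F sets_\<nu> in auto)
    also have "12 * (\<tau> / ?c) * measure \<nu> (\<Union>i\<in>F. mball (X i) (s i)) \<le> 12 * (\<tau> / ?c) * \<omega>"
      using \<tau> c by (intro mult_left_mono \<nu>_le_\<omega>) auto
    finally have fin: "(?c * r) / (12 * \<tau>) \<le> \<omega>" using c \<tau> by (simp add: field_simps)
    have e: "?c * r = (\<kappa> / K) powr p * r powr (real n - p)"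
      using r by (simp add: powr_diff)
    have "c0 * r powr (real n - p) \<le> (\<kappa> / K) powr p / (12 * \<tau>) * r powr (real n - p)"
      by (intro mult_right_mono) (auto simp: c0_def)
    also have "\<dots> = (?c * r) / (12 * \<tau>)" unfolding e by simp
    finally show ?thesis using fin unfolding r_def by linarith
  qed
qed

end

end

section \<open>A lower bound for the modulus\<close>

lemma le_add_INF_ennreal:
  fixes a c :: ennreal
  assumes "\<And>i. i \<in> I \<Longrightarrow> a \<le> c + f i"
  shows "a \<le> c + (INF i\<in>I. f i)"
proof (cases "c = top")
  case False
  have "a - c \<le> (INF i\<in>I. f i)"
    by (rule INF_greatest) (use assms False in \<open>auto simp: ennreal_minus_le_iff\<close>)
  then show ?thesis using False by (simp add: ennreal_minus_le_iff)
qed simp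

lemma le_SUP_powr_inverse:
  fixes \<rho> :: ennreal
  assumes "epowr \<rho> p \<le> (SUP j. ennreal (a j))" "\<And>j. 0 \<le> a j" "0 < p"
  shows "\<rho> \<le> (SUP j. ennreal (a j powr (1 / p)))"
proof (cases "SUP j. ennreal (a j powr (1 / p))")
  case (real r)
  have "a j \<le> r powr p" for j
  proof -
    have "ennreal (a j powr (1 / p)) \<le> (SUP j. ennreal (a j powr (1 / p)))" by (rule SUP_upper) simp
    then have "a j powr (1 / p) \<le> r" using real by (simp add: ennreal_le_iff)
    then have "(a j powr (1 / p)) powr p \<le> r powr p" using assms by (intro powr_mono2) auto
    then show ?thesis using assms by (simp add: powr_powr)
  qed
  then have "(SUP j. ennreal (a j)) \<le> ennreal (r powr p)" by (intro SUP_least ennreal_leI)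
  then have le: "epowr \<rho> p \<le> ennreal (r powr p)" using assms(1) by (rule order_trans[rotated])
  show ?thesis
  proof (cases \<rho>)
    case (real q)
    then have "q powr p \<le> r powr p" using le by (simp add: epowr_ennreal ennreal_le_iff)
    then have "q \<le> r" using powr_less_mono2[of p r q] assms(3) \<open>0 \<le> r\<close> by (force simp: not_less[symmetric])
    then show ?thesis using real \<open>(SUP j. ennreal (a j powr (1 / p))) = ennreal r\<close> by (simp add: ennreal_leI)
  next
    case top
    then show ?thesis using le by (simp add: epowr_def top_unique)
  qed
next
  case top
  show ?thesis unfolding top by simp
qed

section \<open>The potential of a bounded density and paths leaving an open set\<close>

context umetric begin

lemma rectifiable_const: "rectifiable d (\<lambda>_. x)" and arc_const: "arc_len (\<lambda>_. x) t = 0"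
proof -
  have "curve_length d (\<lambda>_. x) a b \<le> 0" for a b by (rule curve_length_leI) auto
  then have "curve_length d (\<lambda>_. x) a b = 0" for a b by simp
  then show "rectifiable d (\<lambda>_. x)" "arc_len (\<lambda>_. x) t = 0" by (auto simp: rectifiable_iff path_def arc_len_def)
qed

text \<open>The least cost, with density g, of getting from y out of U. Truncation at 1 makes it a
  real number also where no cheap path, or no path at all, leads out of U.\<close>

definition potential :: "('a \<Rightarrow> ennreal) \<Rightarrow> 'a set \<Rightarrow> 'a \<Rightarrow> real" where
  "potential g U y = enn2real (min 1 (INF \<gamma>\<in>{\<gamma>. rectifiable d \<gamma> \<and> \<gamma> 0 = y \<and> \<gamma> 1 \<notin> U}. path_integral d g \<gamma>))"

context
  fixes g :: "'a \<Rightarrow> ennreal" and U :: "'a set" and L :: real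
  assumes g[measurable]: "g \<in> borel_measurable borel" and gL: "\<And>x. g x \<le> ennreal L" and L: "0 \<le> L"
    and len: "\<And>x y e. e > 0 \<Longrightarrow> \<exists>\<gamma>. rectifiable d \<gamma> \<and> \<gamma> 0 = x \<and> \<gamma> 1 = y \<and> arc_len \<gamma> 1 \<le> d x y + e"
begin

private abbreviation "J \<equiv> \<lambda>y. (INF \<gamma>\<in>{\<gamma>. rectifiable d \<gamma> \<and> \<gamma> 0 = y \<and> \<gamma> 1 \<notin> U}. path_integral d g \<gamma>)"

lemma potential_eq: "ennreal (potential g U y) = min 1 (J y)"
proof -
  have "min 1 (J y) < top" by (simp add: min_less_iff_disj)
  then show ?thesis unfolding potential_def by simp
qed

lemma potential_nonneg: "0 \<le> potential g U y" by (simp add: potential_def)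

lemma potential_le_1: "potential g U y \<le> 1"
proof -
  have "ennreal (potential g U y) \<le> ennreal 1" unfolding potential_eq by simp
  then show ?thesis by (simp add: ennreal_le_iff)
qed

lemma potential_outside: assumes "y \<notin> U" shows "potential g U y = 0"
proof -
  have "path_integral d g (\<lambda>_. y) \<le> 0"
    using path_integral_le[OF rectifiable_const, of g "ennreal L" y] gL by (simp add: arc_const)
  then have "J y \<le> 0" by (intro INF_lower2[of "\<lambda>_. y"]) (use assms rectifiable_const in auto)
  then show ?thesis by (simp add: potential_def)
qed

text \<open>Running through \<gamma> and then along a path from its end out of U is a competitor for
  its starting point, at the additional cost of the integral along \<gamma>. Reversing \<gamma>
  gives the other sign, and truncation at 1 preserves the inequality.\<close>

lemma potential_upper_gradient: "upper_gradient d g (potential g U)"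
proof -
  have one: "ennreal (potential g U (\<gamma> 0)) \<le> path_integral d g \<gamma> + ennreal (potential g U (\<gamma> 1))"
    if \<gamma>: "rectifiable d \<gamma>" for \<gamma>
  proof -
    have "J (\<gamma> 0) \<le> path_integral d g \<gamma> + J (\<gamma> 1)"
    proof (rule le_add_INF_ennreal)
      fix \<beta> assume "\<beta> \<in> {\<beta>. rectifiable d \<beta> \<and> \<beta> 0 = \<gamma> 1 \<and> \<beta> 1 \<notin> U}"
      then have \<beta>: "rectifiable d \<beta>" "\<beta> 0 = \<gamma> 1" "\<beta> 1 \<notin> U" by auto
      have "J (\<gamma> 0) \<le> path_integral d g (\<gamma> +++ \<beta>)"
        by (rule INF_lower) (use rectifiable_joinpaths[OF \<gamma> \<beta>(1)] \<beta> in \<open>auto simp: joinpaths_def\<close>)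
      then show "J (\<gamma> 0) \<le> path_integral d g \<gamma> + path_integral d g \<beta>"
        using path_integral_joinpaths[OF \<gamma> \<beta>(1) _ g] \<beta> by simp
    qed
    moreover have "min 1 a \<le> c + min 1 b" if "a \<le> c + b" for a b c :: ennreal
    proof (cases "b \<le> 1")
      case True
      then show ?thesis using that by (auto simp: min_absorb2 intro: min.coboundedI2)
    next
      case False
      then have "min 1 b = 1" by (simp add: min_def)
      then show ?thesis by (simp add: add_increasing min.coboundedI1)
    qed
    ultimately show ?thesis unfolding potential_eq by blast
  qed
  show ?thesis
    unfolding upper_gradient_def metric_borel_eq
  proof (intro conjI allI impI g)
    fix \<gamma> assume \<gamma>: "rectifiable d \<gamma>"
    note a = one[OF \<gamma>] and b = one[OF rectifiable_reverse[OF \<gamma>]]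
    show "ennreal \<bar>potential g U (\<gamma> 0) - potential g U (\<gamma> 1)\<bar> \<le> path_integral d g \<gamma>"
    proof (cases "path_integral d g \<gamma>")
      case (real I)
      then show ?thesis
        using a b path_integral_reverse[OF \<gamma> g] potential_nonneg[of "\<gamma> 0"] potential_nonneg[of "\<gamma> 1"]
        by (auto simp: ennreal_le_iff abs_le_iff simp flip: ennreal_plus)
    qed simp
  qed
qed

text \<open>The bound on g and the almost shortest paths supplied by \<open>len\<close> turn the
  upper gradient into a Lipschitz constant. This is the regularity for which bounded densities are
  introduced.\<close>

lemma potential_lipschitz: "\<bar>potential g U x - potential g U y\<bar> \<le> L * d x y"
proof (rule field_le_epsilon)
  fix e :: real assume e: "e > 0"
  have pos: "e / (L + 1) > 0" using e L by simp
  obtain \<gamma> where \<gamma>: "rectifiable d \<gamma>" "\<gamma> 0 = x" "\<gamma> 1 = y" "arc_len \<gamma> 1 \<le> d x y + e / (L + 1)"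
    using len[OF pos] by blast
  have "ennreal \<bar>potential g U x - potential g U y\<bar> \<le> path_integral d g \<gamma>"
    using potential_upper_gradient \<gamma> by (auto simp: upper_gradient_def)
  also have "\<dots> \<le> ennreal L * ennreal (arc_len \<gamma> 1)" by (rule path_integral_le[OF \<gamma>(1) gL])
  also have "\<dots> = ennreal (L * arc_len \<gamma> 1)" by (rule ennreal_mult'[OF L, symmetric])
  finally have "\<bar>potential g U x - potential g U y\<bar> \<le> L * arc_len \<gamma> 1"
    using L arc_mono[OF \<gamma>(1), of 0 1] by (subst (asm) ennreal_le_iff) auto
  also have "\<dots> \<le> L * (d x y + e / (L + 1))" by (rule mult_left_mono[OF \<gamma>(4) L])
  also have "\<dots> = L * d x y + e * (L / (L + 1))" by (simp add: algebra_simps)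
  also have "\<dots> \<le> L * d x y + e * 1" using e L by (intro add_left_mono mult_left_mono) auto
  finally show "\<bar>potential g U x - potential g U y\<bar> \<le> L * d x y + e" by simp
qed

lemma continuous_on_potential: "continuous_on UNIV (potential g U)"
proof (rule continuous_on_from)
  fix x and e :: real assume e: "e > 0"
  show "\<exists>\<delta>>0. \<forall>y\<in>UNIV. d x y < \<delta> \<longrightarrow> \<bar>potential g U y - potential g U x\<bar> < e"
  proof (intro exI[of _ "e / (L + 1)"] conjI ballI impI)
    fix y assume "d x y < e / (L + 1)"
    then have "(L + 1) * d x y < e" using L by (simp add: field_simps)
    moreover have "L * d x y \<le> (L + 1) * d x y" by (intro mult_right_mono) auto
    ultimately show "\<bar>potential g U y - potential g U x\<bar> < e"
      using potential_lipschitz[of x y] unfolding abs_minus_commute[of "potential g U y"] by linarith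
  qed (use e L in auto)
qed

lemma potential_less:
  assumes "potential g U y < 1/2"
  obtains \<gamma> where "rectifiable d \<gamma>" "\<gamma> 0 = y" "\<gamma> 1 \<notin> U" "path_integral d g \<gamma> < ennreal (1/2)"
proof -
  have "ennreal (potential g U y) < ennreal (1/2)" using assms by (intro ennreal_lessI) auto
  moreover have "ennreal (1/2) < 1" using ennreal_lessI[of 1 "1/2"] by simp
  ultimately have "J y < ennreal (1/2)" unfolding potential_eq min_less_iff_disj
    using order_less_asym by blast
  then show ?thesis using that by (auto simp: INF_less_iff)
qed

end

text \<open>The complement of U is closed, so the set of parameters at which the path is outside U
  has a least element; the path is cut there.\<close>

lemma first_exit:
  assumes \<gamma>: "rectifiable d \<gamma>" "\<gamma> 0 \<in> U" "\<gamma> 1 \<notin> U" and U: "open U"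
  obtains \<beta> where "rectifiable d \<beta>" "\<beta> 0 = \<gamma> 0" "\<beta> 1 \<notin> U" "\<And>t. t \<in> {0..<1} \<Longrightarrow> \<beta> t \<in> U"
    "\<And>\<rho>. \<rho> \<in> borel_measurable borel \<Longrightarrow> path_integral d \<rho> \<beta> \<le> path_integral d \<rho> \<gamma>"
proof -
  define Z where "Z = {t\<in>{0..1}. \<gamma> t \<in> - U}"
  have cont: "continuous_on {0..1} \<gamma>" using \<gamma>(1) by (simp add: rectifiable_iff path_def)
  have "Z = {0..1} \<inter> \<gamma> -` (- U)" by (auto simp: Z_def)
  then have "closed Z" using continuous_closed_preimage[OF cont closed_atLeastAtMost closed_Compl[OF U]] by simp
  moreover have "1 \<in> Z" using \<gamma>(3) by (simp add: Z_def)
  moreover have bdd: "bdd_below Z" by (rule bdd_belowI[of _ 0]) (auto simp: Z_def)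
  ultimately have bZ: "Inf Z \<in> Z" by (intro closed_contains_Inf) auto
  define b where "b = Inf Z"
  have b: "b \<in> {0..1}" "\<gamma> b \<notin> U" using bZ by (auto simp: b_def Z_def)
  have "b \<noteq> 0" using b \<gamma>(2) by auto
  then have b0: "0 < b" using b by auto
  have bU: "\<gamma> t \<in> U" if "0 \<le> t" "t < b" for t
  proof (rule ccontr)
    assume "\<gamma> t \<notin> U"
    then have "t \<in> Z" using that b by (auto simp: Z_def)
    then have "b \<le> t" unfolding b_def by (rule cInf_lower[OF _ bdd])
    then show False using that by simp
  qed
  let ?\<beta> = "\<lambda>t. \<gamma> ((b - 0) * t + 0)"
  show ?thesis
  proof (rule that[of ?\<beta>])
    show "rectifiable d ?\<beta>" by (rule rectifiable_sub[OF \<gamma>(1)]) (use b b0 in auto)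
    show "path_integral d \<rho> ?\<beta> \<le> path_integral d \<rho> \<gamma>" if "\<rho> \<in> borel_measurable borel" for \<rho>
      by (rule path_integral_sub_le[OF \<gamma>(1)]) (use that b b0 in auto)
    show "?\<beta> t \<in> U" if "t \<in> {0..<1}" for t
      using that b0 by (auto intro!: bU)
  qed (use b in auto)
qed

end

section \<open>The modulus of the paths that leave a neighbourhood of a connected set\<close>

context loewner_space begin

text \<open>Suppose that an admissible density has less energy than claimed. The energy bound,
  applied to the potentials of bounded approximations, forces each potential below 1/2 somewhere on
  E, so for every index some path from E out of U has integral at most 1/2. A limit of these paths
  has integral at most 1/2 for the given density and contradicts admissibility. The assumption on
  \<Gamma> asks for a path that is at most as expensive, not for c itself, so that the members of
  \<Gamma> may start away from E.\<close>

lemma modulus_lower_bound: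
  assumes len: "\<And>x y e. e > 0 \<Longrightarrow> \<exists>\<gamma>. rectifiable d \<gamma> \<and> \<gamma> 0 = x \<and> \<gamma> 1 = y \<and> arc_len \<gamma> 1 \<le> d x y + e"
    and E: "closed E" "connected E" "E \<subseteq> U" "x0 \<in> E" "y0 \<in> E" "x0 \<noteq> y0"
    and U: "open U" "compact (closure U)"
    and \<Gamma>: "\<And>c. rectifiable d c \<Longrightarrow> c 0 \<in> E \<Longrightarrow> c 1 \<notin> U \<Longrightarrow>
        \<exists>\<gamma>\<in>\<Gamma>. rectifiable d \<gamma> \<and> (\<forall>\<rho>\<in>borel_measurable borel. path_integral d \<rho> \<gamma> \<le> path_integral d \<rho> c)"
  shows "ennreal (c0 * d x0 y0 powr (real n - p)) \<le> modulus d \<mu> p \<Gamma>"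
  unfolding modulus_def metric_borel_eq
proof (rule INF_greatest)
  fix \<rho> assume "\<rho> \<in> {\<rho>\<in>borel_measurable borel. \<forall>\<gamma>\<in>\<Gamma>. rectifiable d \<gamma> \<longrightarrow> 1 \<le> path_integral d \<rho> \<gamma>}"
  then have \<rho>[measurable]: "\<rho> \<in> borel_measurable borel" and adm: "\<And>\<gamma>. \<gamma> \<in> \<Gamma> \<Longrightarrow> rectifiable d \<gamma> \<Longrightarrow> 1 \<le> path_integral d \<rho> \<gamma>"
    by auto
  let ?D = "c0 * d x0 y0 powr (real n - p)"
  have p0: "0 < p" using p_gt1 by simp
  show "ennreal ?D \<le> (\<integral>\<^sup>+x. epowr (\<rho> x) p \<partial>\<mu>)"
  proof (rule ccontr)
    assume "\<not> ?thesis"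
    then have less: "(\<integral>\<^sup>+x. epowr (\<rho> x) p \<partial>\<mu>) < ennreal ?D" by simp
    then obtain I where I: "(\<integral>\<^sup>+x. epowr (\<rho> x) p \<partial>\<mu>) = ennreal I" "0 \<le> I" "I < ?D"
      by (cases "\<integral>\<^sup>+x. epowr (\<rho> x) p \<partial>\<mu>") (auto simp: ennreal_less_iff)
    have "mbounded (closure U)" using U(2) compactin_imp_mbounded[of "closure U"] by (simp add: mtopology_eq)
    then obtain a R where R: "closure U \<subseteq> mcball a R" by (auto simp: mbounded_def)
    \<comment> \<open>An open ball around the closure of U: the limit path may run in the closure,
      so the approximation has to be a majorant there, and its domain has to be open and of finite
      measure.\<close>
    define W where "W = mball a (\<bar>R\<bar> + 1)"
    have W: "open W" "closure U \<subseteq> W" "emeasure \<mu> W < top"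
      using R open_mball ball_meas(1)[of "\<bar>R\<bar> + 1" a] by (auto simp: W_def subset_eq)
    have W_ne: "W \<noteq> UNIV"
    proof
      assume eq: "W = UNIV"
      define m where "m = measure \<mu> W"
      have n0: "n \<ge> 1" using p_lt p0 by (cases n) auto
      have m0: "0 \<le> m" by (simp add: m_def)
      \<comment> \<open>A ball of this radius has measure at least m + 1, as
        \<open>n \<ge> 1\<close>, although the whole space would have measure m.\<close>
      have "(C * (m + 1)) ^ n / C \<le> measure \<mu> (mball a (C * (m + 1)))"
        using C m0 by (intro ball_meas(2)) auto
      also have "\<dots> \<le> m" unfolding m_def
        by (rule measure_mono_fmeasurable) (use W eq open_mball in \<open>auto simp: fmeasurable_def sets_\<mu> intro: borel_open\<close>)
      finally have "(C * (m + 1)) ^ n / C \<le> m" .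
      moreover have "(C * (m + 1)) ^ 1 \<le> (C * (m + 1)) ^ n"
        using C m0 n0 by (intro power_increasing) (auto intro: order_trans[OF _ mult_mono[of 1 C 1 "m + 1"]])
      ultimately have "C * (m + 1) / C \<le> m" using C by (simp add: field_simps)
      then show False using C by simp
    qed
    have Ufin: "emeasure \<mu> U < top"
      using emeasure_mono[of U W \<mu>] W closure_subset[of U] by (auto simp: sets_\<mu> intro: le_less_trans)
    define m where "m = measure \<mu> U"
    have m: "emeasure \<mu> U = ennreal m" "0 \<le> m" using Ufin by (auto simp: m_def emeasure_eq_ennreal_measure less_top)
    \<comment> \<open>Uses up half of the gap between I and the claimed bound: one \<delta> is lost
      in the approximation on W, and \<delta> * m by adding \<delta> on U.\<close>
    define \<delta> where "\<delta> = (?D - I) / (2 * (1 + m))"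
    have \<delta>: "0 < \<delta>" "I + \<delta> + \<delta> * m < ?D"
    proof -
      show "0 < \<delta>" using I m by (simp add: \<delta>_def)
      have "\<delta> * (1 + m) = (?D - I) / 2" using m by (simp add: \<delta>_def field_simps)
      then show "I + \<delta> + \<delta> * m < ?D" using I by (simp add: algebra_simps)
    qed
    define u where "u = (\<lambda>x. epowr (\<rho> x) p)"
    have [measurable]: "u \<in> borel_measurable borel" unfolding u_def by measurable
    obtain h :: "nat \<Rightarrow> 'a \<Rightarrow> real" where h: "\<And>k. continuous_on UNIV (h k)" "\<And>k x. 0 \<le> h k x"
      "\<And>k x. h k x \<le> real k * \<delta>" "\<And>k x. h k x \<le> h (Suc k) x"
      "\<And>x. x \<in> W \<Longrightarrow> u x \<le> (SUP k. ennreal (h k x + \<delta>))"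
      "\<And>k. (\<integral>\<^sup>+x\<in>W. ennreal (h k x) \<partial>\<mu>) \<le> (\<integral>\<^sup>+x\<in>W. u x \<partial>\<mu>) + ennreal \<delta>"
      using continuous_majorants[OF sets_\<mu> W(1,3) _ \<delta>(1) W_ne, of u] by auto
    \<comment> \<open>The added \<delta> serves twice: it lifts the supremum of the approximations
      above the given density, and it keeps each of them at least
      \<open>\<delta> powr (1 / p)\<close>, which bounds the lengths of the paths found
      below.\<close>
    define G where "G = (\<lambda>k x. (h k x + \<delta>) powr (1 / p))"
    have G_cont: "continuous_on UNIV (G k)" for k unfolding G_def
      using h(2) \<delta>(1) by (intro continuous_intros h(1)) (auto simp: add_nonneg_eq_0_iff)
    have G_nn: "0 \<le> G k x" for k x by (simp add: G_def)
    have G_mono: "G k x \<le> G (Suc k) x" for k x unfolding G_def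
      using h(2,4) \<delta>(1) p0 by (intro powr_mono2) (auto intro: add_nonneg_nonneg)
    \<comment> \<open>Cutting off at U confines the added \<delta> to a set of finite measure and
      does not affect integrals along paths that stay in U up to their end point.\<close>
    define g where "g = (\<lambda>k x. ennreal (G k x) * indicator U x)"
    have g_meas [measurable]: "g k \<in> borel_measurable borel" for k
    proof -
      have [measurable]: "U \<in> sets borel" "G k \<in> borel_measurable borel"
        using U borel_measurable_continuous_onI[OF G_cont] by auto
      show ?thesis unfolding g_def by measurable
    qed
    define L where "L = (\<lambda>k. (real k * \<delta> + \<delta>) powr (1 / p))"
    have g_le: "g k x \<le> ennreal (L k)" for k x
    proof -
      have "G k x \<le> L k" unfolding G_def L_def using h(2,3) \<delta>(1) p0
        by (intro powr_mono2) (auto intro: add_nonneg_nonneg)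
      then show ?thesis by (auto simp: g_def indicator_def ennreal_leI)
    qed
    have energy: "(\<integral>\<^sup>+x. epowr (g k x) p \<partial>\<mu>) < ennreal ?D" for k
    proof -
      have [measurable]: "U \<in> sets \<mu>" "W \<in> sets \<mu>" "h k \<in> borel_measurable \<mu>"
        using U W borel_measurable_continuous_onI[OF h(1)] by (auto simp: sets_\<mu> measurable_cong_sets[OF sets_\<mu> refl])
      have eq: "epowr (g k x) p = (ennreal (h k x) + ennreal \<delta>) * indicator U x" for x
      proof (cases "x \<in> U")
        case True
        have "epowr (g k x) p = ennreal (((h k x + \<delta>) powr (1 / p)) powr p)"
          using True G_nn by (simp add: g_def epowr_ennreal G_def)
        also have "((h k x + \<delta>) powr (1 / p)) powr p = h k x + \<delta>"
          using p0 h(2) \<delta>(1) by (simp add: powr_powr add_nonneg_nonneg)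
        finally show ?thesis using True h(2) \<delta>(1) by (simp add: ennreal_plus)
      qed (use p0 in \<open>simp add: g_def epowr_def\<close>)
      have "(\<integral>\<^sup>+x. epowr (g k x) p \<partial>\<mu>) = (\<integral>\<^sup>+x. ennreal (h k x) * indicator U x + ennreal \<delta> * indicator U x \<partial>\<mu>)"
        unfolding eq by (simp add: distrib_right)
      also have "\<dots> = (\<integral>\<^sup>+x. ennreal (h k x) * indicator U x \<partial>\<mu>) + ennreal \<delta> * emeasure \<mu> U"
        by (subst nn_integral_add) (auto simp: nn_integral_cmult_indicator)
      also have "(\<integral>\<^sup>+x. ennreal (h k x) * indicator U x \<partial>\<mu>) \<le> (\<integral>\<^sup>+x\<in>W. ennreal (h k x) \<partial>\<mu>)"
        by (intro nn_integral_mono mult_left_mono) (use W closure_subset[of U] in \<open>auto simp: indicator_def\<close>)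
      also have "\<dots> \<le> (\<integral>\<^sup>+x\<in>W. u x \<partial>\<mu>) + ennreal \<delta>" by (rule h(6))
      also have "(\<integral>\<^sup>+x\<in>W. u x \<partial>\<mu>) \<le> (\<integral>\<^sup>+x. u x \<partial>\<mu>)"
        by (rule nn_integral_mono) (auto simp: indicator_def)
      also have "\<dots> = ennreal I" using I by (simp add: u_def)
      finally have "(\<integral>\<^sup>+x. epowr (g k x) p \<partial>\<mu>) \<le> ennreal I + ennreal \<delta> + ennreal \<delta> * ennreal m"
        using m by (simp add: add_right_mono)
      also have "\<dots> = ennreal (I + \<delta> + \<delta> * m)" using I m \<delta>(1) by (simp add: ennreal_mult)
      also have "\<dots> < ennreal ?D" using \<delta> I m by (intro ennreal_lessI) (auto intro: le_less_trans)
      finally show ?thesis .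
    qed
    have "\<exists>x\<in>E. potential (g k) U x < 1/2" for k
    proof (rule ccontr)
      assume "\<not> ?thesis"
      then have half: "\<And>x. x \<in> E \<Longrightarrow> 1/2 \<le> potential (g k) U x" by (auto simp: not_less)
      have L0: "0 \<le> L k" by (simp add: L_def)
      note pot = g_meas[of k] g_le[of k] L0 len
      have fin: "(\<integral>\<^sup>+x. epowr (g k x) p \<partial>\<mu>) < top" using energy[of k] by (rule order_less_trans) simp
      note ctx = continuous_on_potential[OF pot, of U] potential_nonneg[OF pot, of U] potential_le_1[OF pot, of U]
        potential_upper_gradient[OF pot, of U] fin
      have "?D \<le> \<omega> (g k)"
        by (rule energy_lower_bound[OF ctx E(2,4,5,6) half mbounded_subset[OF \<open>mbounded (closure U)\<close> closure_subset] potential_outside[OF pot]])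
      moreover have "ennreal (\<omega> (g k)) = (\<integral>\<^sup>+x. epowr (g k x) p \<partial>\<mu>)"
      proof -
        interpret F: finite_measure "\<nu> (g k)" by (rule finite_measure_\<nu>[OF ctx])
        have "space \<mu> = UNIV" using sets_eq_imp_space_eq[OF sets_\<mu>] by simp
        then show ?thesis using emeasure_\<nu>[OF ctx, of UNIV] sets_\<mu> F.emeasure_eq_measure[of UNIV]
          by (simp add: \<omega>_def[OF ctx])
      qed
      ultimately have "ennreal ?D \<le> (\<integral>\<^sup>+x. epowr (g k x) p \<partial>\<mu>)" using ennreal_leI by metis
      then show False using energy[of k] leD by blast
    qed
    then obtain X where X: "\<And>k. X k \<in> E" "\<And>k. potential (g k) U (X k) < 1/2" by metis
    have "\<exists>\<gamma>. rectifiable d \<gamma> \<and> \<gamma> 0 \<in> E \<and> \<gamma> 1 \<notin> U \<and> (\<forall>t\<in>{0..<1}. \<gamma> t \<in> U) \<and>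
        path_integral d (g k) \<gamma> \<le> ennreal (1/2)" for k
    proof -
      have L0: "0 \<le> L k" by (simp add: L_def)
      obtain \<gamma> where \<gamma>: "rectifiable d \<gamma>" "\<gamma> 0 = X k" "\<gamma> 1 \<notin> U" "path_integral d (g k) \<gamma> < ennreal (1/2)"
        using potential_less[OF g_meas g_le L0 len X(2)] by blast
      have "\<gamma> 0 \<in> U" using \<gamma>(2) X(1) E(3) by auto
      then obtain \<beta> where \<beta>: "rectifiable d \<beta>" "\<beta> 0 = \<gamma> 0" "\<beta> 1 \<notin> U" "\<And>t. t \<in> {0..<1} \<Longrightarrow> \<beta> t \<in> U"
        "path_integral d (g k) \<beta> \<le> path_integral d (g k) \<gamma>"
        using first_exit[OF \<gamma>(1) _ \<gamma>(3) U(1)] g_meas by metis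
      show ?thesis
      proof (intro exI[of _ \<beta>] conjI ballI)
        show "path_integral d (g k) \<beta> \<le> ennreal (1/2)"
          using \<beta>(5) \<gamma>(4) by (rule order_trans[OF _ less_imp_le])
      qed (use \<beta> \<gamma>(2) X(1) in auto)
    qed
    then obtain \<gamma> where \<gamma>: "\<And>k. rectifiable d (\<gamma> k)" "\<And>k. \<gamma> k 0 \<in> E" "\<And>k. \<gamma> k 1 \<notin> U"
      "\<And>k t. t \<in> {0..<1} \<Longrightarrow> \<gamma> k t \<in> U" "\<And>k. path_integral d (g k) (\<gamma> k) \<le> ennreal (1/2)"
      by metis
    have Gint: "path_integral d (\<lambda>x. ennreal (G k x)) (\<gamma> k) \<le> ennreal (1/2)" for k
    proof -
      have "path_integral d (\<lambda>x. ennreal (G k x)) (\<gamma> k) \<le> path_integral d (g k) (\<gamma> k)"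
        by (rule path_integral_mono_image[OF \<gamma>(1)]) (use \<gamma>(4) in \<open>auto simp: g_def\<close>)
      then show ?thesis using \<gamma>(5) by (rule order_trans)
    qed
    define b where "b = \<delta> powr (1 / p)"
    have b0: "0 < b" using \<delta> by (simp add: b_def)
    have arcB: "arc_len (\<gamma> k) 1 \<le> 1 / (2 * b)" for k
    proof -
      have "ennreal b * ennreal (arc_len (\<gamma> k) 1) \<le> path_integral d (\<lambda>x. ennreal (G k x)) (\<gamma> k)"
      proof (rule path_integral_ge[OF \<gamma>(1)])
        fix t
        have "b \<le> G k (\<gamma> k t)" unfolding b_def G_def using h(2) \<delta>(1) p0 by (intro powr_mono2) auto
        then show "ennreal b \<le> ennreal (G k (\<gamma> k t))" by (rule ennreal_leI)
      qed
      then have "ennreal (b * arc_len (\<gamma> k) 1) \<le> ennreal (1/2)"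
        using Gint[of k] b0 by (simp add: ennreal_mult' order_trans)
      then have "b * arc_len (\<gamma> k) 1 \<le> 1/2" by (subst (asm) ennreal_le_iff) auto
      then show ?thesis using b0 by (simp add: field_simps)
    qed
    obtain c where c: "rectifiable d c" "c 0 \<in> E" "c 1 \<notin> U" "\<And>t. t \<in> {0..1} \<Longrightarrow> c t \<in> closure U"
      "\<And>j. path_integral d (\<lambda>x. ennreal (G j x)) c \<le> ennreal (1/2)"
      using limit_path[where \<gamma>=\<gamma> and E=E and U=U and B="1 / (2 * b)" and K="closure U" and g=G and I="1/2",
          OF \<gamma>(1-4) arcB U(2) closure_subset E(1) U(1) G_cont G_nn G_mono Gint] by auto
    have [measurable]: "G j \<in> borel_measurable borel" for j by (rule borel_measurable_continuous_onI[OF G_cont])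
    note [measurable] = measurable_unit_param[OF c(1)]
    \<comment> \<open>Monotone convergence along the one path c, for which every \<open>G j\<close>
      has integral at most 1/2.\<close>
    have "path_integral d \<rho> c \<le> path_integral d (\<lambda>x. SUP j. ennreal (G j x)) c"
    proof (rule path_integral_mono_image[OF c(1)])
      fix t :: real assume "t \<in> {0..<1}"
      then have "c t \<in> W" using c(4)[of t] W(2) by auto
      then show "\<rho> (c t) \<le> (SUP j. ennreal (G j (c t)))"
        unfolding G_def using h(2,5) \<delta>(1) p0 by (intro le_SUP_powr_inverse) (auto simp: u_def add_nonneg_nonneg)
    qed
    also have "\<dots> = (\<integral>\<^sup>+s. (SUP j. ennreal (G j (unit_param c s)) * indicator {0..arc_len c 1} s) \<partial>lborel)"
      unfolding path_integral_eq[OF c(1)] by (simp add: SUP_mult_right_ennreal)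
    also have "\<dots> = (SUP j. \<integral>\<^sup>+s. ennreal (G j (unit_param c s)) * indicator {0..arc_len c 1} s \<partial>lborel)"
      by (rule nn_integral_monotone_convergence_SUP)
         (auto simp: incseq_Suc_iff le_fun_def G_mono ennreal_leI intro!: mult_right_mono)
    also have "\<dots> \<le> ennreal (1/2)" using c(5) unfolding path_integral_eq[OF c(1)] by (intro SUP_least) auto
    finally have le: "path_integral d \<rho> c \<le> ennreal (1/2)" .
    obtain \<beta> where \<beta>: "\<beta> \<in> \<Gamma>" "rectifiable d \<beta>" "path_integral d \<rho> \<beta> \<le> path_integral d \<rho> c"
      using \<Gamma>[OF c(1-3)] \<rho> by blast
    have "1 \<le> ennreal (1/2)" using adm[OF \<beta>(1,2)] \<beta>(3) le by (meson order_trans)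
    then show False using ennreal_le_iff[of "1/2" 1] by simp
  qed
qed

end

section \<open>Piecewise smooth paths on a Riemannian manifold\<close>

lemma C_k_on_cong:
  assumes "open S" "\<And>x. x \<in> S \<Longrightarrow> f x = g x" "C_k_on k f S"
  shows "C_k_on k g S"
  using assms(2,3)
proof (induction k arbitrary: f g)
  case 0
  then show ?case using continuous_on_cong[of S S f g] by simp
next
  case (Suc k)
  have fd: "(f has_derivative frechet_derivative f (at x)) (at x)" if "x \<in> S" for x
    using Suc.prems(2) that by (auto simp: frechet_derivative_works[symmetric])
  have gd: "(g has_derivative frechet_derivative f (at x)) (at x)" if "x \<in> S" for x
    using fd[OF that] assms(1) that by (rule has_derivative_transform_within_open) (rule Suc.prems(1))
  have eq: "frechet_derivative f (at x) = frechet_derivative g (at x)" if "x \<in> S" for x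
    using frechet_derivative_at[OF gd[OF that]] .
  have "C_k_on k (\<lambda>x. frechet_derivative g (at x) v) S" for v
    by (rule Suc.IH[of "\<lambda>x. frechet_derivative f (at x) v"]) (use eq Suc.prems in auto)
  then show ?case using gd by (auto simp: differentiable_def)
qed

lemma C_k_on_const: "C_k_on k (\<lambda>x. c) S"
  by (induction k arbitrary: c) auto

lemma smooth_on_line:
  fixes a b :: "'b::real_normed_vector"
  shows "smooth_on (\<lambda>t::real. a + t *\<^sub>R b) S"
  unfolding smooth_on_def
proof
  fix k
  have d: "((\<lambda>t. a + t *\<^sub>R b) has_derivative (\<lambda>v. v *\<^sub>R b)) (at x)" for x :: real
    by (auto intro!: derivative_eq_intros)
  have "frechet_derivative (\<lambda>t. a + t *\<^sub>R b) (at x) = (\<lambda>v. v *\<^sub>R b)" for x :: real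
    using frechet_derivative_at[OF d] by simp
  then show "C_k_on k (\<lambda>t. a + t *\<^sub>R b) S"
    using d by (cases k) (auto simp: C_k_on_const differentiable_def intro!: continuous_intros)
qed

lemma C_k_on_affine:
  fixes f :: "real \<Rightarrow> 'b::real_normed_vector"
  assumes "open S'" "\<And>x. x \<in> S' \<Longrightarrow> m * x + q \<in> S" "C_k_on k f S"
  shows "C_k_on k (\<lambda>x. f (m * x + q)) S'"
  using assms(3)
proof (induction k arbitrary: f)
  case 0
  then show ?case using assms(2) by (auto intro!: continuous_on_compose2[of S f] continuous_intros)
next
  case (Suc k)
  have d: "((\<lambda>x. f (m * x + q)) has_derivative (\<lambda>v. frechet_derivative f (at (m * x + q)) (m * v))) (at x)"
    if "x \<in> S'" for x
  proof -
    have "(f has_derivative frechet_derivative f (at (m * x + q))) (at (m * x + q))"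
      using Suc.prems assms(2)[OF that] frechet_derivative_works by auto
    moreover have "((\<lambda>x. m * x + q) has_derivative (\<lambda>v. m * v)) (at x)"
      by (auto intro!: derivative_eq_intros)
    ultimately show ?thesis using diff_chain_at[of "\<lambda>x. m * x + q"] by (auto simp: o_def)
  qed
  have e: "frechet_derivative (\<lambda>x. f (m * x + q)) (at x) = (\<lambda>v. frechet_derivative f (at (m * x + q)) (m * v))"
    if "x \<in> S'" for x using frechet_derivative_at[OF d[OF that]] by simp
  have "C_k_on k (\<lambda>x. frechet_derivative (\<lambda>x. f (m * x + q)) (at x) v) S'" for v
  proof (rule C_k_on_cong[OF assms(1)])
    show "C_k_on k (\<lambda>x. (\<lambda>y. frechet_derivative f (at y) (m * v)) (m * x + q)) S'"
      by (rule Suc.IH) (use Suc.prems in auto)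
  qed (use e in auto)
  then show ?case using d by (auto simp: differentiable_def)
qed

lemma smooth_on_affine:
  fixes f :: "real \<Rightarrow> 'b::real_normed_vector"
  assumes "open S'" "\<And>x. x \<in> S' \<Longrightarrow> m * x + q \<in> S" "smooth_on f S"
  shows "smooth_on (\<lambda>x. f (m * x + q)) S'"
  using assms C_k_on_affine unfolding smooth_on_def by blast

lemma smooth_on_imp_differentiable: "smooth_on f S \<Longrightarrow> x \<in> S \<Longrightarrow> f differentiable (at x)"
  unfolding smooth_on_def by (drule spec[of _ "Suc 0"]) simp

lemma smooth_on_imp_continuous: "smooth_on f S \<Longrightarrow> continuous_on S f"
  unfolding smooth_on_def by (drule spec[of _ "0"]) simp

lemma smooth_on_imp_continuous_derivative:
  "smooth_on f S \<Longrightarrow> continuous_on S (\<lambda>x. frechet_derivative f (at x) v)"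
  unfolding smooth_on_def by (drule spec[of _ "Suc 0"]) simp

lemma smooth_on_imp_vector_derivative:
  fixes h :: "real \<Rightarrow> 'b::real_normed_vector"
  assumes "smooth_on h J"
  shows "t \<in> J \<Longrightarrow> (h has_vector_derivative vector_derivative h (at t)) (at t)"
    and "continuous_on J (\<lambda>t. vector_derivative h (at t))"
proof -
  have d: "(h has_vector_derivative vector_derivative h (at t)) (at t)" if "t \<in> J" for t
    using smooth_on_imp_differentiable[OF assms that] by (simp add: vector_derivative_works)
  then show "t \<in> J \<Longrightarrow> (h has_vector_derivative vector_derivative h (at t)) (at t)" .
  have "frechet_derivative h (at t) 1 = vector_derivative h (at t)" if "t \<in> J" for t
    using frechet_derivative_at[OF d[OF that, unfolded has_vector_derivative_def]] by (metis scaleR_one)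
  then show "continuous_on J (\<lambda>t. vector_derivative h (at t))"
    using smooth_on_imp_continuous_derivative[OF assms, of 1] continuous_on_cong[OF refl] by (metis (no_types, lifting))
qed

lemma continuous_on_matvec [continuous_intros]:
  fixes A :: "'b::topological_space \<Rightarrow> real ^ 'n ^ 'm" and w :: "'b \<Rightarrow> real ^ 'n"
  assumes "continuous_on S A" "continuous_on S w"
  shows "continuous_on S (\<lambda>x. A x *v w x)"
  unfolding matrix_vector_mult_def using assms by (intro continuous_intros)

lemma inner_transpose_mult:
  fixes g D :: "real ^ 'n ^ 'n"
  shows "w \<bullet> ((transpose D ** g ** D) *v w) = (D *v w) \<bullet> (g *v (D *v w))"
proof -
  have "w \<bullet> ((transpose D ** g ** D) *v w) = w \<bullet> (transpose D *v (g *v (D *v w)))"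
    by (simp add: matrix_vector_mul_assoc matrix_mul_assoc)
  also have "\<dots> = (g *v (D *v w)) \<bullet> (D *v w)"
    unfolding transpose_matrix_vector by (subst inner_commute) (rule dot_lmul_matrix)
  also have "\<dots> = (D *v w) \<bullet> (g *v (D *v w))" by (rule inner_commute)
  finally show ?thesis .
qed

section \<open>Charts, changes of charts and the speed of a curve\<close>

locale riem =
  fixes M :: "('a::{t2_space, second_countable_topology}, 'n::finite) riemannian"
  assumes M: "riemannian_manifold M"
begin

lemma atlas_cover: obtains U \<phi> where "(U, \<phi>) \<in> atlas M" "x \<in> U"
proof -
  have "(\<Union>(U, \<phi>)\<in>atlas M. U) = UNIV" using M by (simp add: riemannian_manifold_def smooth_atlas_def)
  then have "x \<in> (\<Union>(U, \<phi>)\<in>atlas M. U)" by simp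
  then show ?thesis using that by auto
qed

context
  fixes U \<phi> assumes c: "(U, \<phi>) \<in> atlas M"
begin

lemma chart_open: "open U" "open (\<phi> ` U)"
  and chart_homeo: "homeomorphism U (\<phi> ` U) \<phi> (inv_into U \<phi>)"
  using M c unfolding riemannian_manifold_def smooth_atlas_def by (auto dest!: bspec)

lemma chart_cont: "continuous_on U \<phi>" "continuous_on (\<phi> ` U) (inv_into U \<phi>)"
  and chart_inv: "x \<in> U \<Longrightarrow> inv_into U \<phi> (\<phi> x) = x"
  using chart_homeo by (auto simp: homeomorphism_def)

lemma chart_inv2: "y \<in> \<phi> ` U \<Longrightarrow> \<phi> (inv_into U \<phi> y) = y" "y \<in> \<phi> ` U \<Longrightarrow> inv_into U \<phi> y \<in> U"
  by (auto intro: f_inv_into_f inv_into_into)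

lemma chart_preimage_open:
  assumes "open W" shows "open {x \<in> U. \<phi> x \<in> W}"
proof -
  have "{x \<in> U. \<phi> x \<in> W} = U \<inter> \<phi> -` W" by auto
  then show ?thesis using continuous_open_preimage[OF chart_cont(1) chart_open(1) assms] by simp
qed

lemma metric_smooth: "smooth_on (metric_tensor M (U, \<phi>) \<circ> inv_into U \<phi>) (\<phi> ` U)"
  and metric_pos: "x \<in> U \<Longrightarrow> w \<noteq> 0 \<Longrightarrow> 0 < w \<bullet> (metric_tensor M (U, \<phi>) x *v w)"
  using M c unfolding riemannian_manifold_def metric_tensor_on_def by (auto dest!: bspec)

lemma metric_cont: "continuous_on (\<phi> ` U) (\<lambda>y. metric_tensor M (U, \<phi>) (inv_into U \<phi> y))"
  using smooth_on_imp_continuous[OF metric_smooth] by (simp add: o_def)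

lemma metric_nonneg: "x \<in> U \<Longrightarrow> 0 \<le> w \<bullet> (metric_tensor M (U, \<phi>) x *v w)"
  using metric_pos[of x w] by (cases "w = 0") auto

end

lemma transition:
  assumes "(U, \<phi>) \<in> atlas M" "(V, \<psi>) \<in> atlas M" "x \<in> U" "x \<in> V"
  defines "F \<equiv> frechet_derivative (\<psi> \<circ> inv_into U \<phi>) (at (\<phi> x))"
  shows "((\<psi> \<circ> inv_into U \<phi>) has_derivative F) (at (\<phi> x))"
    and "w \<bullet> (metric_tensor M (U, \<phi>) x *v w) = F w \<bullet> (metric_tensor M (V, \<psi>) x *v F w)"
proof -
  have "smooth_on (\<psi> \<circ> inv_into U \<phi>) (\<phi> ` (U \<inter> V))"
    using M assms(1,2) unfolding riemannian_manifold_def smooth_atlas_def by fast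
  then have "(\<psi> \<circ> inv_into U \<phi>) differentiable (at (\<phi> x))"
    by (rule smooth_on_imp_differentiable) (use assms(3,4) in auto)
  then show F: "((\<psi> \<circ> inv_into U \<phi>) has_derivative F) (at (\<phi> x))"
    using frechet_derivative_works F_def by auto
  have g: "metric_tensor M (U, \<phi>) x = transpose (matrix F) ** metric_tensor M (V, \<psi>) x ** matrix F"
    using M assms(1-4) unfolding riemannian_manifold_def metric_tensor_on_def F_def Let_def by fast
  have "matrix F *v w = F w"
    using has_derivative_bounded_linear[OF F] by (simp add: matrix_works bounded_linear.linear)
  then show "w \<bullet> (metric_tensor M (U, \<phi>) x *v w) = F w \<bullet> (metric_tensor M (V, \<psi>) x *v F w)"
    unfolding g inner_transpose_mult by simp
qed

text \<open>Differentiability is asked for in one chart and carries over to all others by the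
  transition maps. Continuity is a separate condition because differentiability of
  \<open>\<phi> \<circ> \<gamma>\<close> does not keep \<gamma> inside the domain of the chart near
  t.\<close>

definition regular_at :: "(real \<Rightarrow> 'a) \<Rightarrow> real \<Rightarrow> bool" where
  "regular_at \<gamma> t \<longleftrightarrow> isCont \<gamma> t \<and> (\<exists>U \<phi>. (U, \<phi>) \<in> atlas M \<and> \<gamma> t \<in> U \<and> (\<phi> \<circ> \<gamma>) differentiable (at t))"

lemma isCont_eventually:
  assumes "isCont \<gamma> t" "open U" "\<gamma> t \<in> U"
  obtains J where "open J" "t \<in> J" "\<And>s. s \<in> J \<Longrightarrow> \<gamma> s \<in> U"
  using assms continuous_at_open[of t \<gamma>] by metis

text \<open>\<open>speed\<close> uses a chart picked by \<open>SOME\<close>. The chain rule for the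
  transition map and the transformation rule of the metric tensor show that every chart around the
  point gives the same value.\<close>

lemma
  assumes r: "regular_at \<gamma> t" and V: "(V, \<psi>) \<in> atlas M" "\<gamma> t \<in> V"
  shows regular_at_differentiable: "(\<psi> \<circ> \<gamma>) differentiable (at t)"
    and regular_at_speed: "speed M \<gamma> t =
      sqrt (vector_derivative (\<psi> \<circ> \<gamma>) (at t) \<bullet> (metric_tensor M (V, \<psi>) (\<gamma> t) *v vector_derivative (\<psi> \<circ> \<gamma>) (at t)))"
proof -
  have cont: "isCont \<gamma> t" using r by (simp add: regular_at_def)
  have chain: "((\<psi>' \<circ> \<gamma>) has_vector_derivative frechet_derivative (\<psi>' \<circ> inv_into U \<phi>) (at (\<phi> (\<gamma> t))) w) (at t)"
    if U: "(U, \<phi>) \<in> atlas M" "\<gamma> t \<in> U" and V: "(V', \<psi>') \<in> atlas M" "\<gamma> t \<in> V'"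
      and w: "((\<phi> \<circ> \<gamma>) has_vector_derivative w) (at t)" for U \<phi> V' \<psi>' w
  proof -
    let ?F = "frechet_derivative (\<psi>' \<circ> inv_into U \<phi>) (at (\<phi> (\<gamma> t)))"
    note F = transition(1)[OF U(1) V(1) U(2) V(2)]
    have "(((\<psi>' \<circ> inv_into U \<phi>) \<circ> (\<phi> \<circ> \<gamma>)) has_derivative (?F \<circ> (\<lambda>h. h *\<^sub>R w))) (at t)"
      using w F by (intro diff_chain_at) (auto simp: has_vector_derivative_def)
    moreover have "?F \<circ> (\<lambda>h. h *\<^sub>R w) = (\<lambda>h. h *\<^sub>R ?F w)"
      using has_derivative_bounded_linear[OF F] by (auto simp: fun_eq_iff linear_scale bounded_linear.linear)
    ultimately have d: "(((\<psi>' \<circ> inv_into U \<phi>) \<circ> (\<phi> \<circ> \<gamma>)) has_vector_derivative ?F w) (at t)"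
      by (simp add: has_vector_derivative_def)
    obtain J where J: "open J" "t \<in> J" "\<And>s. s \<in> J \<Longrightarrow> \<gamma> s \<in> U"
      using isCont_eventually[OF cont chart_open(1)[OF U(1)] U(2)] by blast
    show ?thesis
      by (rule has_vector_derivative_transform_within_open[OF d J(1,2)]) (use chart_inv[OF U(1)] J in auto)
  qed
  obtain U \<phi> where U: "(U, \<phi>) \<in> atlas M" "\<gamma> t \<in> U" "(\<phi> \<circ> \<gamma>) differentiable (at t)"
    using r by (auto simp: regular_at_def)
  have diff: "((\<psi>' \<circ> \<gamma>) has_vector_derivative vector_derivative (\<psi>' \<circ> \<gamma>) (at t)) (at t)"
    if "(V', \<psi>') \<in> atlas M" "\<gamma> t \<in> V'" for V' \<psi>'
    using chain[OF U(1,2) that] U(3) by (metis vector_derivative_works differentiableI_vector)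
  then show "(\<psi> \<circ> \<gamma>) differentiable (at t)" using V differentiableI_vector by blast
  define ch where "ch = (SOME c. c \<in> atlas M \<and> \<gamma> t \<in> fst c)"
  have "ch \<in> atlas M \<and> \<gamma> t \<in> fst ch" unfolding ch_def by (rule someI[of _ "(V, \<psi>)"]) (use V in auto)
  then obtain V' \<psi>' where ch: "ch = (V', \<psi>')" "(V', \<psi>') \<in> atlas M" "\<gamma> t \<in> V'" by (cases ch) auto
  let ?w = "vector_derivative (\<psi>' \<circ> \<gamma>) (at t)" and ?v = "vector_derivative (\<psi> \<circ> \<gamma>) (at t)"
  have sp: "speed M \<gamma> t = sqrt (?w \<bullet> (metric_tensor M (V', \<psi>') (\<gamma> t) *v ?w))"
    unfolding speed_def ch_def[symmetric] ch(1) Let_def by simp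
  have "?w = frechet_derivative (\<psi>' \<circ> inv_into V \<psi>) (at (\<psi> (\<gamma> t))) ?v"
    using chain[OF V ch(2,3) diff[OF V]] by (rule vector_derivative_at)
  then show "speed M \<gamma> t = sqrt (?v \<bullet> (metric_tensor M (V, \<psi>) (\<gamma> t) *v ?v))"
    unfolding sp transition(2)[OF V(1) ch(2) V(2) ch(3), of ?v] by simp
qed

lemma speed_nonneg: assumes "regular_at \<gamma> t" shows "0 \<le> speed M \<gamma> t"
proof -
  obtain U \<phi> where c: "(U, \<phi>) \<in> atlas M" "\<gamma> t \<in> U" using atlas_cover by blast
  show ?thesis unfolding regular_at_speed[OF assms c] by (rule real_sqrt_ge_zero) (rule metric_nonneg[OF c])
qed

lemma smooth_curve_on_iff:
  "smooth_curve_on M S \<gamma> \<longleftrightarrow> (\<forall>t\<in>S. \<exists>U \<phi>. (U, \<phi>) \<in> atlas M \<and> (\<exists>J h. open J \<and> t \<in> J \<and> smooth_on h J \<and>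
     (\<forall>s\<in>S \<inter> J. \<gamma> s \<in> U \<and> h s = \<phi> (\<gamma> s))))"
  unfolding smooth_curve_on_def Bex_def split_paired_Ex prod.case ..

lemma smooth_curve_onE:
  assumes "smooth_curve_on M S \<gamma>" "t \<in> S"
  obtains U \<phi> J h where "(U, \<phi>) \<in> atlas M" "open J" "t \<in> J" "smooth_on h J" 
    "\<And>s. s \<in> S \<Longrightarrow> s \<in> J \<Longrightarrow> \<gamma> s \<in> U" "\<And>s. s \<in> S \<Longrightarrow> s \<in> J \<Longrightarrow> h s = \<phi> (\<gamma> s)"
proof -
  from bspec[OF assms(1)[unfolded smooth_curve_on_iff] assms(2)] show ?thesis
  proof (elim exE conjE)
    fix U \<phi> J h
    assume "(U, \<phi>) \<in> atlas M" "open J" "t \<in> J" "smooth_on h J"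
      "\<forall>s\<in>S \<inter> J. \<gamma> s \<in> U \<and> h s = \<phi> (\<gamma> s)"
    then show thesis by (intro that[of U \<phi> J h]) auto
  qed
qed

lemma smooth_curve_onI:
  assumes "\<And>t. t \<in> S \<Longrightarrow> \<exists>U \<phi> J h. (U, \<phi>) \<in> atlas M \<and> open J \<and> t \<in> J \<and> smooth_on h J \<and>
     (\<forall>s\<in>S \<inter> J. \<gamma> s \<in> U \<and> h s = \<phi> (\<gamma> s))"
  shows "smooth_curve_on M S \<gamma>"
  unfolding smooth_curve_on_iff
proof
  fix t assume "t \<in> S"
  from assms[OF this] show "\<exists>U \<phi>. (U, \<phi>) \<in> atlas M \<and> (\<exists>J h. open J \<and> t \<in> J \<and> smooth_on h J \<and>
     (\<forall>s\<in>S \<inter> J. \<gamma> s \<in> U \<and> h s = \<phi> (\<gamma> s)))"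
    by (elim exE conjE) (intro exI conjI)
qed

lemma smooth_curve_on_subset:
  assumes "smooth_curve_on M S \<gamma>" "T \<subseteq> S" shows "smooth_curve_on M T \<gamma>"
proof (rule smooth_curve_onI)
  fix t assume "t \<in> T"
  then obtain U \<phi> J h where "(U, \<phi>) \<in> atlas M" "open J" "t \<in> J" "smooth_on h J"
    "\<And>s. s \<in> S \<Longrightarrow> s \<in> J \<Longrightarrow> \<gamma> s \<in> U" "\<And>s. s \<in> S \<Longrightarrow> s \<in> J \<Longrightarrow> h s = \<phi> (\<gamma> s)"
    using smooth_curve_onE[OF assms(1), of t] assms(2) by blast
  then show "\<exists>U \<phi> J h. (U, \<phi>) \<in> atlas M \<and> open J \<and> t \<in> J \<and> smooth_on h J \<and>
     (\<forall>s\<in>T \<inter> J. \<gamma> s \<in> U \<and> h s = \<phi> (\<gamma> s))"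
    using assms(2) by (intro exI[of _ U] exI[of _ \<phi>] exI[of _ J] exI[of _ h]) auto
qed

lemma smooth_curve_on_cong:
  assumes "smooth_curve_on M S \<gamma>" "\<And>t. t \<in> S \<Longrightarrow> \<gamma> t = \<beta> t"
  shows "smooth_curve_on M S \<beta>"
proof (rule smooth_curve_onI)
  fix t assume "t \<in> S"
  then obtain U \<phi> J h where "(U, \<phi>) \<in> atlas M" "open J" "t \<in> J" "smooth_on h J"
    "\<And>s. s \<in> S \<Longrightarrow> s \<in> J \<Longrightarrow> \<gamma> s \<in> U" "\<And>s. s \<in> S \<Longrightarrow> s \<in> J \<Longrightarrow> h s = \<phi> (\<gamma> s)"
    using smooth_curve_onE[OF assms(1), of t] by blast
  then show "\<exists>U \<phi> J h. (U, \<phi>) \<in> atlas M \<and> open J \<and> t \<in> J \<and> smooth_on h J \<and>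
     (\<forall>s\<in>S \<inter> J. \<beta> s \<in> U \<and> h s = \<phi> (\<beta> s))"
    using assms(2) by (intro exI[of _ U] exI[of _ \<phi>] exI[of _ J] exI[of _ h]) auto
qed

lemma smooth_curve_on_affine:
  assumes "smooth_curve_on M S \<gamma>" "\<And>t. t \<in> S' \<Longrightarrow> m * t + q \<in> S"
  shows "smooth_curve_on M S' (\<lambda>t. \<gamma> (m * t + q))"
proof (rule smooth_curve_onI)
  fix t assume t: "t \<in> S'"
  obtain U \<phi> J h where J: "(U, \<phi>) \<in> atlas M" "open J" "m * t + q \<in> J" "smooth_on h J" 
    "\<And>s. s \<in> S \<Longrightarrow> s \<in> J \<Longrightarrow> \<gamma> s \<in> U" "\<And>s. s \<in> S \<Longrightarrow> s \<in> J \<Longrightarrow> h s = \<phi> (\<gamma> s)"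
    using smooth_curve_onE[OF assms(1) assms(2)[OF t]] by blast
  let ?J = "(\<lambda>t. m * t + q) -` J"
  have "open ?J" by (rule open_vimage[OF J(2)]) (intro continuous_intros)
  moreover have "smooth_on (\<lambda>t. h (m * t + q)) ?J"
    by (rule smooth_on_affine[OF \<open>open ?J\<close> _ J(4)]) auto
  ultimately show "\<exists>U \<phi> J h. (U, \<phi>) \<in> atlas M \<and> open J \<and> t \<in> J \<and> smooth_on h J \<and>
     (\<forall>s\<in>S' \<inter> J. \<gamma> (m * s + q) \<in> U \<and> h s = \<phi> (\<gamma> (m * s + q)))"
    using J assms(2) by (intro exI[of _ U] exI[of _ \<phi>] exI[of _ ?J] exI[of _ "\<lambda>t. h (m * t + q)"]) auto
qed

lemma smooth_curve_on_continuous: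
  assumes "smooth_curve_on M S \<gamma>" shows "continuous_on S \<gamma>"
  unfolding continuous_on_eq_continuous_within
proof
  fix t assume t: "t \<in> S"
  obtain U \<phi> J h where J: "(U, \<phi>) \<in> atlas M" "open J" "t \<in> J" "smooth_on h J" 
    "\<And>s. s \<in> S \<Longrightarrow> s \<in> J \<Longrightarrow> \<gamma> s \<in> U" "\<And>s. s \<in> S \<Longrightarrow> s \<in> J \<Longrightarrow> h s = \<phi> (\<gamma> s)"
    using smooth_curve_onE[OF assms t] by blast
  have "continuous_on (S \<inter> J) (\<lambda>s. inv_into U \<phi> (h s))"
    by (rule continuous_on_compose2[OF chart_cont(2)[OF J(1)]])
       (use J in \<open>auto intro: continuous_on_subset[OF smooth_on_imp_continuous[OF J(4)]]\<close>)
  then have "continuous_on (S \<inter> J) \<gamma>"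
    by (rule continuous_on_eq) (use J chart_inv[OF J(1)] in auto)
  then have "continuous (at t within S \<inter> J) \<gamma>" using t J by (simp add: continuous_on_eq_continuous_within)
  moreover have "at t within S \<inter> J = at t within S"
    by (rule at_within_nhd[OF J(3,2)]) auto
  ultimately show "continuous (at t within S) \<gamma>" by simp
qed

text \<open>Stated for interior parameters because the two-sided derivative in \<open>speed\<close>
  may fail to exist at the ends of a piece. Near t the coordinates of the curve equal a smooth
  function on an open set, which also gives the continuity of the speed.\<close>

lemma smooth_curve_on_interior:
  assumes "smooth_curve_on M {a..b} \<gamma>" and t: "t \<in> {a<..<b}"
  shows "regular_at \<gamma> t" and "isCont (speed M \<gamma>) t"
proof -
  obtain U \<phi> J' h where J': "(U, \<phi>) \<in> atlas M" "open J'" "t \<in> J'" "smooth_on h J'" 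
    "\<And>s. s \<in> {a..b} \<Longrightarrow> s \<in> J' \<Longrightarrow> \<gamma> s \<in> U" "\<And>s. s \<in> {a..b} \<Longrightarrow> s \<in> J' \<Longrightarrow> h s = \<phi> (\<gamma> s)"
  proof -
    have "t \<in> {a..b}" using t by auto
    from smooth_curve_onE[OF assms(1) this] show ?thesis using that by blast
  qed
  define J where "J = J' \<inter> {a<..<b}"
  have J: "open J" "t \<in> J" "J \<subseteq> J'" "\<And>s. s \<in> J \<Longrightarrow> \<gamma> s \<in> U" "\<And>s. s \<in> J \<Longrightarrow> h s = \<phi> (\<gamma> s)"
    using J' t by (auto simp: J_def)
  have cont: "continuous_on J \<gamma>"
    using smooth_curve_on_continuous[OF assms(1)] by (rule continuous_on_subset) (auto simp: J_def)
  have vd: "((\<phi> \<circ> \<gamma>) has_vector_derivative vector_derivative h (at s)) (at s)" if s: "s \<in> J" for s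
  proof (rule has_vector_derivative_transform_within_open[OF _ J(1) s])
    show "(h has_vector_derivative vector_derivative h (at s)) (at s)"
      using smooth_on_imp_vector_derivative(1)[OF J'(4)] J(3) s by blast
  qed (simp add: J(5))
  have reg: "regular_at \<gamma> s" if s: "s \<in> J" for s
    unfolding regular_at_def
  proof (intro conjI exI)
    show "isCont \<gamma> s" using cont s continuous_on_eq_continuous_at[OF J(1)] by blast
    show "(\<phi> \<circ> \<gamma>) differentiable at s" using vd[OF s] by (rule differentiableI_vector)
  qed (use J'(1) J(4)[OF s] in auto)
  then show "regular_at \<gamma> t" using J by blast
  let ?w = "\<lambda>s. vector_derivative h (at s)"
  let ?f = "\<lambda>s. sqrt (?w s \<bullet> (metric_tensor M (U, \<phi>) (inv_into U \<phi> (h s)) *v ?w s))"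
  have eq: "speed M \<gamma> s = ?f s" if s: "s \<in> J" for s
    using regular_at_speed[OF reg[OF s] J'(1) J(4)[OF s]] vector_derivative_at[OF vd[OF s]]
      chart_inv[OF J'(1) J(4)[OF s]] J(5)[OF s] by simp
  have "continuous_on J ?w" "continuous_on J h"
    using smooth_on_imp_vector_derivative(2)[OF J'(4)] smooth_on_imp_continuous[OF J'(4)] J(3)
    by (auto intro: continuous_on_subset)
  moreover have "continuous_on J (\<lambda>s. metric_tensor M (U, \<phi>) (inv_into U \<phi> (h s)))"
    by (rule continuous_on_compose2[OF metric_cont[OF J'(1)] \<open>continuous_on J h\<close>]) (use J in auto)
  ultimately have "continuous_on J ?f"
    by (intro continuous_intros continuous_on_matvec)
  then have "continuous_on J (speed M \<gamma>)" by (rule continuous_on_eq) (simp add: eq)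
  then show "isCont (speed M \<gamma>) t" using J(2) continuous_on_eq_continuous_at[OF J(1)] by blast
qed

end

section \<open>Lengths of piecewise smooth paths and the extended distance\<close>

context riem begin

text \<open>Closed under concatenation by construction, so that properties are proved by induction
  over pieces instead of over partitions; on {0..1} it agrees with
  \<open>piecewise_smooth_path\<close>.\<close>

inductive pws :: "(real \<Rightarrow> 'a) \<Rightarrow> real \<Rightarrow> real \<Rightarrow> bool" for \<gamma> where
  smooth: "a < b \<Longrightarrow> smooth_curve_on M {a..b} \<gamma> \<Longrightarrow> pws \<gamma> a b"
| trans: "pws \<gamma> a b \<Longrightarrow> pws \<gamma> b c \<Longrightarrow> pws \<gamma> a c"

definition path_len :: "(real \<Rightarrow> 'a) \<Rightarrow> real \<Rightarrow> real \<Rightarrow> ennreal" where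
  "path_len \<gamma> a b = (\<integral>\<^sup>+t\<in>{a..b}. ennreal (speed M \<gamma> t) \<partial>lborel)"

text \<open>With values in \<open>ennreal\<close> because \<open>enn2real\<close> in
  \<open>geodesic_dist\<close> sends an infinite distance to 0. Symmetry and the triangle inequality
  are thus available before finiteness is known.\<close>

definition ext_dist :: "'a \<Rightarrow> 'a \<Rightarrow> ennreal" where
  "ext_dist x y = (INF \<gamma>\<in>{\<gamma>. pws \<gamma> 0 1 \<and> \<gamma> 0 = x \<and> \<gamma> 1 = y}. path_len \<gamma> 0 1)"

lemma pws_less: "pws \<gamma> a b \<Longrightarrow> a < b"
  by (induction rule: pws.induct) auto

lemma pws_sub: "pws \<gamma> a b \<Longrightarrow> a \<le> a' \<Longrightarrow> a' < b' \<Longrightarrow> b' \<le> b \<Longrightarrow> pws \<gamma> a' b'"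
proof (induction arbitrary: a' b' rule: pws.induct)
  case (smooth a b)
  have "smooth_curve_on M {a'..b'} \<gamma>"
    by (rule smooth_curve_on_subset[OF smooth(2)]) (use smooth in auto)
  then show ?case using smooth by (intro pws.smooth)
next
  case (trans a b c)
  consider "b' \<le> b" | "b \<le> a'" | "a' < b" "b < b'" by linarith
  then show ?case
  proof cases
    case 3
    then show ?thesis using trans by (intro pws.trans[of _ a' b b']) auto
  qed (use trans in auto)
qed

lemma pws_cong: "pws \<gamma> a b \<Longrightarrow> (\<And>t. t \<in> {a..b} \<Longrightarrow> \<gamma> t = \<beta> t) \<Longrightarrow> pws \<beta> a b"
proof (induction rule: pws.induct)
  case (smooth a b)
  have "smooth_curve_on M {a..b} \<beta>"
    by (rule smooth_curve_on_cong[OF smooth(2)]) (rule smooth.prems)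
  then show ?case using smooth by (intro pws.smooth)
next
  case (trans a b c)
  have "pws \<beta> a b" by (rule trans.IH(1)) (use trans.prems pws_less[OF trans.hyps(2)] in auto)
  moreover have "pws \<beta> b c" by (rule trans.IH(2)) (use trans.prems pws_less[OF trans.hyps(1)] in auto)
  ultimately show ?case by (rule pws.trans)
qed

lemma pws_affine: "pws \<gamma> a b \<Longrightarrow> m > 0 \<Longrightarrow> pws (\<lambda>t. \<gamma> (m * t + q)) ((a - q) / m) ((b - q) / m)"
proof (induction rule: pws.induct)
  case (smooth a b)
  have "smooth_curve_on M {(a - q) / m..(b - q) / m} (\<lambda>t. \<gamma> (m * t + q))"
    by (rule smooth_curve_on_affine[OF smooth(2)]) (use smooth in \<open>auto simp: field_simps\<close>)
  then show ?case using smooth by (intro pws.smooth) (auto simp: divide_strict_right_mono)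
next
  case (trans a b c)
  then show ?case by (blast intro: pws.trans)
qed

lemma pws_reflect: "pws \<gamma> a b \<Longrightarrow> pws (\<lambda>t. \<gamma> (q - t)) (q - b) (q - a)"
proof (induction rule: pws.induct)
  case (smooth a b)
  have "smooth_curve_on M {q - b..q - a} (\<lambda>t. \<gamma> (- 1 * t + q))"
    by (rule smooth_curve_on_affine[OF smooth(2)]) auto
  then show ?case using smooth by (intro pws.smooth) auto
next
  case (trans a b c)
  then show ?case by (blast intro: pws.trans)
qed

lemma pws_continuous: "pws \<gamma> a b \<Longrightarrow> continuous_on {a..b} \<gamma>"
proof (induction rule: pws.induct)
  case (smooth a b)
  then show ?case by (intro smooth_curve_on_continuous)
next
  case (trans a b c)
  have "{a..c} = {a..b} \<union> {b..c}" using pws_less[OF trans.hyps(1)] pws_less[OF trans.hyps(2)] by auto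
  then show ?case using trans.IH by (simp add: continuous_on_closed_Un)
qed

lemma pws_regular:
  "pws \<gamma> a b \<Longrightarrow> \<exists>F. finite F \<and> (\<forall>t\<in>{a..b} - F. regular_at \<gamma> t \<and> isCont (speed M \<gamma>) t)"
proof (induction rule: pws.induct)
  case (smooth a b)
  show ?case
    by (intro exI[of _ "{a, b}"]) (use smooth_curve_on_interior[OF smooth(2)] in auto)
next
  case (trans a b c)
  then obtain F1 F2 where "finite F1" "finite F2"
    "\<forall>t\<in>{a..b} - F1. regular_at \<gamma> t \<and> isCont (speed M \<gamma>) t"
    "\<forall>t\<in>{b..c} - F2. regular_at \<gamma> t \<and> isCont (speed M \<gamma>) t" by blast
  then show ?case by (intro exI[of _ "F1 \<union> F2"]) force
qed

text \<open>Nothing is known of \<open>speed\<close> at finitely many parameters, and elsewhere it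
  is continuous; changing a measurable function at countably many points keeps it
  measurable.\<close>

lemma measurable_speed:
  assumes "pws \<gamma> a b"
  shows "(\<lambda>t. ennreal (speed M \<gamma> t) * indicator {a..b} t) \<in> borel_measurable borel"
proof -
  obtain F where F: "finite F" "\<And>t. t \<in> {a..b} - F \<Longrightarrow> isCont (speed M \<gamma>) t" using pws_regular[OF assms] by blast
  define S where "S = {a<..<b} - F"
  have "open S" unfolding S_def using F(1) by (intro open_Diff finite_imp_closed) auto
  moreover have "continuous_on S (speed M \<gamma>)"
    by (rule continuous_at_imp_continuous_on) (use F(2) in \<open>auto simp: S_def\<close>)
  ultimately have [measurable]: "(\<lambda>t. indicator S t *\<^sub>R speed M \<gamma> t) \<in> borel_measurable borel"
    by (intro borel_measurable_continuous_on_indicator) auto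
  have "(\<lambda>t. ennreal (indicator S t *\<^sub>R speed M \<gamma> t)) \<in> borel_measurable borel" by measurable
  then show ?thesis
  proof (rule measurable_discrete_difference[where X="insert a (insert b F)"])
    show "countable (insert a (insert b F))" using F(1) by (simp add: countable_finite)
    fix t assume "t \<notin> insert a (insert b F)"
    then show "ennreal (indicator S t *\<^sub>R speed M \<gamma> t) = ennreal (speed M \<gamma> t) * indicator {a..b} t"
      by (auto simp: S_def indicator_def)
  qed auto
qed

lemma len_add:
  assumes "pws \<gamma> a c" "a \<le> b" "b \<le> c"
  shows "path_len \<gamma> a c = path_len \<gamma> a b + path_len \<gamma> b c"
proof -
  let ?f = "\<lambda>t. ennreal (speed M \<gamma> t) * indicator {a..c} t"
  have e: "(\<integral>\<^sup>+t\<in>{a'..b'}. ?f t \<partial>lborel) = path_len \<gamma> a' b'" if "a \<le> a'" "b' \<le> c" for a' b'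
    unfolding path_len_def by (rule nn_integral_cong) (use that in \<open>auto simp: indicator_def\<close>)
  show ?thesis using nn_integral_Icc_split[OF measurable_speed[OF assms(1)] assms(2,3)] assms(2,3)
    by (simp only: e order.refl)
qed

lemma len_mono: "a \<le> a' \<Longrightarrow> b' \<le> b \<Longrightarrow> path_len \<gamma> a' b' \<le> path_len \<gamma> a b"
  unfolding path_len_def by (rule nn_integral_mono) (auto simp: indicator_def)

lemma AE_not_in_finite: "finite F \<Longrightarrow> AE t in lborel. (t::real) \<notin> F"
  using finite_imp_null_set_lborel AE_not_in by blast

lemma speed_affine:
  assumes "regular_at \<gamma> (m * t + q)"
  shows "speed M (\<lambda>t. \<gamma> (m * t + q)) t = \<bar>m\<bar> * speed M \<gamma> (m * t + q)"
proof -
  define x where "x = \<gamma> (m * t + q)"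
  define ch where "ch = (SOME c. c \<in> atlas M \<and> x \<in> fst c)"
  obtain U \<phi> where U: "(U, \<phi>) \<in> atlas M" "x \<in> U" by (rule atlas_cover)
  have "ch \<in> atlas M \<and> x \<in> fst ch" unfolding ch_def by (rule someI[of _ "(U, \<phi>)"]) (use U in auto)
  then have ch: "(fst ch, snd ch) \<in> atlas M" "\<gamma> (m * t + q) \<in> fst ch" by (auto simp: x_def)
  let ?w = "vector_derivative (snd ch \<circ> \<gamma>) (at (m * t + q))"
  have w: "((snd ch \<circ> \<gamma>) has_vector_derivative ?w) (at (m * t + q))"
    using regular_at_differentiable[OF assms ch] by (simp add: vector_derivative_works)
  have a: "((\<lambda>t. m * t + q) has_vector_derivative m) (at t)"
    by (auto intro!: derivative_eq_intros)
  have "((snd ch \<circ> \<gamma>) \<circ> (\<lambda>t. m * t + q) has_vector_derivative m *\<^sub>R ?w) (at t)"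
    by (rule vector_diff_chain_at[OF a w])
  then have "vector_derivative (snd ch \<circ> (\<lambda>t. \<gamma> (m * t + q))) (at t) = m *\<^sub>R ?w"
    by (intro vector_derivative_at) (simp add: o_def)
  then have "speed M (\<lambda>t. \<gamma> (m * t + q)) t = sqrt (m\<^sup>2 * (?w \<bullet> (metric_tensor M ch x *v ?w)))"
    unfolding speed_def x_def[symmetric] ch_def[symmetric] Let_def
    by (simp add: matrix_vector_mult_scaleR power2_eq_square mult.assoc)
  also have "\<dots> = \<bar>m\<bar> * sqrt (?w \<bullet> (metric_tensor M ch x *v ?w))"
    by (simp add: real_sqrt_mult)
  also have "\<dots> = \<bar>m\<bar> * speed M \<gamma> (m * t + q)"
    unfolding speed_def x_def[symmetric] ch_def[symmetric] Let_def by simp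
  finally show ?thesis .
qed

text \<open>The substitution multiplies the speed by \<open>\<bar>m\<bar>\<close> and Lebesgue
  measure by its inverse. Writing the domain as an indicator at \<open>m * t + q\<close> makes one
  statement serve both signs of m, and so both rescaling and reversal.\<close>

lemma len_affine_aux:
  assumes "pws \<gamma> a b" "m \<noteq> 0"
  shows "(\<integral>\<^sup>+t. ennreal (speed M (\<lambda>t. \<gamma> (m * t + q)) t) * indicator {a..b} (m * t + q) \<partial>lborel) = path_len \<gamma> a b"
proof -
  obtain F where F: "finite F" "\<And>t. t \<in> {a..b} - F \<Longrightarrow> regular_at \<gamma> t" using pws_regular[OF assms(1)] by blast
  let ?f = "\<lambda>t. ennreal (speed M \<gamma> t) * indicator {a..b} t"
  have "path_len \<gamma> a b = ennreal \<bar>m\<bar> * (\<integral>\<^sup>+t. ?f (q + m * t) \<partial>lborel)"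
    unfolding path_len_def by (rule nn_integral_real_affine[OF measurable_speed[OF assms(1)] assms(2)])
  also have "\<dots> = (\<integral>\<^sup>+t. ennreal \<bar>m\<bar> * ?f (q + m * t) \<partial>lborel)"
  proof (rule nn_integral_cmult[symmetric])
    have "(\<lambda>t. ?f (q + m * t)) \<in> borel_measurable borel"
      by (rule measurable_compose[OF _ measurable_speed[OF assms(1)]]) measurable
    then show "(\<lambda>t. ?f (q + m * t)) \<in> borel_measurable lborel" by simp
  qed
  also have "\<dots> = (\<integral>\<^sup>+t. ennreal (speed M (\<lambda>t. \<gamma> (m * t + q)) t) * indicator {a..b} (m * t + q) \<partial>lborel)"
  proof (rule nn_integral_cong_AE)
    have "finite ((\<lambda>t. m * t + q) -` F)" by (rule finite_vimageI[OF F(1)]) (use assms(2) in \<open>auto simp: inj_def\<close>)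
    from AE_not_in_finite[OF this]
    show "AE t in lborel. ennreal \<bar>m\<bar> * ?f (q + m * t) =
        ennreal (speed M (\<lambda>t. \<gamma> (m * t + q)) t) * indicator {a..b} (m * t + q)"
    proof eventually_elim
      case (elim t)
      show ?case
      proof (cases "m * t + q \<in> {a..b}")
        case True
        then have "regular_at \<gamma> (m * t + q)" using F(2) elim by simp
        then show ?thesis using True
          by (simp add: speed_affine ennreal_mult' add.commute[of q])
      qed (simp add: add.commute[of q])
    qed
  qed
  finally show ?thesis by simp
qed

lemma len_affine:
  assumes "pws \<gamma> a b" "m > 0"
  shows "path_len (\<lambda>t. \<gamma> (m * t + q)) ((a - q) / m) ((b - q) / m) = path_len \<gamma> a b"
  unfolding len_affine_aux[OF assms(1), of m q, symmetric, OF less_imp_neq[OF assms(2), symmetric]]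
  unfolding path_len_def
  by (rule nn_integral_cong) (use assms(2) in \<open>auto simp: indicator_def field_simps\<close>)

lemma len_reflect:
  assumes "pws \<gamma> a b"
  shows "path_len (\<lambda>t. \<gamma> (q - t)) (q - b) (q - a) = path_len \<gamma> a b"
proof -
  have "path_len \<gamma> a b = (\<integral>\<^sup>+t. ennreal (speed M (\<lambda>t. \<gamma> (-1 * t + q)) t) * indicator {a..b} (-1 * t + q) \<partial>lborel)"
    by (rule len_affine_aux[OF assms, symmetric]) simp
  also have "\<dots> = path_len (\<lambda>t. \<gamma> (q - t)) (q - b) (q - a)"
    unfolding path_len_def by (rule nn_integral_cong) (auto simp: indicator_def)
  finally show ?thesis by simp
qed

text \<open>Agreement on {a..b} determines the derivatives only in the open interval; the two end
  points form a null set.\<close>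

lemma len_cong:
  assumes "\<And>t. t \<in> {a..b} \<Longrightarrow> \<gamma> t = \<beta> t"
  shows "path_len \<gamma> a b = path_len \<beta> a b"
  unfolding path_len_def
proof (rule nn_integral_cong_AE)
  show "AE t in lborel. ennreal (speed M \<gamma> t) * indicator {a..b} t = ennreal (speed M \<beta> t) * indicator {a..b} t"
    using AE_not_in_finite[of "{a, b}", OF finite.insertI[OF finite.insertI[OF finite.emptyI]]]
  proof eventually_elim
    case (elim t)
    show ?case
    proof (cases "t \<in> {a..b}")
      case True
      then have t: "t \<in> {a<..<b}" using elim by auto
      have "\<forall>\<^sub>F s in nhds t. s \<in> {a<..<b}" by (rule eventually_nhds_in_open) (use t in auto)
      then have "\<forall>\<^sub>F s in nhds t. s \<in> UNIV \<longrightarrow> (f \<circ> \<gamma>) s = (f \<circ> \<beta>) s" for f :: "'a \<Rightarrow> real ^ 'n"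
        by eventually_elim (use assms in auto)
      then have "vector_derivative (f \<circ> \<gamma>) (at t) = vector_derivative (f \<circ> \<beta>) (at t)" for f :: "'a \<Rightarrow> real ^ 'n"
        by (intro vector_derivative_cong_eq) auto
      moreover have "\<gamma> t = \<beta> t" using assms True by auto
      ultimately show ?thesis by (simp add: speed_def Let_def)
    qed simp
  qed
qed

lemma pws_imp_partition:
  "pws \<gamma> a b \<Longrightarrow> \<exists>(k::nat) t. t 0 = a \<and> t k = b \<and> (\<forall>i<k. t i < t (Suc i) \<and> smooth_curve_on M {t i..t (Suc i)} \<gamma>)"
proof (induction rule: pws.induct)
  case (smooth a b)
  then show ?case by (intro exI[of _ 1] exI[of _ "\<lambda>i. if i = 0 then a else b"]) auto
next
  case (trans a b c)
  obtain k t where t: "t 0 = a" "t (k::nat) = b" "\<forall>i<k. t i < t (Suc i) \<and> smooth_curve_on M {t i..t (Suc i)} \<gamma>"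
    using trans.IH(1) by blast
  obtain l s where s: "s 0 = b" "s (l::nat) = c" "\<forall>i<l. s i < s (Suc i) \<and> smooth_curve_on M {s i..s (Suc i)} \<gamma>"
    using trans.IH(2) by blast
  let ?r = "\<lambda>i. if i \<le> k then t i else s (i - k)"
  show ?case
  proof (intro exI[of _ "k + l"] exI[of _ ?r] conjI)
    show "?r 0 = a" using t by simp
    show "?r (k + l) = c" using t s by (cases "l = 0") auto
    show "\<forall>i<k + l. ?r i < ?r (Suc i) \<and> smooth_curve_on M {?r i..?r (Suc i)} \<gamma>"
    proof (intro allI impI)
      fix i assume i: "i < k + l"
      consider "i < k" | "i = k" | "i > k" by linarith
      then show "?r i < ?r (Suc i) \<and> smooth_curve_on M {?r i..?r (Suc i)} \<gamma>"
      proof cases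
        case 1
        then show ?thesis using t by simp
      next
        case 2
        then show ?thesis using s(3)[rule_format, of 0] t(2) s(1) i by simp
      next
        case 3
        then show ?thesis using s(3)[rule_format, of "i - k"] i by (simp add: Suc_diff_le)
      qed
    qed
  qed
qed

lemma piecewise_smooth_path_iff: "piecewise_smooth_path M \<gamma> \<longleftrightarrow> pws \<gamma> 0 1"
proof
  assume "piecewise_smooth_path M \<gamma>"
  then obtain k t where t: "t 0 = 0" "t (k::nat) = 1" "\<And>i. i < k \<Longrightarrow> t i < t (Suc i)"
    "\<And>i. i < k \<Longrightarrow> smooth_curve_on M {t i..t (Suc i)} \<gamma>"
    unfolding piecewise_smooth_path_def by blast
  have P: "pws \<gamma> (t 0) (t (Suc i))" if "Suc i \<le> k" for i
    using that
  proof (induction i)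
    case 0
    then have "0 < k" by simp
    then show ?case using t(3)[of 0] t(4)[of 0] by (intro pws.smooth)
  next
    case (Suc i)
    then have "pws \<gamma> (t (Suc i)) (t (Suc (Suc i)))" using t by (intro pws.smooth) auto
    then show ?case using Suc by (auto intro: pws.trans)
  qed
  have "k \<noteq> 0" using t(1,2) by (intro notI) auto
  then obtain j where "k = Suc j" by (cases k) auto
  then show "pws \<gamma> 0 1" using P[of j] t(1,2) by simp
next
  assume "pws \<gamma> 0 1"
  then show "piecewise_smooth_path M \<gamma>"
    unfolding piecewise_smooth_path_def path_def using pws_continuous pws_imp_partition by blast
qed

lemma geodesic_dist_eq: "geodesic_dist M x y = enn2real (ext_dist x y)"
  unfolding geodesic_dist_def ext_dist_def piecewise_smooth_path_iff riemannian_length_def path_len_def ..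

lemma ed_le:
  assumes "pws \<gamma> a b" "\<gamma> a = x" "\<gamma> b = y"
  shows "ext_dist x y \<le> path_len \<gamma> a b"
proof -
  have ab: "b - a > 0" using pws_less[OF assms(1)] by simp
  let ?\<beta> = "\<lambda>t. \<gamma> ((b - a) * t + a)"
  have "pws ?\<beta> 0 1" "path_len ?\<beta> 0 1 = path_len \<gamma> a b"
    using pws_affine[OF assms(1) ab, of a] len_affine[OF assms(1) ab, of a] ab by simp_all
  then show ?thesis unfolding ext_dist_def using assms by (intro INF_lower2[of ?\<beta>]) auto
qed

lemma ed_sym: "ext_dist x y = ext_dist y x"
proof -
  have "ext_dist y x \<le> ext_dist x y" for x y
    unfolding ext_dist_def[of x y]
  proof (rule INF_greatest)
    fix \<gamma> assume "\<gamma> \<in> {\<gamma>. pws \<gamma> 0 1 \<and> \<gamma> 0 = x \<and> \<gamma> 1 = y}"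
    then show "ext_dist y x \<le> path_len \<gamma> 0 1"
      using ed_le[OF pws_reflect[of \<gamma> 0 1 1], of y x] len_reflect[of \<gamma> 0 1 1] by simp
  qed
  then show ?thesis by (intro antisym)
qed

lemma ed_triangle: "ext_dist x z \<le> ext_dist x y + ext_dist y z"
proof -
  have main: "ext_dist x z \<le> path_len \<gamma> 0 1 + path_len \<beta> 0 1"
    if \<gamma>: "pws \<gamma> 0 1" "\<gamma> 0 = x" "\<gamma> 1 = y" and \<beta>: "pws \<beta> 0 1" "\<beta> 0 = y" "\<beta> 1 = z" for \<gamma> \<beta>
  proof -
    let ?\<beta> = "\<lambda>t. \<beta> (1 * t + - 1)"
    let ?\<alpha> = "\<lambda>t. if t \<le> 1 then \<gamma> t else \<beta> (t - 1)"
    have 1: "pws ?\<alpha> 0 1" "path_len ?\<alpha> 0 1 = path_len \<gamma> 0 1"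
      using pws_cong[OF \<gamma>(1), of ?\<alpha>] len_cong[of 0 1 \<gamma> ?\<alpha>] by auto
    have "pws ?\<beta> 1 2" "path_len ?\<beta> 1 2 = path_len \<beta> 0 1"
      using pws_affine[OF \<beta>(1), of 1 "-1"] len_affine[OF \<beta>(1), of 1 "-1"] by simp_all
    moreover have "?\<beta> t = ?\<alpha> t" if "t \<in> {1..2}" for t
      using that \<gamma>(3) \<beta>(2) by (cases "t = 1") auto
    ultimately have 2: "pws ?\<alpha> 1 2" "path_len ?\<alpha> 1 2 = path_len \<beta> 0 1"
      using pws_cong[of ?\<beta> 1 2 ?\<alpha>] len_cong[of 1 2 ?\<beta> ?\<alpha>] by auto
    have p: "pws ?\<alpha> 0 2" by (rule pws.trans[OF 1(1) 2(1)])
    have "ext_dist x z \<le> path_len ?\<alpha> 0 2" by (rule ed_le[OF p]) (use \<gamma> \<beta> in auto)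
    also have "\<dots> = path_len \<gamma> 0 1 + path_len \<beta> 0 1" using len_add[OF p, of 1] 1 2 by simp
    finally show ?thesis .
  qed
  have "ext_dist x z \<le> path_len \<gamma> 0 1 + ext_dist y z" if "pws \<gamma> 0 1" "\<gamma> 0 = x" "\<gamma> 1 = y" for \<gamma>
    unfolding ext_dist_def[of y z] using main[OF that] by (intro le_add_INF_ennreal) auto
  then have "ext_dist x z \<le> ext_dist y z + path_len \<gamma> 0 1" if "pws \<gamma> 0 1" "\<gamma> 0 = x" "\<gamma> 1 = y" for \<gamma>
    using that by (simp add: add.commute)
  then have "ext_dist x z \<le> ext_dist y z + ext_dist x y"
    unfolding ext_dist_def[of x y] by (intro le_add_INF_ennreal) auto
  then show ?thesis by (simp add: add.commute)
qed

end

section \<open>The geodesic distance in charts\<close>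

lemma continuous_on_det:
  fixes A :: "'b::topological_space \<Rightarrow> real ^ 'n ^ 'n"
  assumes "continuous_on S A" shows "continuous_on S (\<lambda>x. det (A x))"
  unfolding det_def using assms by (intro continuous_intros)

text \<open>All matrices on the segment from the identity to A have trivial kernel. The determinant
  is therefore a continuous function without zeros on the segment, and it is 1 at the
  identity.\<close>

lemma det_pos_of_positive_definite:
  fixes A :: "real ^ 'n ^ 'n"
  assumes pos: "\<And>w. w \<noteq> 0 \<Longrightarrow> 0 < w \<bullet> (A *v w)"
  shows "0 < det A"
proof (rule ccontr)
  assume neg: "\<not> 0 < det A"
  define B where "B = (\<lambda>t::real. (1 - t) *\<^sub>R mat 1 + t *\<^sub>R A)"
  have B: "B t *v w = (1 - t) *\<^sub>R w + t *\<^sub>R (A *v w)" for t w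
    by (simp add: B_def matrix_vector_mult_add_rdistrib scaleR_matrix_vector_assoc[symmetric])
  have nz: "det (B t) \<noteq> 0" if t: "t \<in> {0..1}" for t
  proof -
    have "w = 0" if "B t *v w = 0" for w
    proof (rule ccontr)
      assume w: "w \<noteq> 0"
      have "0 = w \<bullet> (B t *v w)" using that by simp
      also have "\<dots> = (1 - t) * (w \<bullet> w) + t * (w \<bullet> (A *v w))"
        by (simp add: B inner_add_right)
      also have "\<dots> > 0"
        using pos[OF w] w t by (cases "t = 0") (auto intro!: add_nonneg_pos mult_pos_pos mult_nonneg_nonneg)
      finally show False by simp
    qed
    then have "invertible (B t)"
      using matrix_left_invertible_ker[of "B t"] by (auto simp: invertible_left_inverse)
    then show ?thesis by (simp add: invertible_det_nz)
  qed
  have "continuous_on {0..1} (\<lambda>t. det (B t))"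
    unfolding B_def by (intro continuous_on_det continuous_intros)
  moreover have "det (B 1) \<le> 0" "0 \<le> det (B 0)" using neg by (simp_all add: B_def)
  ultimately obtain t where "t \<in> {0..1}" "det (B t) = 0"
    using IVT2'[of "\<lambda>t. det (B t)" 1 0 0] by auto
  then show False using nz by blast
qed

section \<open>Comparison with the Euclidean distance in a chart\<close>

context riem begin

abbreviation gram :: "'a set \<Rightarrow> ('a \<Rightarrow> real ^ 'n) \<Rightarrow> real ^ 'n \<Rightarrow> real ^ 'n ^ 'n" where
  "gram U \<phi> y \<equiv> metric_tensor M (U, \<phi>) (inv_into U \<phi> y)"

definition good_chart :: "'a \<Rightarrow> 'a set \<Rightarrow> ('a \<Rightarrow> real ^ 'n) \<Rightarrow> real \<Rightarrow> real \<Rightarrow> real \<Rightarrow> bool" where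
  "good_chart z U \<phi> r a b \<longleftrightarrow> (U, \<phi>) \<in> atlas M \<and> z \<in> U \<and> 0 < r \<and> 0 < a \<and> 0 < b \<and> cball (\<phi> z) r \<subseteq> \<phi> ` U \<and>
     (\<forall>y\<in>cball (\<phi> z) r. \<forall>w. a * norm w \<le> sqrt (w \<bullet> (gram U \<phi> y *v w)) \<and> sqrt (w \<bullet> (gram U \<phi> y *v w)) \<le> b * norm w)"

definition chart_ball :: "'a set \<Rightarrow> ('a \<Rightarrow> real ^ 'n) \<Rightarrow> 'a \<Rightarrow> real \<Rightarrow> 'a set" where
  "chart_ball U \<phi> z s = {x \<in> U. \<phi> x \<in> ball (\<phi> z) s}"

text \<open>The quadratic form of the metric attains a positive minimum and a maximum on the compact
  product of a coordinate ball and the unit sphere; homogeneity extends the bounds to all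
  vectors.\<close>

lemma good_chart_exists:
  assumes c: "(U, \<phi>) \<in> atlas M" "z \<in> U"
  obtains r a b where "good_chart z U \<phi> r a b"
proof -
  have "\<phi> z \<in> \<phi> ` U" using c by simp
  then obtain r where r: "r > 0" "cball (\<phi> z) r \<subseteq> \<phi> ` U"
    using chart_open(2)[OF c(1)] open_contains_cball by metis
  let ?S = "cball (\<phi> z) r \<times> sphere (0 :: real ^ 'n) 1"
  let ?q = "\<lambda>(y, w). w \<bullet> (gram U \<phi> y *v w)"
  have comp: "compact ?S" by (intro compact_Times) auto
  have "(\<phi> z, axis undefined 1) \<in> ?S" using r by (auto simp: norm_axis_1)
  then have ne: "?S \<noteq> {}" by blast
  have "continuous_on ?S (\<lambda>p. snd p \<bullet> (gram U \<phi> (fst p) *v snd p))"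
    using r by (intro continuous_intros continuous_on_compose2[OF metric_cont[OF c(1)], of _ fst]) auto
  then have cont: "continuous_on ?S ?q" by (simp add: case_prod_beta)
  obtain p0 where p0: "p0 \<in> ?S" "\<And>p. p \<in> ?S \<Longrightarrow> ?q p0 \<le> ?q p"
    using continuous_attains_inf[OF comp ne cont] by blast
  obtain p1 where p1: "p1 \<in> ?S" "\<And>p. p \<in> ?S \<Longrightarrow> ?q p \<le> ?q p1"
    using continuous_attains_sup[OF comp ne cont] by blast
  have pos: "0 < ?q p" if "p \<in> ?S" for p
  proof -
    obtain y w where p1: "p = (y, w)" by (cases p)
    then have p: "p = (y, w)" "y \<in> cball (\<phi> z) r" "norm w = 1" using that by auto
    then have "inv_into U \<phi> y \<in> U" "w \<noteq> 0" using r chart_inv2(2)[OF c(1), of y] by auto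
    then show ?thesis using metric_pos[OF c(1)] p by simp
  qed
  let ?a = "sqrt (?q p0)" and ?b = "sqrt (?q p1)"
  have "?a * norm w \<le> sqrt (w \<bullet> (gram U \<phi> y *v w)) \<and> sqrt (w \<bullet> (gram U \<phi> y *v w)) \<le> ?b * norm w"
    if y: "y \<in> cball (\<phi> z) r" for y w
  proof (cases "w = 0")
    case False
    define u where "u = w /\<^sub>R norm w"
    have w: "w = norm w *\<^sub>R u" using False by (simp add: u_def)
    have u: "(y, u) \<in> ?S" using y False by (simp add: u_def)
    have "w \<bullet> (gram U \<phi> y *v w) = (norm w)\<^sup>2 * ?q (y, u)"
      by (subst (1 2) w) (simp add: matrix_vector_mult_scaleR power2_eq_square)
    then have "sqrt (w \<bullet> (gram U \<phi> y *v w)) = norm w * sqrt (?q (y, u))" by (simp add: real_sqrt_mult)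
    moreover have "?a \<le> sqrt (?q (y, u))" "sqrt (?q (y, u)) \<le> ?b"
      using p0(2)[OF u] p1(2)[OF u] by (auto intro: real_sqrt_le_mono)
    ultimately show ?thesis using mult_left_mono[of ?a "sqrt (?q (y, u))" "norm w"]
        mult_left_mono[of "sqrt (?q (y, u))" ?b "norm w"] by (simp add: mult.commute)
  qed simp
  then have "good_chart z U \<phi> r ?a ?b"
    unfolding good_chart_def using c r pos[OF p0(1)] pos[OF p1(1)] by auto
  then show ?thesis by (rule that)
qed

context
  fixes z U \<phi> r a b
  assumes good: "good_chart z U \<phi> r a b"
begin

lemma good: "(U, \<phi>) \<in> atlas M" "z \<in> U" "0 < r" "0 < a" "0 < b" "cball (\<phi> z) r \<subseteq> \<phi> ` U"
  and good_lower: "y \<in> cball (\<phi> z) r \<Longrightarrow> a * norm w \<le> sqrt (w \<bullet> (gram U \<phi> y *v w))"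
  and good_upper: "y \<in> cball (\<phi> z) r \<Longrightarrow> sqrt (w \<bullet> (gram U \<phi> y *v w)) \<le> b * norm w"
  using good by (auto simp: good_chart_def)

lemma open_cb: "open (chart_ball U \<phi> z s)"
  unfolding chart_ball_def by (rule chart_preimage_open[OF good(1)]) auto

lemma z_in_cb: "0 < s \<Longrightarrow> z \<in> chart_ball U \<phi> z s"
  using good by (simp add: chart_ball_def)

lemma image_cb: "s \<le> r \<Longrightarrow> \<phi> ` chart_ball U \<phi> z s = ball (\<phi> z) s"
proof
  assume s: "s \<le> r"
  show "ball (\<phi> z) s \<subseteq> \<phi> ` chart_ball U \<phi> z s"
  proof
    fix y assume y: "y \<in> ball (\<phi> z) s"
    then have "y \<in> \<phi> ` U" using good(6) s by auto
    then show "y \<in> \<phi> ` chart_ball U \<phi> z s" using y by (auto simp: chart_ball_def)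
  qed
qed (auto simp: chart_ball_def)

lemma cb_eq_image: "s \<le> r \<Longrightarrow> chart_ball U \<phi> z s = inv_into U \<phi> ` ball (\<phi> z) s"
proof -
  assume s: "s \<le> r"
  have "chart_ball U \<phi> z s = inv_into U \<phi> ` \<phi> ` chart_ball U \<phi> z s"
    using chart_inv[OF good(1)] by (auto simp: chart_ball_def image_image intro!: image_eqI)
  then show ?thesis by (simp add: image_cb[OF s])
qed

text \<open>The preimage of the straight segment is a competitor: it stays in the coordinate ball by
  convexity and has speed at most \<open>b * norm (y2 - y1)\<close>.\<close>

lemma ed_upper:
  assumes y: "y1 \<in> ball (\<phi> z) r" "y2 \<in> ball (\<phi> z) r"
  shows "ext_dist (inv_into U \<phi> y1) (inv_into U \<phi> y2) \<le> ennreal (b * norm (y2 - y1))"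
proof -
  let ?h = "\<lambda>t::real. y1 + t *\<^sub>R (y2 - y1)"
  let ?\<gamma> = "\<lambda>t. inv_into U \<phi> (?h t)"
  define J where "J = ?h -` ball (\<phi> z) r"
  have J: "open J" unfolding J_def by (intro open_vimage continuous_intros) auto
  have J01: "{0..1} \<subseteq> J"
  proof
    fix t :: real assume "t \<in> {0..1}"
    then have "(1 - t) *\<^sub>R y1 + t *\<^sub>R y2 \<in> ball (\<phi> z) r" by (intro convexD_alt[OF convex_ball y]) auto
    moreover have "(1 - t) *\<^sub>R y1 + t *\<^sub>R y2 = ?h t" by (simp add: algebra_simps)
    ultimately show "t \<in> J" by (simp add: J_def)
  qed
  have hU: "?h t \<in> \<phi> ` U" if "t \<in> J" for t using that good(6) by (auto simp: J_def)
  have sm: "smooth_curve_on M {0..1} ?\<gamma>"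
  proof (rule smooth_curve_onI)
    fix t :: real assume "t \<in> {0..1}"
    then show "\<exists>U' \<phi>' J h. (U', \<phi>') \<in> atlas M \<and> open J \<and> t \<in> J \<and> smooth_on h J \<and>
        (\<forall>s\<in>{0..1} \<inter> J. ?\<gamma> s \<in> U' \<and> h s = \<phi>' (?\<gamma> s))"
      using good(1) J J01 smooth_on_line[of y1 "y2 - y1" J] hU chart_inv2[OF good(1)]
      by (intro exI[of _ U] exI[of _ \<phi>] exI[of _ J] exI[of _ ?h]) auto
  qed
  have p: "pws ?\<gamma> 0 1" by (rule pws.smooth[OF _ sm]) simp
  have sp: "speed M ?\<gamma> t \<le> b * norm (y2 - y1)" if t: "t \<in> {0<..<1}" for t
  proof -
    have reg: "regular_at ?\<gamma> t" using smooth_curve_on_interior(1)[OF sm t] .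
    have tJ: "t \<in> J" using t J01 by auto
    have gU: "?\<gamma> t \<in> U" using chart_inv2(2)[OF good(1) hU[OF tJ]] .
    have "((\<phi> \<circ> ?\<gamma>) has_vector_derivative (y2 - y1)) (at t)"
    proof (rule has_vector_derivative_transform_within_open[OF _ J tJ])
      show "(?h has_vector_derivative (y2 - y1)) (at t)" by (auto intro!: derivative_eq_intros)
      show "?h s = (\<phi> \<circ> ?\<gamma>) s" if "s \<in> J" for s using chart_inv2(1)[OF good(1) hU[OF that]] by simp
    qed
    then have w: "vector_derivative (\<phi> \<circ> ?\<gamma>) (at t) = y2 - y1" by (rule vector_derivative_at)
    have "?h t \<in> cball (\<phi> z) r" using tJ by (auto simp: J_def)
    then show ?thesis unfolding regular_at_speed[OF reg good(1) gU] w by (rule good_upper)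
  qed
  have "ext_dist (?\<gamma> 0) (?\<gamma> 1) \<le> path_len ?\<gamma> 0 1" by (rule ed_le[OF p refl refl])
  also have "\<dots> \<le> (\<integral>\<^sup>+t\<in>{0..1::real}. ennreal (b * norm (y2 - y1)) \<partial>lborel)"
    unfolding path_len_def
  proof (rule nn_integral_mono_AE)
    show "AE t in lborel. ennreal (speed M ?\<gamma> t) * indicator {0..1} t \<le> ennreal (b * norm (y2 - y1)) * indicator {0..1} t"
      using AE_not_in_finite[of "{0, 1}", OF finite.insertI[OF finite.insertI[OF finite.emptyI]]]
    proof eventually_elim
      case (elim t)
      then show ?case using sp[of t] by (auto simp: indicator_def intro!: ennreal_leI)
    qed
  qed
  also have "\<dots> = ennreal (b * norm (y2 - y1))" by (subst nn_integral_cmult_indicator) auto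
  finally show ?thesis by simp
qed

text \<open>The displacement in coordinates is the integral of a velocity whose norm is at most the
  speed divided by a. Derivatives are controlled only inside a smooth piece, so the estimate is made
  on smaller intervals and reaches the ends by continuity.\<close>

lemma len_lower:
  assumes "pws \<gamma> c e" "\<And>t. t \<in> {c..e} \<Longrightarrow> \<gamma> t \<in> chart_ball U \<phi> z r"
  shows "ennreal (a * norm (\<phi> (\<gamma> e) - \<phi> (\<gamma> c))) \<le> path_len \<gamma> c e"
  using assms
proof (induction rule: pws.induct)
  case (smooth c e)
  show ?case
  proof (cases "path_len \<gamma> c e")
    case (real l)
    have inU: "\<gamma> t \<in> U" "\<phi> (\<gamma> t) \<in> cball (\<phi> z) r" "inv_into U \<phi> (\<phi> (\<gamma> t)) = \<gamma> t" if "t \<in> {c..e}" for t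
      using smooth.prems[OF that] chart_inv[OF good(1)] by (auto simp: chart_ball_def)
    note int = smooth_curve_on_interior[OF smooth(2)]
    let ?w = "\<lambda>t. vector_derivative (\<phi> \<circ> \<gamma>) (at t)"
    have bound: "a * norm (\<phi> (\<gamma> e') - \<phi> (\<gamma> c')) \<le> l" if ce: "c < c'" "c' < e'" "e' < e" for c' e'
    proof -
      have vd: "((\<phi> \<circ> \<gamma>) has_vector_derivative ?w t) (at t)" if "t \<in> {c'..e'}" for t
        using regular_at_differentiable[OF int(1) good(1) inU(1)] that ce by (auto simp: vector_derivative_works)
      have "(?w has_integral ((\<phi> \<circ> \<gamma>) e' - (\<phi> \<circ> \<gamma>) c')) {c'..e'}"
      proof (rule fundamental_theorem_of_calculus)
        show "((\<phi> \<circ> \<gamma>) has_vector_derivative ?w t) (at t within {c'..e'})" if "t \<in> {c'..e'}" for t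
          by (rule has_vector_derivative_at_within[OF vd[OF that]])
      qed (use ce in simp)
      then have I: "?w integrable_on {c'..e'}" "integral {c'..e'} ?w = \<phi> (\<gamma> e') - \<phi> (\<gamma> c')"
        by (auto simp: has_integral_integrable integral_unique)
      have "continuous_on {c'..e'} (speed M \<gamma>)"
        by (rule continuous_at_imp_continuous_on) (use int(2) ce in auto)
      then have S: "speed M \<gamma> integrable_on {c'..e'}" by (rule integrable_continuous_interval)
      have "norm (integral {c'..e'} ?w) \<le> integral {c'..e'} (\<lambda>t. speed M \<gamma> t / a)"
      proof (rule integral_norm_bound_integral[OF I(1)])
        show "(\<lambda>t. speed M \<gamma> t / a) integrable_on {c'..e'}" using S by (simp add: divide_inverse integrable_on_mult_left)
        fix t assume t: "t \<in> {c'..e'}"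
        have "a * norm (?w t) \<le> speed M \<gamma> t"
          using regular_at_speed[OF int(1) good(1) inU(1)] good_lower[OF inU(2), of t "?w t"] inU(3)[of t] t ce by auto
        then show "norm (?w t) \<le> speed M \<gamma> t / a" using good(4) by (simp add: field_simps)
      qed
      also have "\<dots> = integral {c'..e'} (speed M \<gamma>) / a" by simp
      finally have "a * norm (\<phi> (\<gamma> e') - \<phi> (\<gamma> c')) \<le> integral {c'..e'} (speed M \<gamma>)"
        using good(4) by (simp add: I(2) field_simps)
      moreover have "ennreal (integral {c'..e'} (speed M \<gamma>)) \<le> ennreal l"
      proof -
        have "0 \<le> speed M \<gamma> t" if "t \<in> {c'..e'}" for t using speed_nonneg[OF int(1)] that ce by auto
        then have "ennreal (integral {c'..e'} (speed M \<gamma>)) = path_len \<gamma> c' e'"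
          unfolding path_len_def using nn_integral_has_integral_lebesgue'[OF _ integrable_integral[OF S]] by simp
        also have "\<dots> \<le> path_len \<gamma> c e" by (rule len_mono) (use ce in auto)
        finally show ?thesis using real by simp
      qed
      ultimately show ?thesis using real(1) ennreal_le_iff order_trans by blast
    qed
    \<comment> \<open>At most a third of the length, so that \<open>c + u n < e - u n\<close> for
      every n, also for the first.\<close>
    define u where "u = (\<lambda>n::nat. (e - c) / (real n + 3))"
    have u: "0 < u n" "u n \<le> (e - c) / 3" for n
    proof -
      show "0 < u n" using smooth(1) by (simp add: u_def)
      show "u n \<le> (e - c) / 3" unfolding u_def using smooth(1) by (intro divide_left_mono) auto
    qed
    have "u \<longlonglongrightarrow> 0" unfolding u_def by real_asymp
    then have lim: "(\<lambda>n. c + u n) \<longlonglongrightarrow> c" "(\<lambda>n. e - u n) \<longlonglongrightarrow> e"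
      using tendsto_add[OF tendsto_const, of u 0 sequentially c] tendsto_diff[OF tendsto_const, of u 0 sequentially e] by auto
    have cont: "continuous_on {c..e} (\<lambda>t. \<phi> (\<gamma> t))"
      by (rule continuous_on_compose2[OF chart_cont(1)[OF good(1)] smooth_curve_on_continuous[OF smooth(2)]]) (use inU in auto)
    have in': "c + u n \<in> {c..e}" "e - u n \<in> {c..e}" for n using u[of n] smooth(1) by auto
    have "(\<lambda>n. a * norm (\<phi> (\<gamma> (e - u n)) - \<phi> (\<gamma> (c + u n)))) \<longlonglongrightarrow> a * norm (\<phi> (\<gamma> e) - \<phi> (\<gamma> c))"
      using smooth(1) in'
      by (intro tendsto_intros continuous_on_tendsto_compose[OF cont lim(2)] continuous_on_tendsto_compose[OF cont lim(1)]) auto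
    then have "a * norm (\<phi> (\<gamma> e) - \<phi> (\<gamma> c)) \<le> l"
    proof (rule LIMSEQ_le_const2)
      have "a * norm (\<phi> (\<gamma> (e - u n)) - \<phi> (\<gamma> (c + u n))) \<le> l" for n
      proof (rule bound)
        have 3: "3 * u n \<le> e - c" using u(2)[of n] by simp
        show "c + u n < e - u n" using 3 u(1)[of n] by linarith
      qed (use u(1)[of n] in simp_all)
      then show "\<exists>N. \<forall>n\<ge>N. a * norm (\<phi> (\<gamma> (e - u n)) - \<phi> (\<gamma> (c + u n))) \<le> l" by blast
    qed
    then show ?thesis using real by (simp add: ennreal_leI)
  qed simp
next
  case (trans c m e)
  note lt = pws_less[OF trans.hyps(1)] pws_less[OF trans.hyps(2)]
  have "a * norm (\<phi> (\<gamma> e) - \<phi> (\<gamma> c)) \<le> a * norm (\<phi> (\<gamma> m) - \<phi> (\<gamma> c)) + a * norm (\<phi> (\<gamma> e) - \<phi> (\<gamma> m))"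
    using good(4) norm_triangle_ineq[of "\<phi> (\<gamma> m) - \<phi> (\<gamma> c)" "\<phi> (\<gamma> e) - \<phi> (\<gamma> m)"]
    by (simp flip: distrib_left)
  then have "ennreal (a * norm (\<phi> (\<gamma> e) - \<phi> (\<gamma> c)))
      \<le> ennreal (a * norm (\<phi> (\<gamma> m) - \<phi> (\<gamma> c))) + ennreal (a * norm (\<phi> (\<gamma> e) - \<phi> (\<gamma> m)))"
    using good(4) by (simp add: ennreal_leI flip: ennreal_plus)
  also have "\<dots> \<le> path_len \<gamma> c m + path_len \<gamma> m e"
    using lt trans.prems by (intro add_mono trans.IH) auto
  also have "\<dots> = path_len \<gamma> c e" using len_add[OF pws.trans[OF trans.hyps(1,2)], of m] lt by simp
  finally show ?case .
qed

text \<open>Before leaving the chart ball of radius s a path has to reach every coordinate distance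
  s' < s, which costs at least a * s'.\<close>

lemma ed_lower:
  assumes y: "y \<notin> chart_ball U \<phi> z s" and s: "0 < s" "s \<le> r"
  shows "ennreal (a * s) \<le> ext_dist z y"
  unfolding ext_dist_def
proof (rule INF_greatest)
  fix \<gamma> assume "\<gamma> \<in> {\<gamma>. pws \<gamma> 0 1 \<and> \<gamma> 0 = z \<and> \<gamma> 1 = y}"
  then have \<gamma>: "pws \<gamma> 0 1" "\<gamma> 0 = z" "\<gamma> 1 = y" by auto
  have cont: "continuous_on {0..1} \<gamma>" using pws_continuous[OF \<gamma>(1)] .
  let ?Z = "{0..1} \<inter> \<gamma> -` (- chart_ball U \<phi> z s)"
  have cl: "closed ?Z" by (rule continuous_closed_preimage[OF cont]) (use open_cb in auto)
  have one: "1 \<in> ?Z" using \<gamma>(3) y by simp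
  have bdd: "bdd_below ?Z" by (rule bdd_belowI[of _ 0]) auto
  have T: "Inf ?Z \<in> ?Z" by (rule closed_contains_Inf[OF _ bdd cl]) (use one in blast)
  define T where "T = Inf ?Z"
  have T01: "T \<in> {0..1}" "\<gamma> T \<notin> chart_ball U \<phi> z s" using T by (auto simp: T_def)
  have "T \<noteq> 0" using T01 \<gamma>(2) z_in_cb[OF s(1)] by auto
  then have T0: "0 < T" using T01 by auto
  have before: "\<gamma> t \<in> chart_ball U \<phi> z s" if "0 \<le> t" "t < T" for t
  proof (rule ccontr)
    assume "\<gamma> t \<notin> chart_ball U \<phi> z s"
    then have "t \<in> ?Z" using that T01 by auto
    then have "T \<le> t" unfolding T_def by (rule cInf_lower[OF _ bdd])
    then show False using that by simp
  qed
  show "ennreal (a * s) \<le> path_len \<gamma> 0 1"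
  proof (cases "path_len \<gamma> 0 1")
    case (real l)
    have "a * s' \<le> l" if s': "0 < s'" "s' < s" for s'
    proof -
      \<comment> \<open>The exit point itself may lie outside U, where \<phi> says nothing. If all
        earlier points had coordinate distance below s', the exit point would belong to the compact,
        hence closed, preimage of the ball of radius s' and so would still be in the chart
        ball.\<close>
      have "\<exists>t\<in>{0<..<T}. s' \<le> dist (\<phi> z) (\<phi> (\<gamma> t))"
      proof (rule ccontr)
        assume "\<not> ?thesis"
        then have small: "\<And>t. t \<in> {0<..<T} \<Longrightarrow> dist (\<phi> z) (\<phi> (\<gamma> t)) < s'" by (auto simp: not_le)
        have "cball (\<phi> z) s' \<subseteq> cball (\<phi> z) r" using s s' by (intro subset_cball) auto
        then have "continuous_on (cball (\<phi> z) s') (inv_into U \<phi>)"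
          using good(6) by (intro continuous_on_subset[OF chart_cont(2)[OF good(1)]]) auto
        then have "compact (inv_into U \<phi> ` cball (\<phi> z) s')"
          by (intro compact_continuous_image compact_cball)
        then have cl: "closed (inv_into U \<phi> ` cball (\<phi> z) s')" by (rule compact_imp_closed)
        have "\<gamma> ` {0<..<T} \<subseteq> inv_into U \<phi> ` cball (\<phi> z) s'"
        proof
          fix x assume "x \<in> \<gamma> ` {0<..<T}"
          then obtain t where t: "t \<in> {0<..<T}" "x = \<gamma> t" by blast
          then have "\<gamma> t \<in> U" using before[of t] by (auto simp: chart_ball_def)
          then have "x = inv_into U \<phi> (\<phi> (\<gamma> t))" using chart_inv[OF good(1)] t by simp
          then show "x \<in> inv_into U \<phi> ` cball (\<phi> z) s'" using small[OF t(1)] by auto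
        qed
        moreover have "continuous_on (closure {0<..<T}) \<gamma>"
          by (rule continuous_on_subset[OF cont]) (use T0 T01 in auto)
        ultimately have "\<gamma> ` closure {0<..<T} \<subseteq> inv_into U \<phi> ` cball (\<phi> z) s'"
          using cl by (intro image_closure_subset)
        moreover have "T \<in> closure {0<..<T}" using T0 by simp
        ultimately obtain y' where "\<gamma> T = inv_into U \<phi> y'" "y' \<in> cball (\<phi> z) s'" by blast
        then have "\<gamma> T \<in> chart_ball U \<phi> z s"
          unfolding cb_eq_image[OF s(2)] using s' by auto
        then show False using T01 by simp
      qed
      then obtain t where t: "0 < t" "t < T" "s' \<le> dist (\<phi> z) (\<phi> (\<gamma> t))" by auto
      have "ennreal (a * norm (\<phi> (\<gamma> t) - \<phi> (\<gamma> 0))) \<le> path_len \<gamma> 0 t"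
      proof (rule len_lower)
        show "pws \<gamma> 0 t" by (rule pws_sub[OF \<gamma>(1)]) (use t T01 in auto)
        show "\<gamma> u \<in> chart_ball U \<phi> z r" if "u \<in> {0..t}" for u
          using before[of u] that t s by (auto simp: chart_ball_def)
      qed
      also have "\<dots> \<le> path_len \<gamma> 0 1" by (rule len_mono) (use t T01 in auto)
      finally have "a * norm (\<phi> (\<gamma> t) - \<phi> (\<gamma> 0)) \<le> l" using real by (simp add: ennreal_le_iff)
      moreover have "a * s' \<le> a * norm (\<phi> (\<gamma> t) - \<phi> (\<gamma> 0))"
        using t(3) good(4) \<gamma>(2) by (intro mult_left_mono) (auto simp: dist_norm norm_minus_commute)
      ultimately show ?thesis by linarith
    qed
    then have "a * s \<le> l"
      using good(4) s(1) dense_ge_bounded[of 0 s]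
      by (metis dense_le_bounded[of 0 s "l / a"] mult.commute pos_le_divide_eq)
    then show ?thesis using real by (simp add: ennreal_leI)
  qed simp
qed

end

end

section \<open>The geodesic distance as a metric on a connected manifold\<close>

locale riem_conn = riem M for M :: "('a::{t2_space, second_countable_topology}, 'n::finite) riemannian" +
  assumes conn: "connected (UNIV :: 'a set)"
begin

abbreviation gd :: "'a \<Rightarrow> 'a \<Rightarrow> real" where "gd \<equiv> geodesic_dist M"

lemma good_chart_ex: obtains U \<phi> r a b where "good_chart z U \<phi> r a b"
  using atlas_cover[of z] good_chart_exists by metis

lemma ed_locally_finite: "\<exists>N. open N \<and> y \<in> N \<and> (\<forall>x\<in>N. ext_dist y x < top)"
proof -
  obtain U \<phi> r a b where g: "good_chart y U \<phi> r a b" by (rule good_chart_ex)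
  note gd = good[OF g]
  have "ext_dist y x < top" if "x \<in> chart_ball U \<phi> y r" for x
  proof -
    have "ext_dist (inv_into U \<phi> (\<phi> y)) (inv_into U \<phi> (\<phi> x)) \<le> ennreal (b * norm (\<phi> x - \<phi> y))"
      by (rule ed_upper[OF g]) (use that gd(3) in \<open>auto simp: chart_ball_def\<close>)
    then have "ext_dist y x \<le> ennreal (b * norm (\<phi> x - \<phi> y))"
      using chart_inv[OF gd(1)] gd(2) that by (simp add: chart_ball_def)
    then show ?thesis by (rule le_less_trans) simp
  qed
  then show ?thesis using open_cb[OF g, of r] z_in_cb[OF g gd(3)] by blast
qed

text \<open>Every point has a neighbourhood at finite distance from it, so the points at finite
  distance from x form an open set, and so do those at infinite distance; connectedness leaves none
  of the latter.\<close>

lemma ed_finite: "ext_dist x y < top"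
proof -
  let ?S = "{y. ext_dist x y < top}"
  have "open ?S"
  proof (subst open_subopen, intro ballI)
    fix y assume y: "y \<in> ?S"
    obtain N where N: "open N" "y \<in> N" "\<forall>x\<in>N. ext_dist y x < top" using ed_locally_finite by blast
    have "N \<subseteq> ?S"
    proof
      fix u assume "u \<in> N"
      then have "ext_dist x y + ext_dist y u < top" using N y by simp
      then show "u \<in> ?S" using ed_triangle[of x u y] by (auto intro: le_less_trans)
    qed
    then show "\<exists>T. open T \<and> y \<in> T \<and> T \<subseteq> ?S" using N by blast
  qed
  moreover have "open (- ?S)"
  proof (subst open_subopen, intro ballI)
    fix y assume y: "y \<in> - ?S"
    obtain N where N: "open N" "y \<in> N" "\<forall>x\<in>N. ext_dist y x < top" using ed_locally_finite by blast
    have "N \<subseteq> - ?S"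
    proof
      fix u assume u: "u \<in> N"
      show "u \<in> - ?S"
      proof
        assume "u \<in> ?S"
        then have "ext_dist x u + ext_dist u y < top" using N u ed_sym[of u y] by simp
        then show False using ed_triangle[of x y u] y by (auto simp: not_less top_unique)
      qed
    qed
    then show "\<exists>T. open T \<and> y \<in> T \<and> T \<subseteq> - ?S" using N by blast
  qed
  moreover have "x \<in> ?S" using ed_locally_finite[of x] by blast
  ultimately have "- ?S = {}" using connectedD[OF conn, of ?S "- ?S"] by auto
  then show ?thesis by blast
qed

lemma ed_eq: "ext_dist x y = ennreal (gd x y)"
  unfolding geodesic_dist_eq using ed_finite[of x y] by simp

lemma gd_nonneg: "0 \<le> gd x y" by (simp add: geodesic_dist_eq)

context
  fixes z U \<phi> r a b
  assumes g: "good_chart z U \<phi> r a b"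
begin

lemma gd_ball_subset_cb:
  assumes "0 < s" "s \<le> r" "gd z x < a * s" shows "x \<in> chart_ball U \<phi> z s"
proof (rule ccontr)
  assume "x \<notin> chart_ball U \<phi> z s"
  then have "a * s \<le> gd z x" using ed_lower[OF g _ assms(1,2)] by (simp add: ed_eq ennreal_le_iff gd_nonneg)
  then show False using assms by simp
qed

lemma cb_subset_gd_ball:
  assumes "s \<le> r" "x \<in> chart_ball U \<phi> z s" shows "gd z x < b * s"
proof -
  note gd = good[OF g]
  have "ext_dist (inv_into U \<phi> (\<phi> z)) (inv_into U \<phi> (\<phi> x)) \<le> ennreal (b * norm (\<phi> x - \<phi> z))"
    by (rule ed_upper[OF g]) (use assms gd(3) in \<open>auto simp: chart_ball_def\<close>)
  then have "gd z x \<le> b * norm (\<phi> x - \<phi> z)"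
    using chart_inv[OF gd(1)] gd(2,5) assms by (simp add: chart_ball_def ed_eq ennreal_le_iff)
  also have "\<dots> < b * s" using gd(5) assms by (intro mult_strict_left_mono) (auto simp: chart_ball_def dist_norm norm_minus_commute)
  finally show ?thesis .
qed

end

text \<open>A point y other than x in the chart has a positive coordinate distance s from x. At
  geodesic distance 0 it would lie in the open chart ball of radius s around x.\<close>

lemma gd_zero: "gd x y = 0 \<longleftrightarrow> x = y"
proof
  assume 0: "gd x y = 0"
  show "x = y"
  proof (rule ccontr)
    assume ne: "x \<noteq> y"
    obtain U \<phi> r a b where g: "good_chart x U \<phi> r a b" by (rule good_chart_ex)
    note gd = good[OF g]
    have yr: "y \<in> chart_ball U \<phi> x r" by (rule gd_ball_subset_cb[OF g gd(3)]) (use 0 gd in auto)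
    define s where "s = dist (\<phi> x) (\<phi> y)"
    have "y \<in> U" using yr by (simp add: chart_ball_def)
    have "\<phi> x \<noteq> \<phi> y"
    proof
      assume "\<phi> x = \<phi> y"
      then have "inv_into U \<phi> (\<phi> x) = inv_into U \<phi> (\<phi> y)" by simp
      then show False using chart_inv[OF gd(1,2)] chart_inv[OF gd(1) \<open>y \<in> U\<close>] ne by simp
    qed
    then have s: "0 < s" "s \<le> r" using yr by (auto simp: s_def chart_ball_def)
    have "y \<in> chart_ball U \<phi> x s" by (rule gd_ball_subset_cb[OF g s]) (use 0 s gd in auto)
    then show False by (simp add: chart_ball_def s_def)
  qed
next
  assume xy: "x = y"
  obtain U \<phi> r a b where g: "good_chart x U \<phi> r a b" by (rule good_chart_ex)
  note gd = good[OF g]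
  have "ext_dist (inv_into U \<phi> (\<phi> x)) (inv_into U \<phi> (\<phi> x)) \<le> ennreal (b * norm (\<phi> x - \<phi> x))"
    by (rule ed_upper[OF g]) (use gd(3) in auto)
  then show "gd x y = 0" using chart_inv[OF gd(1) gd(2)] xy by (simp add: ed_eq gd_nonneg)
qed

lemma Metric_space_gd: "Metric_space UNIV gd"
proof
  show "gd x y = gd y x" for x y by (simp add: geodesic_dist_eq ed_sym)
  show "gd x z \<le> gd x y + gd y z" for x y z
  proof -
    have "ennreal (gd x z) \<le> ennreal (gd x y) + ennreal (gd y z)"
      using ed_triangle[of x z y] by (simp only: ed_eq)
    also have "\<dots> = ennreal (gd x y + gd y z)" by (simp only: ennreal_plus gd_nonneg)
    finally show ?thesis by (simp only: ennreal_le_iff add_nonneg_nonneg gd_nonneg)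
  qed
qed (auto simp: gd_nonneg gd_zero)

lemma open_iff_gd: "open W \<longleftrightarrow> (\<forall>x\<in>W. \<exists>\<rho>>0. \<forall>y. gd x y < \<rho> \<longrightarrow> y \<in> W)"
proof
  assume W: "open W"
  show "\<forall>x\<in>W. \<exists>\<rho>>0. \<forall>y. gd x y < \<rho> \<longrightarrow> y \<in> W"
  proof
    fix x assume x: "x \<in> W"
    obtain U \<phi> r a b where g: "good_chart x U \<phi> r a b" by (rule good_chart_ex)
    note gd = good[OF g]
    have "open (\<phi> ` U \<inter> inv_into U \<phi> -` W)"
      by (rule continuous_open_preimage[OF chart_cont(2)[OF gd(1)] chart_open(2)[OF gd(1)] W])
    moreover have "\<phi> x \<in> \<phi> ` U \<inter> inv_into U \<phi> -` W" using gd(2) chart_inv[OF gd(1,2)] x by auto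
    ultimately obtain s where s: "0 < s" "ball (\<phi> x) s \<subseteq> \<phi> ` U \<inter> inv_into U \<phi> -` W"
      by (meson open_contains_ball)
    let ?s = "min s r"
    have "y \<in> W" if "gd x y < a * ?s" for y
    proof -
      have "y \<in> chart_ball U \<phi> x ?s" by (rule gd_ball_subset_cb[OF g _ _ that]) (use s gd in auto)
      then have "y \<in> U" "\<phi> y \<in> ball (\<phi> x) s" by (auto simp: chart_ball_def)
      then show ?thesis using s(2) chart_inv[OF gd(1), of y] by auto
    qed
    then show "\<exists>\<rho>>0. \<forall>y. gd x y < \<rho> \<longrightarrow> y \<in> W"
      using s gd by (intro exI[of _ "a * ?s"]) auto
  qed
next
  assume H: "\<forall>x\<in>W. \<exists>\<rho>>0. \<forall>y. gd x y < \<rho> \<longrightarrow> y \<in> W"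
  show "open W"
  proof (subst open_subopen, intro ballI)
    fix x assume "x \<in> W"
    then obtain \<rho> where \<rho>: "\<rho> > 0" "\<forall>y. gd x y < \<rho> \<longrightarrow> y \<in> W" using H by blast
    obtain U \<phi> r a b where g: "good_chart x U \<phi> r a b" by (rule good_chart_ex)
    note gd = good[OF g]
    let ?s = "min r (\<rho> / b)"
    have "chart_ball U \<phi> x ?s \<subseteq> W"
    proof
      fix y assume "y \<in> chart_ball U \<phi> x ?s"
      then have "gd x y < b * ?s" by (intro cb_subset_gd_ball[OF g]) auto
      also have "b * ?s \<le> b * (\<rho> / b)" using gd(5) by (intro mult_left_mono) auto
      also have "\<dots> = \<rho>" using gd(5) by simp
      finally show "y \<in> W" using \<rho> by blast
    qed
    then show "\<exists>T. open T \<and> x \<in> T \<and> T \<subseteq> W"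
      using open_cb[OF g, of ?s] z_in_cb[OF g, of ?s] \<rho> gd by (intro exI[of _ "chart_ball U \<phi> x ?s"]) auto
  qed
qed

lemma umetric_gd: "umetric gd"
proof (intro umetric.intro umetric_axioms.intro Metric_space_gd)
  interpret Metric_space UNIV gd by (rule Metric_space_gd)
  have "openin mtopology W \<longleftrightarrow> openin euclidean W" for W
    unfolding openin_mtopology open_openin[symmetric] open_iff_gd by (simp add: subset_eq Ball_def)
  then show "mtopology = euclidean" by (simp add: topology_eq)
qed

sublocale umetric gd by (rule umetric_gd)

text \<open>Links the two notions of length: each chord is at most the Riemannian length of its
  piece. Almost minimal piecewise smooth paths are therefore almost shortest for the metric as
  well.\<close>

lemma curve_length_le_len:
  assumes \<gamma>: "pws \<gamma> 0 1" shows "curve_length gd \<gamma> 0 1 \<le> path_len \<gamma> 0 1"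
proof (rule curve_length_leI)
  fix k and t :: "nat \<Rightarrow> real" assume t: "\<And>i. i \<le> k \<Longrightarrow> t i \<in> {0..1}" "\<And>i. i < k \<Longrightarrow> t i \<le> t (Suc i)"
  have "(\<Sum>i<j. ennreal (gd (\<gamma> (t i)) (\<gamma> (t (Suc i))))) \<le> path_len \<gamma> 0 (t j)" if "j \<le> k" for j
    using that
  proof (induction j)
    case (Suc j)
    then have IH: "(\<Sum>i<j. ennreal (gd (\<gamma> (t i)) (\<gamma> (t (Suc i))))) \<le> path_len \<gamma> 0 (t j)" and tj: "t j \<le> t (Suc j)"
      "t j \<in> {0..1}" "t (Suc j) \<in> {0..1}"
      using t(2)[of j] t(1)[of j] t(1)[of "Suc j"] by auto
    show ?case
    proof (cases "t j = t (Suc j)")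
      case True
      then show ?thesis using IH by (simp add: gd_zero)
    next
      case False
      then have lt: "t j < t (Suc j)" using tj by simp
      have p: "pws \<gamma> (t j) (t (Suc j))" "pws \<gamma> 0 (t (Suc j))"
        by (rule pws_sub[OF \<gamma>]; use lt tj in simp)+
      have "(\<Sum>i<Suc j. ennreal (gd (\<gamma> (t i)) (\<gamma> (t (Suc i))))) \<le> path_len \<gamma> 0 (t j) + path_len \<gamma> (t j) (t (Suc j))"
        using IH ed_le[OF p(1) refl refl] by (simp add: ed_eq add_mono)
      also have "\<dots> = path_len \<gamma> 0 (t (Suc j))" using len_add[OF p(2), of "t j"] tj by simp
      finally show ?thesis .
    qed
  qed simp
  from this[of k] have "(\<Sum>i<k. ennreal (gd (\<gamma> (t i)) (\<gamma> (t (Suc i))))) \<le> path_len \<gamma> 0 (t k)" by simp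
  also have "\<dots> \<le> path_len \<gamma> 0 1" by (rule len_mono) (use t(1)[of k] in auto)
  finally show "(\<Sum>i<k. ennreal (gd (\<gamma> (t i)) (\<gamma> (t (Suc i))))) \<le> path_len \<gamma> 0 1" .
qed

lemma length_space:
  assumes "e > 0" shows "\<exists>\<gamma>. rectifiable gd \<gamma> \<and> \<gamma> 0 = x \<and> \<gamma> 1 = y \<and> arc_len \<gamma> 1 \<le> gd x y + e"
proof -
  have "ext_dist x y < ennreal (gd x y + e)" unfolding ed_eq using assms gd_nonneg by (intro ennreal_lessI) (auto intro: add_nonneg_pos)
  then obtain \<gamma> where \<gamma>: "pws \<gamma> 0 1" "\<gamma> 0 = x" "\<gamma> 1 = y" "path_len \<gamma> 0 1 < ennreal (gd x y + e)"
    unfolding ext_dist_def by (auto simp: INF_less_iff)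
  have le: "curve_length gd \<gamma> 0 1 \<le> ennreal (gd x y + e)"
    using curve_length_le_len[OF \<gamma>(1)] \<gamma>(4) by simp
  then have "rectifiable gd \<gamma>"
    using pws_continuous[OF \<gamma>(1)] by (auto simp: rectifiable_iff path_def intro: le_less_trans)
  moreover have "arc_len \<gamma> 1 \<le> gd x y + e"
    unfolding arc_len_def using le gd_nonneg[of x y] assms by (intro enn2real_leI) auto
  ultimately show ?thesis using \<gamma> by blast
qed

text \<open>A path from z of length less than \<rho> stays within distance \<rho> of z. One whose
  length exceeds the distance of x by at most half of the remaining margin is short enough.\<close>

lemma connected_joining_set:
  assumes "gd z x < \<rho>"
  obtains K where "compact K" "connected K" "z \<in> K" "x \<in> K" "\<And>y. y \<in> K \<Longrightarrow> gd z y < \<rho>"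
proof -
  obtain \<gamma> where \<gamma>: "rectifiable gd \<gamma>" "\<gamma> 0 = z" "\<gamma> 1 = x" "arc_len \<gamma> 1 \<le> gd z x + (\<rho> - gd z x) / 2"
    using length_space[of "(\<rho> - gd z x) / 2"] assms by auto
  have cont: "continuous_on {0..1} \<gamma>" using \<gamma>(1) by (simp add: rectifiable_iff path_def)
  show ?thesis
  proof (rule that[of "\<gamma> ` {0..1}"])
    show "compact (\<gamma> ` {0..1})" "connected (\<gamma> ` {0..1})"
      using cont by (auto intro: compact_continuous_image connected_continuous_image)
    show "gd z y < \<rho>" if "y \<in> \<gamma> ` {0..1}" for y
    proof -
      obtain t where t: "t \<in> {0..1}" "y = \<gamma> t" using \<open>y \<in> \<gamma> ` {0..1}\<close> by blast
      have "gd z y \<le> arc_len \<gamma> t" using dist_le_arc[OF \<gamma>(1), of 0 t] t \<gamma>(2) by simp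
      also have "\<dots> \<le> arc_len \<gamma> 1" using arc_mono[OF \<gamma>(1), of t 1] t by simp
      finally have "gd z y \<le> gd z x + (\<rho> - gd z x) / 2" using \<gamma>(4) by linarith
      then show ?thesis using assms by (simp add: field_simps)
    qed
  qed (use \<gamma> in auto)
qed

text \<open>The source need not be proper; but a small closed geodesic ball is a closed subset of
  the preimage of a compact coordinate ball.\<close>

lemma small_balls_compact: "\<exists>\<rho>0>0. \<forall>\<rho>\<le>\<rho>0. compact (mcball z \<rho>)"
proof -
  obtain U \<phi> r a b where g: "good_chart z U \<phi> r a b" by (rule good_chart_ex)
  note gd = good[OF g]
  have "compact (mcball z \<rho>)" if \<rho>: "\<rho> \<le> a * r / 4" for \<rho>
  proof -
    let ?K = "inv_into U \<phi> ` cball (\<phi> z) (r / 2)"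
    have sub: "cball (\<phi> z) (r / 2) \<subseteq> \<phi> ` U" using gd(3,6) subset_cball[of "r/2" r "\<phi> z"] by auto
    have K: "compact ?K"
      by (intro compact_continuous_image compact_cball continuous_on_subset[OF chart_cont(2)[OF gd(1)] sub])
    have "mcball z \<rho> \<subseteq> ?K"
    proof
      fix x assume "x \<in> mcball z \<rho>"
      then have "gd z x \<le> \<rho>" by simp
      moreover have "0 < a * r" using gd(3,4) by simp
      ultimately have "gd z x < a * r / 2" using \<rho> by linarith
      then have "gd z x < a * (r / 2)" by simp
      then have "x \<in> chart_ball U \<phi> z (r / 2)" using gd(3) by (intro gd_ball_subset_cb[OF g]) auto
      moreover have "r / 2 \<le> r" using gd(3) by simp
      ultimately show "x \<in> ?K" using cb_eq_image[OF g, of "r / 2"] by auto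
    qed
    then have "mcball z \<rho> = ?K \<inter> mcball z \<rho>" by blast
    then show ?thesis using compact_Int_closed[OF K closed_mcball[of z \<rho>]] by simp
  qed
  then show ?thesis using gd by (intro exI[of _ "a * r / 4"]) auto
qed

text \<open>A geodesic ball of radius s lies between the chart balls of radii s / b and s / a, and
  the density of the volume is between two positive constants on the compact coordinate
  ball.\<close>

lemma volume_small_balls:
  assumes v: "is_volume_measure M v"
  shows "\<exists>c1>0. \<exists>c2>0. \<exists>s0>0. \<forall>s. 0 < s \<and> s \<le> s0 \<longrightarrow>
     ennreal (c1 * s ^ CARD('n)) \<le> emeasure v (mball z s) \<and> emeasure v (mball z s) \<le> ennreal (c2 * s ^ CARD('n))"
proof -
  obtain U \<phi> r a b where g: "good_chart z U \<phi> r a b" by (rule good_chart_ex)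
  note gd = good[OF g]
  let ?D = "\<lambda>y. sqrt (det (gram U \<phi> y))"
  let ?n = "CARD('n)"
  let ?V = "unit_ball_vol (real ?n)"
  have V: "0 < ?V" by simp
  have sets_v: "sets v = sets borel" using v by (simp add: is_volume_measure_def)
  have vol: "emeasure v E = (\<integral>\<^sup>+y\<in>\<phi> ` E. ennreal (?D y) \<partial>lborel)" if "E \<in> sets borel" "E \<subseteq> U" for E
  proof -
    have "\<forall>(U, \<phi>)\<in>atlas M. \<forall>E\<in>sets borel. E \<subseteq> U \<longrightarrow>
        emeasure v E = (\<integral>\<^sup>+y\<in>\<phi> ` E. ennreal (sqrt (det (metric_tensor M (U, \<phi>) (inv_into U \<phi> y)))) \<partial>lborel)"
      using v by (simp add: is_volume_measure_def)
    from bspec[OF this gd(1)] that show ?thesis by simp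
  qed
  have "continuous_on (cball (\<phi> z) r) ?D"
    by (intro continuous_intros continuous_on_det continuous_on_subset[OF metric_cont[OF gd(1)] gd(6)])
  moreover have ne: "cball (\<phi> z) r \<noteq> {}" using gd(3) by auto
  ultimately obtain y0 y1 where y0: "y0 \<in> cball (\<phi> z) r" "\<And>y. y \<in> cball (\<phi> z) r \<Longrightarrow> ?D y0 \<le> ?D y"
    and y1: "y1 \<in> cball (\<phi> z) r" "\<And>y. y \<in> cball (\<phi> z) r \<Longrightarrow> ?D y \<le> ?D y1"
    using continuous_attains_inf[OF compact_cball ne, of ?D] continuous_attains_sup[OF compact_cball ne, of ?D] by metis
  have Dpos: "0 < ?D y" if "y \<in> cball (\<phi> z) r" for y
  proof -
    have "inv_into U \<phi> y \<in> U" using chart_inv2(2)[OF gd(1)] gd(6) that by blast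
    then have "0 < det (gram U \<phi> y)"
      by (intro det_pos_of_positive_definite metric_pos[OF gd(1)])
    then show ?thesis by simp
  qed
  have cb_vol: "emeasure v (chart_ball U \<phi> z s) = (\<integral>\<^sup>+y\<in>ball (\<phi> z) s. ennreal (?D y) \<partial>lborel)" if "s \<le> r" for s
    using vol[of "chart_ball U \<phi> z s"] open_cb[OF g, of s] image_cb[OF g that] by (auto simp: chart_ball_def)
  have ball: "emeasure lborel (ball (\<phi> z) s) = ennreal (?V * s ^ ?n)" if "0 \<le> s" for s
    using emeasure_ball[OF that, of "\<phi> z"] by simp
  have const: "(\<integral>\<^sup>+y\<in>ball (\<phi> z) s. ennreal m \<partial>lborel) = ennreal (m * ?V * s ^ ?n)" if "0 \<le> s" "0 \<le> m" for m s
    using that by (subst nn_integral_cmult_indicator) (auto simp: ball ennreal_mult' mult.assoc)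
  have m_pos: "0 < ?D y0" "0 < ?D y1" using Dpos y0 y1 by auto
  show ?thesis
  proof (intro exI conjI allI impI)
    show "0 < ?D y0 * ?V / b ^ ?n" "0 < ?D y1 * ?V / a ^ ?n" "0 < min (a * r) (b * r)"
      using m_pos V gd by auto
    fix s assume s: "0 < s \<and> s \<le> min (a * r) (b * r)"
    have sb: "0 < s / b" "s / b \<le> r" and sa: "0 < s / a" "s / a \<le> r"
      using s gd by (auto simp: field_simps)
    have "ennreal (?D y0 * ?V / b ^ ?n * s ^ ?n) = (\<integral>\<^sup>+y\<in>ball (\<phi> z) (s / b). ennreal (?D y0) \<partial>lborel)"
      using const[of "s / b" "?D y0"] sb m_pos by (simp add: power_divide)
    also have "\<dots> \<le> (\<integral>\<^sup>+y\<in>ball (\<phi> z) (s / b). ennreal (?D y) \<partial>lborel)"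
      by (rule nn_integral_mono) (use y0(2) sb in \<open>auto simp: indicator_def intro!: ennreal_leI\<close>)
    also have "\<dots> = emeasure v (chart_ball U \<phi> z (s / b))" using cb_vol sb by simp
    also have "\<dots> \<le> emeasure v (mball z s)"
    proof (rule emeasure_mono)
      show "chart_ball U \<phi> z (s / b) \<subseteq> mball z s"
        using cb_subset_gd_ball[OF g sb(2)] gd(5) by auto
    qed (use open_mball[of z s] sets_v in auto)
    finally show "ennreal (?D y0 * ?V / b ^ ?n * s ^ ?n) \<le> emeasure v (mball z s)" .
    have "emeasure v (mball z s) \<le> emeasure v (chart_ball U \<phi> z (s / a))"
    proof (rule emeasure_mono)
      show "mball z s \<subseteq> chart_ball U \<phi> z (s / a)"
        using gd_ball_subset_cb[OF g sa] gd(4) by auto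
    qed (use open_cb[OF g] sets_v in auto)
    also have "\<dots> = (\<integral>\<^sup>+y\<in>ball (\<phi> z) (s / a). ennreal (?D y) \<partial>lborel)" using cb_vol sa by simp
    also have "\<dots> \<le> (\<integral>\<^sup>+y\<in>ball (\<phi> z) (s / a). ennreal (?D y1) \<partial>lborel)"
      by (rule nn_integral_mono) (use y1(2) sa in \<open>auto simp: indicator_def intro!: ennreal_leI\<close>)
    also have "\<dots> = ennreal (?D y1 * ?V / a ^ ?n * s ^ ?n)"
      using const[of "s / a" "?D y1"] sa m_pos by (simp add: power_divide)
    finally show "emeasure v (mball z s) \<le> ennreal (?D y1 * ?V / a ^ ?n * s ^ ?n)" .
  qed
qed

end

section \<open>Growth of the integral of an FMO function\<close>

context riem_conn begin

text \<open>At the radii \<open>R * (1/2) ^ k\<close> the mean of Q grows at most linearly in k,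
  while \<open>r powr (-p)\<close> times the volume of the ball is at most a multiple of
  \<open>q ^ k\<close>, where q < 1 because \<open>p < n\<close>. The product tends to 0.\<close>

lemma FMO_imp_growth:
  fixes Q :: "'a \<Rightarrow> ennreal"
  assumes v: "is_volume_measure M v" and fmo: "FMO gd v G (\<lambda>x. enn2ereal (Q x)) z"
    and r0: "0 < r0" "{x. gd x z < r0} \<subseteq> G" and p: "p < real CARD('n)" and e: "0 < e"
  obtains r where "0 < r" "r < r0"
    "ennreal (r powr (-p)) * (\<integral>\<^sup>+x\<in>mball z r. Q x \<partial>completion v) \<le> ennreal e"
proof -
  define N where "N = completion v"
  define f where "f = (\<lambda>x. enn2real (Q x))"
  define B where "B = (\<lambda>s. {x\<in>G. gd x z < s})"
  let ?n = "CARD('n)"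
  have sets_v: "sets v = sets borel" using v by (simp add: is_volume_measure_def)
  obtain c1 c2 s0 where c: "c1 > 0" "c2 > 0" "s0 > 0"
    and vol: "\<And>s. 0 < s \<Longrightarrow> s \<le> s0 \<Longrightarrow> ennreal (c1 * s ^ ?n) \<le> emeasure v (mball z s) \<and> emeasure v (mball z s) \<le> ennreal (c2 * s ^ ?n)"
    using volume_small_balls[OF v, of z] by blast
  let ?avg = "\<lambda>s h. (LINT x:B s|N. h x) / measure N (B s)"
  have f_alt: "real_of_ereal (enn2ereal (Q x)) = f x" for x unfolding f_def enn2real_def ..
  from fmo have "(\<exists>\<epsilon>>0. (AE x in v. x \<in> B \<epsilon> \<longrightarrow> \<bar>enn2ereal (Q x)\<bar> \<noteq> \<infinity>) \<and> set_integrable N (B \<epsilon>) f) \<and>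
         Limsup (at_right 0) (\<lambda>\<epsilon>. ereal (?avg \<epsilon> (\<lambda>x. \<bar>f x - ?avg \<epsilon> f\<bar>))) < \<infinity>"
    unfolding FMO_def Let_def f_alt B_def N_def .
  then obtain s1 where s1: "0 < s1" "AE x in v. x \<in> B s1 \<longrightarrow> \<bar>enn2ereal (Q x)\<bar> \<noteq> \<infinity>" "set_integrable N (B s1) f"
    and lim: "Limsup (at_right 0) (\<lambda>\<epsilon>. ereal (?avg \<epsilon> (\<lambda>x. \<bar>f x - ?avg \<epsilon> f\<bar>))) < \<infinity>" by blast
  obtain K0 where "Limsup (at_right 0) (\<lambda>\<epsilon>. ereal (?avg \<epsilon> (\<lambda>x. \<bar>f x - ?avg \<epsilon> f\<bar>))) < ereal K0"
    using ereal_dense2[OF lim] by blast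
  then have "\<forall>\<^sub>F \<epsilon> in at_right 0. ereal (?avg \<epsilon> (\<lambda>x. \<bar>f x - ?avg \<epsilon> f\<bar>)) < ereal K0"
    by (rule Limsup_lessD)
  then obtain s2 where s2: "0 < s2" "\<And>s. 0 < s \<Longrightarrow> s < s2 \<Longrightarrow> ?avg s (\<lambda>x. \<bar>f x - ?avg s f\<bar>) < K0"
    unfolding eventually_at_right_field by auto
  \<comment> \<open>Half of the smallest of four radii, so that the volume bounds, integrability,
    bounded oscillation and inclusion in G are all available up to and including R.\<close>
  define R where "R = min (min s0 s1) (min s2 r0) / 2"
  have R: "0 < R" "R \<le> s0" "R < s1" "R < s2" "R < r0" using c s1 s2 r0 by (auto simp: R_def min_def)
  have Bm: "B s = mball z s" if "s \<le> R" for s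
    using that R(5) r0(2) by (auto simp: B_def commute)
  have Bsets: "mball z s \<in> sets v" for s using open_mball[of z s] sets_v by auto
  then have BsetsN: "mball z s \<in> sets N" for s by (simp add: N_def sets_completionI_sets)
  have emN: "emeasure N (mball z s) = emeasure v (mball z s)" for s using Bsets by (simp add: N_def)
  define V where "V = (\<lambda>s. measure N (mball z s))"
  have V: "c1 * s ^ ?n \<le> V s" "V s \<le> c2 * s ^ ?n" "0 < V s" "emeasure N (mball z s) < top" if s: "0 < s" "s \<le> R" for s
  proof -
    have lo: "ennreal (c1 * s ^ ?n) \<le> emeasure N (mball z s)" and hi: "emeasure N (mball z s) \<le> ennreal (c2 * s ^ ?n)"
      using vol[of s] s R(2) by (auto simp: emN)
    show fin: "emeasure N (mball z s) < top" using hi by (rule le_less_trans) simp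
    then have eq: "emeasure N (mball z s) = ennreal (V s)" by (simp add: V_def emeasure_eq_ennreal_measure less_top)
    show 1: "c1 * s ^ ?n \<le> V s" using lo unfolding eq by (subst (asm) ennreal_le_iff) (auto simp: V_def)
    show "V s \<le> c2 * s ^ ?n" using hi s c unfolding eq by (subst (asm) ennreal_le_iff) auto
    have "0 < c1 * s ^ ?n" using s c by simp
    then show "0 < V s" using 1 by linarith
  qed
  have fint: "set_integrable N (mball z s) f" if "s \<le> R" for s
  proof (rule set_integrable_subset[OF s1(3) BsetsN])
    show "mball z s \<subseteq> B s1"
    proof
      fix x assume "x \<in> mball z s"
      then have "x \<in> B s" using Bm[OF that] by simp
      then show "x \<in> B s1" using that R(3) unfolding B_def by simp
    qed
  qed
  have cint: "set_integrable N (mball z s) (\<lambda>_. a)" if "0 < s" "s \<le> R" for s and a :: real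
    using V(4)[OF that] BsetsN by (simp add: set_integrable_def)
  have fcint: "set_integrable N (mball z s) (\<lambda>x. f x - a)" "set_integrable N (mball z s) (\<lambda>x. \<bar>f x - a\<bar>)"
    if "0 < s" "s \<le> R" for s a
  proof -
    show 1: "set_integrable N (mball z s) (\<lambda>x. f x - a)"
      by (rule set_integral_diff(1)[OF fint[OF that(2)] cint[OF that]])
    show "set_integrable N (mball z s) (\<lambda>x. \<bar>f x - a\<bar>)" by (rule set_integrable_abs[OF 1])
  qed
  define m where "m = (\<lambda>s. (LINT x:mball z s|N. f x) / V s)"
  have osc: "(LINT x:mball z s|N. \<bar>f x - m s\<bar>) \<le> K0 * V s" if s: "0 < s" "s \<le> R" for s
  proof -
    have "?avg s (\<lambda>x. \<bar>f x - ?avg s f\<bar>) < K0" using s2(2) s R(4) by simp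
    then have "(LINT x:mball z s|N. \<bar>f x - m s\<bar>) / V s < K0" by (simp add: Bm[OF s(2)] m_def V_def)
    then show ?thesis using V(3)[OF s] by (simp add: pos_divide_less_eq)
  qed
  \<comment> \<open>The oscillation bound times the doubling constant of the volume, which compares
    a ball with its half.\<close>
  define D where "D = c2 * 2 ^ ?n / c1 * K0"
  have K0: "0 \<le> K0"
  proof -
    have "0 \<le> (LINT x:mball z R|N. \<bar>f x - m R\<bar>)"
      unfolding set_lebesgue_integral_def by (intro integral_nonneg_AE) auto
    then have "0 \<le> K0 * V R" using osc[of R] R by simp
    then show ?thesis using V(3)[of R] R by (simp add: zero_le_mult_iff)
  qed
  have D: "0 \<le> D" using K0 c by (simp add: D_def)
  have half: "\<bar>m (s / 2)\<bar> \<le> \<bar>m s\<bar> + D" if s: "0 < s" "s \<le> R" for s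
  proof -
    have s': "0 < s / 2" "s / 2 \<le> R" using s by auto
    have "(LINT x:mball z (s/2)|N. f x - m s) = (LINT x:mball z (s/2)|N. f x) - V (s/2) * m s"
      using set_integral_diff(2)[OF fint[OF s'(2)] cint[OF s', of "m s"]] V(4)[OF s'] BsetsN
      by (simp add: set_lebesgue_integral_def V_def)
    then have "m (s/2) - m s = (LINT x:mball z (s/2)|N. f x - m s) / V (s/2)"
      using V(3)[OF s'] by (simp add: m_def[of] field_simps)
    then have "\<bar>m (s/2) - m s\<bar> = \<bar>LINT x:mball z (s/2)|N. f x - m s\<bar> / V (s/2)"
      using V(3)[OF s'] by (simp add: abs_divide)
    also have "\<dots> \<le> (K0 * V s) / V (s/2)"
    proof (rule divide_right_mono)
      have "\<bar>LINT x:mball z (s/2)|N. f x - m s\<bar> \<le> (LINT x:mball z (s/2)|N. \<bar>f x - m s\<bar>)"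
        using set_integral_norm_bound[OF fcint(1)[OF s', of "m s"]] by simp
      also have "\<dots> \<le> (LINT x:mball z s|N. \<bar>f x - m s\<bar>)"
        unfolding set_lebesgue_integral_def
        by (rule integral_mono)
           (use fcint(2)[OF s, of "m s"] fcint(2)[OF s', of "m s"] s in \<open>auto simp: set_integrable_def indicator_def\<close>)
      also have "\<dots> \<le> K0 * V s" by (rule osc[OF s])
      finally show "\<bar>LINT x:mball z (s/2)|N. f x - m s\<bar> \<le> K0 * V s" .
    qed (use V(3)[OF s'] in simp)
    also have "\<dots> \<le> K0 * (c2 * s ^ ?n) / (c1 * (s/2) ^ ?n)"
      using V(1)[OF s'] V(2,3)[OF s] K0 c s by (intro frac_le mult_left_mono) auto
    also have "\<dots> = D" using s c by (simp add: D_def power_divide)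
    finally show ?thesis by linarith
  qed
  have mk: "\<bar>m (R * (1/2) ^ k)\<bar> \<le> \<bar>m R\<bar> + real k * D" for k
  proof (induction k)
    case (Suc k)
    have "\<bar>m (R * (1/2) ^ k / 2)\<bar> \<le> \<bar>m (R * (1/2) ^ k)\<bar> + D"
      using R(1) by (intro half) (auto simp: power_le_one mult_left_le)
    then show ?case using Suc by (simp add: algebra_simps)
  qed simp
  define q where "q = (1/2::real) powr (real ?n - p)"
  have q: "0 < q" "q < 1"
  proof -
    show "0 < q" by (simp add: q_def)
    have "(1/2::real) powr (real ?n - p) < (1/2) powr 0" using p by (intro powr_less_mono') auto
    then show "q < 1" by (simp add: q_def)
  qed
  have bound: "ennreal (s powr (-p)) * (\<integral>\<^sup>+x\<in>mball z s. Q x \<partial>N) \<le> ennreal (c2 * R powr (real ?n - p) * (\<bar>m R\<bar> * q ^ k + D * (real k * q ^ k)))"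
    if s_def: "s = R * (1/2) ^ k" for s k
  proof -
    have s: "0 < s" "s \<le> R" using R(1) by (auto simp: s_def power_le_one mult_left_le)
    \<comment> \<open>FMO is formulated with the real part of Q; finiteness almost everywhere allows
      the return to the integral of Q itself.\<close>
    have "AE x in N. x \<in> B s1 \<longrightarrow> \<bar>enn2ereal (Q x)\<bar> \<noteq> \<infinity>" unfolding N_def by (rule AE_completion[OF s1(2)])
    then have "(\<integral>\<^sup>+x\<in>mball z s. Q x \<partial>N) = (\<integral>\<^sup>+x. ennreal (indicator (mball z s) x *\<^sub>R f x) \<partial>N)"
    proof (intro nn_integral_cong_AE, eventually_elim)
      case (elim x)
      show ?case
      proof (cases "x \<in> mball z s")
        case True
        then have "x \<in> B s" using Bm[OF s(2)] by simp
        then have "x \<in> B s1" using s R unfolding B_def by simp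
        then have "Q x \<noteq> top" using elim by auto
        then show ?thesis using True by (simp add: f_def less_top)
      qed simp
    qed
    also have "\<dots> = ennreal (LINT x:mball z s|N. f x)"
      unfolding set_lebesgue_integral_def
      using fint[OF s(2)] by (intro nn_integral_eq_integral) (auto simp: set_integrable_def f_def)
    also have "(LINT x:mball z s|N. f x) = m s * V s" using V(3)[OF s] by (simp add: m_def)
    finally have I: "(\<integral>\<^sup>+x\<in>mball z s. Q x \<partial>N) = ennreal (m s * V s)" .
    have "m s * V s \<le> (\<bar>m R\<bar> + real k * D) * (c2 * s ^ ?n)"
      using mk[of k] V(2,3)[OF s] D by (intro mult_mono) (auto simp: s_def)
    then have "s powr (-p) * (m s * V s) \<le> s powr (-p) * ((\<bar>m R\<bar> + real k * D) * (c2 * s ^ ?n))"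
      by (intro mult_left_mono) auto
    also have "\<dots> = (\<bar>m R\<bar> + real k * D) * c2 * (s powr (-p) * s powr real ?n)"
      using s by (simp add: powr_realpow)
    also have "s powr (-p) * s powr real ?n = R powr (real ?n - p) * q ^ k"
    proof -
      have "s powr (-p) * s powr real ?n = s powr (real ?n - p)" by (simp flip: powr_add)
      also have "\<dots> = R powr (real ?n - p) * ((1/2) ^ k) powr (real ?n - p)"
        unfolding s_def using R(1) by (simp add: powr_mult)
      also have "((1/2::real) ^ k) powr (real ?n - p) = q ^ k"
        unfolding q_def by (simp add: powr_realpow[symmetric] powr_powr powr_power mult.commute)
      finally show ?thesis .
    qed
    finally have "s powr (-p) * (m s * V s) \<le> c2 * R powr (real ?n - p) * (\<bar>m R\<bar> * q ^ k + D * (real k * q ^ k))"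
      by (simp add: algebra_simps)
    then show ?thesis unfolding I by (subst ennreal_mult'[symmetric]) (auto intro: ennreal_leI)
  qed
  have "(\<lambda>k. c2 * R powr (real ?n - p) * (\<bar>m R\<bar> * q ^ k + D * (real k * q ^ k))) \<longlonglongrightarrow>
      c2 * R powr (real ?n - p) * (\<bar>m R\<bar> * 0 + D * 0)"
    using q by (intro tendsto_intros LIMSEQ_power_zero powser_times_n_limit_0) auto
  then have "(\<lambda>k. c2 * R powr (real ?n - p) * (\<bar>m R\<bar> * q ^ k + D * (real k * q ^ k))) \<longlonglongrightarrow> 0" by simp
  then have "\<forall>\<^sub>F k in sequentially. c2 * R powr (real ?n - p) * (\<bar>m R\<bar> * q ^ k + D * (real k * q ^ k)) < e"
    using e by (rule order_tendstoD)
  then obtain k where k: "c2 * R powr (real ?n - p) * (\<bar>m R\<bar> * q ^ k + D * (real k * q ^ k)) < e"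
    by (auto simp: eventually_sequentially)
  show ?thesis
  proof (rule that[of "R * (1/2) ^ k"])
    show "0 < R * (1/2) ^ k" using R by simp
    have "R * (1/2) ^ k \<le> R" using R(1) by (simp add: power_le_one mult_left_le)
    then show "R * (1/2) ^ k < r0" using R(5) by linarith
    show "ennreal ((R * (1/2) ^ k) powr (-p)) * (\<integral>\<^sup>+x\<in>mball z (R * (1/2) ^ k). Q x \<partial>completion v) \<le> ennreal e"
      by (rule order_trans[OF bound[OF refl, of k, unfolded N_def] ennreal_leI[OF less_imp_le[OF k]]])
  qed
qed

end

section \<open>Equicontinuity of ring homeomorphisms\<close>

lemma hausdorff_measure_empty: "hausdorff_measure d s {} = 0"
proof -
  have "(INF A\<in>{A :: nat \<Rightarrow> 'a set. {} \<subseteq> (\<Union>i. A i) \<and> (\<forall>i. ediam d (A i) \<le> ennreal \<delta>)}.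
        \<Sum>i. ennreal (unit_ball_vol s) * epowr (ediam d (A i) / 2) s) \<le> 0" for \<delta>
    by (rule INF_lower2[of "\<lambda>_. {}"]) (auto simp: ediam_def epowr_def bot_ennreal)
  then show ?thesis unfolding hausdorff_measure_def by (simp add: SUP_eq_const)
qed

text \<open>The last time at level a and not the first, since afterwards the function stays above a.
  Applied to the distance from the centre of a ring, this discards all returns to the inner
  ball.\<close>

lemma last_crossing:
  fixes h :: "real \<Rightarrow> real"
  assumes h: "continuous_on {0..1} h" "h 0 < a" "a < h 1"
  obtains t0 where "0 \<le> t0" "t0 < 1" "h t0 = a" "\<And>t. t0 < t \<Longrightarrow> t \<le> 1 \<Longrightarrow> a < h t"
proof -
  let ?Z = "{0..1} \<inter> h -` {..a}"
  have cl: "closed ?Z" by (rule continuous_closed_preimage[OF h(1)]) auto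
  have zero: "0 \<in> ?Z" using h by simp
  have bdd: "bdd_above ?Z" by (rule bdd_aboveI[of _ 1]) auto
  define t0 where "t0 = Sup ?Z"
  have "t0 \<in> ?Z" unfolding t0_def by (rule closed_contains_Sup[OF _ bdd cl]) (use zero in blast)
  then have t0: "0 \<le> t0" "t0 \<le> 1" "h t0 \<le> a" by auto
  then have t01: "t0 < 1" using h(3) by (cases "t0 = 1") auto
  have after: "a < h t" if "t0 < t" "t \<le> 1" for t
  proof (rule ccontr)
    assume "\<not> a < h t"
    then have "t \<in> ?Z" using that t0 by auto
    then have "t \<le> t0" unfolding t0_def by (rule cSup_upper[OF _ bdd])
    then show False using that by simp
  qed
  have "h t0 = a"
  proof (rule ccontr)
    assume "h t0 \<noteq> a"
    then have "h t0 < a" using t0 by simp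
    moreover have "continuous_on {t0..1} h" by (rule continuous_on_subset[OF h(1)]) (use t0 in auto)
    ultimately obtain t where "t0 \<le> t" "t \<le> 1" "h t = a" using IVT'[of h t0 a 1] h(3) t0 by auto
    then show False using after[of t] \<open>h t0 < a\<close> by (cases "t = t0") auto
  qed
  then show ?thesis using that[OF t0(1) t01 _ after] by blast
qed

section \<open>The target: noncompactness and estimates at all scales\<close>

locale ring_target = riem_conn M for M :: "('b::{t2_space, second_countable_topology}, 'n::finite) riemannian" +
  fixes v :: "'b measure" and p :: real
  assumes v: "is_volume_measure M v" and n2: "CARD('n) \<ge> 2"
    and p: "real CARD('n) - 1 < p" "p < real CARD('n)"
    and adm: "admissible_target CARD('n) p (geodesic_dist M) v"
    and proper: "proper_space (geodesic_dist M)"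
    and iso: "\<exists>c>0. \<forall>A. open A \<and> compact (closure A) \<and> smooth_boundary M A \<longrightarrow>
           hausdorff_measure (geodesic_dist M) (real CARD('n) - 1) (frontier A)
             \<ge> ennreal (c / measure v A powr (1 / real CARD('n) - 1))"
begin

lemma sets_v: "sets v = sets borel" using v by (simp add: is_volume_measure_def)

text \<open>A compact manifold without boundary violates the isoperimetric inequality for \<open>A = UNIV\<close>.\<close>

lemma not_compact: "\<not> compact (UNIV :: 'b set)"
proof
  assume cpt: "compact (UNIV :: 'b set)"
  obtain c where c: "c > 0" and ineq: "\<And>A. open A \<Longrightarrow> compact (closure A) \<Longrightarrow> smooth_boundary M A \<Longrightarrow>
      ennreal (c / measure v A powr (1 / real CARD('n) - 1)) \<le> hausdorff_measure gd (real CARD('n) - 1) (frontier A)"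
    using iso by blast
  have ball: "\<exists>s>0. 0 < emeasure v (mball z s) \<and> emeasure v (mball z s) < top" for z
  proof -
    obtain c1 c2 s0 where cs: "c1 > 0" "c2 > 0" "s0 > 0"
      "\<And>s. 0 < s \<Longrightarrow> s \<le> s0 \<Longrightarrow> ennreal (c1 * s ^ CARD('n)) \<le> emeasure v (mball z s) \<and> emeasure v (mball z s) \<le> ennreal (c2 * s ^ CARD('n))"
      using volume_small_balls[OF v, of z] by blast
    have lo: "0 < ennreal (c1 * s0 ^ CARD('n))" using cs by simp
    have b: "ennreal (c1 * s0 ^ CARD('n)) \<le> emeasure v (mball z s0)" "emeasure v (mball z s0) \<le> ennreal (c2 * s0 ^ CARD('n))"
      using cs(4)[OF cs(3)] by auto
    have "0 < emeasure v (mball z s0)" by (rule less_le_trans[OF lo b(1)])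
    moreover have "emeasure v (mball z s0) < top" by (rule le_less_trans[OF b(2)]) simp
    ultimately show ?thesis using cs(3) by blast
  qed
  then obtain S where S: "\<And>z. S z > 0" "\<And>z. 0 < emeasure v (mball z (S z))" "\<And>z. emeasure v (mball z (S z)) < top" by metis
  have "UNIV \<subseteq> (\<Union>z\<in>UNIV. mball z (S z))" using S(1) by (auto intro!: exI)
  then obtain F where F: "F \<subseteq> UNIV" "finite F" "UNIV \<subseteq> (\<Union>z\<in>F. mball z (S z))"
    by (rule compactE_image[OF cpt open_mball])
  have ms: "mball z (S z) \<in> sets v" for z using open_mball sets_v by auto
  have "emeasure v UNIV \<le> emeasure v (\<Union>z\<in>F. mball z (S z))" using F ms by (intro emeasure_mono) auto
  also have "\<dots> \<le> (\<Sum>z\<in>F. emeasure v (mball z (S z)))" by (rule emeasure_subadditive_finite) (use F ms in auto)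
  also have "\<dots> < top" using F(2) by (induction F rule: finite_induct) (auto simp: S(3))
  finally have fin: "emeasure v UNIV < top" .
  have "0 < emeasure v (mball undefined (S undefined))" by (rule S(2))
  also have "\<dots> \<le> emeasure v UNIV" using sets_v by (intro emeasure_mono) auto
  \<comment> \<open>Finiteness matters here because \<open>measure\<close> is 0 for infinite
    measure; then \<open>0 powr x = 0\<close> and division by 0 would turn the lower bound of the
    isoperimetric inequality into 0.\<close>
  finally have "0 < measure v UNIV" using fin by (simp add: measure_def enn2real_positive_iff)
  then have "0 < c / measure v UNIV powr (1 / real CARD('n) - 1)" using c by simp
  moreover have "ennreal (c / measure v UNIV powr (1 / real CARD('n) - 1)) \<le> 0"
    using ineq[of UNIV] cpt by (simp add: smooth_boundary_def hausdorff_measure_empty)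
  ultimately show False by (simp add: ennreal_eq_0_iff)
qed

lemma ediam_UNIV: "ediam gd UNIV = top"
proof (rule ccontr)
  assume "ediam gd UNIV \<noteq> top"
  then obtain D where D: "ediam gd UNIV = ennreal D" "0 \<le> D" by (cases "ediam gd UNIV") auto
  have "gd x y \<le> D" for x y
  proof -
    have "ennreal (gd x y) \<le> ediam gd UNIV" unfolding ediam_def by (rule SUP_upper2[of x], simp, rule SUP_upper2[of y]) simp_all
    then show ?thesis using D by (simp add: ennreal_le_iff)
  qed
  then have "mcball undefined D = UNIV" by auto
  moreover have "compact (mcball undefined D)" using proper by (simp add: proper_space_def mtopology_eq)
  ultimately show False using not_compact by simp
qed

lemma loewner: "\<exists>C P \<tau>. loewner_space gd v CARD('n) p C P \<tau>"
proof -
  obtain C where C: "C \<ge> 1" and ahl: "\<And>x R. 0 < R \<Longrightarrow> ennreal R < ediam gd UNIV \<Longrightarrow>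
        ennreal (R ^ CARD('n) / C) \<le> emeasure v (mball x R) \<and> emeasure v (mball x R) \<le> ennreal (C * R ^ CARD('n))"
    using adm unfolding admissible_target_def ahlfors_regular_def by blast
  obtain P \<tau> where P: "P \<ge> 1" "\<tau> \<ge> 1" and poi: "\<forall>x r u \<rho>.
        let B = mball x r; \<tau>B = mball x (\<tau> * r) in
        0 < r \<and> bounded (u ` B) \<and> continuous_map (subtopology mtopology B) euclideanreal u \<and>
        upper_gradient gd \<rho> u \<longrightarrow>
        (\<integral>\<^sup>+y\<in>B. ennreal \<bar>u y - (LINT z:B|v. u z) / measure v B\<bar> \<partial>v) / emeasure v B
        \<le> ennreal P * ediam gd B * epowr ((\<integral>\<^sup>+y\<in>\<tau>B. epowr (\<rho> y) p \<partial>v) / emeasure v \<tau>B) (1 / p)"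
    using adm unfolding admissible_target_def poincare_inequality_def by blast
  have "loewner_space gd v CARD('n) p C P \<tau>"
  proof (intro loewner_space.intro umetric_gd loewner_space_axioms.intro)
    show "1 < p" using n2 p(1) by linarith
    show "ennreal (R ^ CARD('n) / C) \<le> emeasure v (mball x R) \<and> emeasure v (mball x R) \<le> ennreal (C * R ^ CARD('n))"
      if "0 < R" for x R
      by (rule ahl[OF that]) (simp add: ediam_UNIV)
    show "(\<integral>\<^sup>+y\<in>mball x r. ennreal \<bar>u y - (LINT z:mball x r|v. u z) / measure v (mball x r)\<bar> \<partial>v) / emeasure v (mball x r)
        \<le> ennreal P * ediam gd (mball x r) *
          epowr ((\<integral>\<^sup>+y\<in>mball x (\<tau> * r). epowr (\<rho> y) p \<partial>v) / emeasure v (mball x (\<tau> * r))) (1 / p)"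
      if "0 < r" "bounded (u ` mball x r)" "continuous_on (mball x r) u" "upper_gradient gd \<rho> u" for x r u \<rho>
      using poi[unfolded Let_def, rule_format, of r u x \<rho>] that by (simp add: mtopology_eq)
  qed (use C P p sets_v in auto)
  then show ?thesis by blast
qed

end

section \<open>Rings in the source and their images in the target\<close>

locale ring_setting = S: riem_conn M + T: ring_target M' v' p
  for M :: "('a::{t2_space, second_countable_topology}, 'n::finite) riemannian"
    and M' :: "('b::{t2_space, second_countable_topology}, 'n) riemannian" and v' p +
  fixes G :: "'a set" and z :: 'a
  assumes G: "open G" "z \<in> G"
begin

text \<open>The path c starts in the image of the inner ball and may wander about after leaving the
  image of the outer one. Cutting it at the first exit from the outer image and at the last crossing
  of the inner sphere leaves a piece whose preimage joins the two spheres within the open ring; the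
  integral over a piece is at most that over the whole.\<close>

lemma image_path_family:
  assumes f: "homeomorphism G (f ` G) f g" and r: "0 < r" "compact (S.mcball z r)" "S.mcball z r \<subseteq> G"
    and c: "rectifiable T.gd c" "c 0 \<in> f ` S.mball z (r / 2)" "c 1 \<notin> f ` S.mball z r"
    and U: "open (f ` S.mball z r)"
  shows "\<exists>\<gamma>\<in>(\<lambda>\<gamma>. f \<circ> \<gamma>) ` joining_paths S.gd (msphere S.gd z (r / 2)) (msphere S.gd z r) (ring_dom S.gd z (r / 2) r).
     rectifiable T.gd \<gamma> \<and> (\<forall>\<rho>\<in>borel_measurable borel. path_integral T.gd \<rho> \<gamma> \<le> path_integral T.gd \<rho> c)"
proof -
  have gf: "g (f x) = x" if "x \<in> G" for x using f that by (simp add: homeomorphism_def)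
  have fcont: "continuous_on G f" and gcont: "continuous_on (f ` G) g" using f by (auto simp: homeomorphism_def)
  let ?U = "f ` S.mball z r" and ?K = "f ` S.mcball z r"
  have sub: "S.mball z r \<subseteq> S.mcball z r" by auto
  have "compact ?K" by (intro compact_continuous_image continuous_on_subset[OF fcont] r)
  then have Kcl: "closed ?K" by (rule compact_imp_closed)
  have c0: "c 0 \<in> ?U" using c(2) r(1) by (auto intro!: imageI)
  obtain \<beta> where \<beta>: "rectifiable T.gd \<beta>" "\<beta> 0 = c 0" "\<beta> 1 \<notin> ?U" "\<And>t. t \<in> {0..<1} \<Longrightarrow> \<beta> t \<in> ?U"
    "\<And>\<rho>. \<rho> \<in> borel_measurable borel \<Longrightarrow> path_integral T.gd \<rho> \<beta> \<le> path_integral T.gd \<rho> c"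
    using T.first_exit[OF c(1) c0 c(3) U] by metis
  have \<beta>cont: "continuous_on {0..1} \<beta>" using \<beta>(1) by (simp add: T.rectifiable_iff path_def)
  have \<beta>K: "\<beta> t \<in> ?K" if t: "t \<in> {0..1}" for t
  proof -
    have "continuous_on (closure {0..<1}) \<beta>" using \<beta>cont by simp
    moreover have "\<beta> ` {0..<1} \<subseteq> ?K" using \<beta>(4) sub by blast
    ultimately have "\<beta> ` closure {0..<1} \<subseteq> ?K" using Kcl by (intro image_closure_subset)
    then show ?thesis using t by auto
  qed
  have K_G: "?K \<subseteq> f ` G" using r(3) by blast
  define h where "h = (\<lambda>t. S.gd (g (\<beta> t)) z)"
  have g\<beta>: "continuous_on {0..1} (\<lambda>t. g (\<beta> t))"
    by (rule continuous_on_compose2[OF gcont \<beta>cont]) (use \<beta>K K_G in blast)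
  have hcont: "continuous_on {0..1} h" unfolding h_def
    by (rule continuous_on_compose2[OF S.continuous_on_dist g\<beta>, of UNIV]) auto
  have fg: "f (g (\<beta> t)) = \<beta> t" "g (\<beta> t) \<in> S.mcball z r" if t: "t \<in> {0..1}" for t
  proof -
    obtain x where x: "x \<in> S.mcball z r" "\<beta> t = f x" using \<beta>K[OF t] by blast
    then have "g (\<beta> t) = x" using gf r(3) by auto
    then show "f (g (\<beta> t)) = \<beta> t" "g (\<beta> t) \<in> S.mcball z r" using x by auto
  qed
  have h_le: "h t \<le> r" if "t \<in> {0..1}" for t using fg(2)[OF that] by (simp add: h_def S.commute)
  have h_lt: "h t < r" if t: "t \<in> {0..<1}" for t
  proof -
    obtain x where x: "x \<in> S.mball z r" "\<beta> t = f x" using \<beta>(4)[OF t] by blast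
    then have "x \<in> G" using r(3) sub by blast
    then have "g (\<beta> t) = x" using gf x by simp
    then show ?thesis using x by (simp add: h_def S.commute)
  qed
  have h0: "h 0 < r / 2"
  proof -
    obtain x where x: "x \<in> S.mball z (r / 2)" "\<beta> 0 = f x" using \<beta>(2) c(2) by auto
    then have "x \<in> G" using r by (auto simp: subset_eq)
    then have "g (\<beta> 0) = x" using gf x by simp
    then show ?thesis using x by (simp add: h_def S.commute)
  qed
  \<comment> \<open>The exit point is in the compact image of the closed ball but not in the image
    of the open one, so its preimage is on the outer sphere.\<close>
  have h1: "h 1 = r"
  proof (rule ccontr)
    assume "h 1 \<noteq> r"
    then have "h 1 < r" using h_le[of 1] by simp
    then have "g (\<beta> 1) \<in> S.mball z r" by (simp add: h_def S.commute)
    then have "f (g (\<beta> 1)) \<in> ?U" by (rule imageI)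
    then show False using \<beta>(3) fg(1)[of 1] by simp
  qed
  obtain t0 where t0: "0 \<le> t0" "t0 < 1" "h t0 = r / 2" "\<And>t. t0 < t \<Longrightarrow> t \<le> 1 \<Longrightarrow> r / 2 < h t"
    using last_crossing[OF hcont h0] h1 r(1) by auto
  define \<alpha> where "\<alpha> = (\<lambda>t. (1 - t0) * t + t0)"
  have \<alpha>: "\<alpha> t \<in> {0..1}" if "t \<in> {0..1}" for t
  proof -
    have 1: "(1 - t0) * t \<le> 1 - t0" using that t0 by (intro mult_left_le) auto
    have 2: "0 \<le> (1 - t0) * t" using that t0 by simp
    have "0 \<le> \<alpha> t" unfolding \<alpha>_def using 2 t0(1) by linarith
    moreover have "\<alpha> t \<le> 1" unfolding \<alpha>_def using 1 by linarith
    ultimately show ?thesis by simp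
  qed
  have \<alpha>int: "t0 < \<alpha> t" "\<alpha> t < 1" if "t \<in> {0<..<1}" for t
  proof -
    show "t0 < \<alpha> t" using that t0 by (simp add: \<alpha>_def)
    have "(1 - t0) * t < (1 - t0) * 1" using that t0 by (intro mult_strict_left_mono) auto
    then show "\<alpha> t < 1" unfolding \<alpha>_def mult_1_right by linarith
  qed
  let ?\<beta> = "\<lambda>t. \<beta> ((1 - t0) * t + t0)"
  \<comment> \<open>Clamped to \<open>{0..1}\<close> because paths are total functions on the reals.\<close>
  define \<gamma> where "\<gamma> = (\<lambda>t. g (\<beta> (\<alpha> (max 0 (min 1 t)))))"
  have \<gamma>eq: "\<gamma> t = g (\<beta> (\<alpha> t))" if "t \<in> {0..1}" for t
  proof -
    have "max 0 (min 1 t) = t" using that by auto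
    then show ?thesis by (simp add: \<gamma>_def)
  qed
  have f\<gamma>: "?\<beta> t = (f \<circ> \<gamma>) t" if "t \<in> {0..1}" for t
    using fg(1)[OF \<alpha>[OF that]] \<gamma>eq[OF that] by (simp add: \<alpha>_def)
  have \<beta>r: "rectifiable T.gd ?\<beta>" by (rule T.rectifiable_sub[OF \<beta>(1) t0(1,2)]) simp
  have h\<gamma>: "S.gd (\<gamma> t) z = h (\<alpha> t)" if "t \<in> {0..1}" for t using \<gamma>eq[OF that] by (simp add: h_def)
  have "continuous_on {0..1} (\<lambda>t. g (\<beta> (\<alpha> t)))"
    by (rule continuous_on_compose2[OF g\<beta>, of _ \<alpha>]) (use \<alpha> in \<open>auto simp: \<alpha>_def intro!: continuous_intros\<close>)
  then have "path \<gamma>" unfolding path_def by (rule continuous_on_eq) (simp add: \<gamma>eq)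
  then have "pathin S.mtopology \<gamma>" by (simp add: S.pathin_eq_path)
  moreover have "S.gd (\<gamma> 0) z = r / 2" "S.gd (\<gamma> 1) z = r"
    using h\<gamma>[of 0] h\<gamma>[of 1] t0(3) h1 by (simp_all add: \<alpha>_def)
  moreover have "r / 2 < S.gd (\<gamma> t) z \<and> S.gd (\<gamma> t) z < r" if "t \<in> {0<..<1}" for t
    using h\<gamma>[of t] that \<alpha>int[OF that] t0(4)[of "\<alpha> t"] h_lt[of "\<alpha> t"] t0(1) by simp
  ultimately have "\<gamma> \<in> joining_paths S.gd (msphere S.gd z (r / 2)) (msphere S.gd z r) (ring_dom S.gd z (r / 2) r)"
    by (simp add: joining_paths_def msphere_def ring_dom_def)
  moreover have "rectifiable T.gd ?\<beta> \<longleftrightarrow> rectifiable T.gd (f \<circ> \<gamma>)" by (rule T.rectifiable_cong[OF f\<gamma>])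
  then have "rectifiable T.gd (f \<circ> \<gamma>)" using \<beta>r by blast
  moreover have "path_integral T.gd \<rho> (f \<circ> \<gamma>) \<le> path_integral T.gd \<rho> c" if \<rho>: "\<rho> \<in> borel_measurable borel" for \<rho>
  proof -
    have "path_integral T.gd \<rho> (f \<circ> \<gamma>) = path_integral T.gd \<rho> ?\<beta>"
      by (rule T.path_integral_cong[OF \<beta>r f\<gamma>, symmetric])
    also have "\<dots> \<le> path_integral T.gd \<rho> \<beta>" by (rule T.path_integral_sub_le[OF \<beta>(1) t0(1,2) _ \<rho>]) simp
    also have "\<dots> \<le> path_integral T.gd \<rho> c" by (rule \<beta>(5)[OF \<rho>])
    finally show ?thesis .
  qed
  ultimately show ?thesis by blast
qed

lemma ring_modulus_upper:
  fixes Q :: "'a \<Rightarrow> ennreal"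
  assumes f: "ring_Q_mapping S.gd v T.gd v' r0 z p Q f" and r: "0 < r" "r < r0"
    and Q: "Q \<in> borel_measurable (restrict_space (completion v) G)" "S.mball z r \<subseteq> G" and sets_v: "sets v = sets borel"
    and e: "ennreal (r powr (-p)) * (\<integral>\<^sup>+x\<in>S.mball z r. Q x \<partial>completion v) \<le> ennreal e"
  shows "modulus T.gd v' p ((\<lambda>\<gamma>. f \<circ> \<gamma>) ` joining_paths S.gd (msphere S.gd z (r / 2)) (msphere S.gd z r) (ring_dom S.gd z (r / 2) r))
     \<le> ennreal (2 powr p * e)"
proof -
  let ?N = "completion v" and ?A = "ring_dom S.gd z (r / 2) r"
  \<comment> \<open>Constant on an interval of length r / 2, with integral exactly 1.\<close>
  define \<eta> where "\<eta> = (\<lambda>_::real. ennreal (2 / r))"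
  have one: "1 \<le> (\<integral>\<^sup>+t. \<eta> t \<partial>lebesgue_on {r / 2<..<r})"
  proof -
    have "(\<integral>\<^sup>+t. \<eta> t \<partial>lebesgue_on {r / 2<..<r}) = ennreal (2 / r) * ennreal (r - r / 2)"
      using r by (simp add: \<eta>_def emeasure_restrict_space)
    also have "\<dots> = ennreal 1" using r by (simp flip: ennreal_mult)
    finally show ?thesis by simp
  qed
  have \<eta>m: "\<eta> \<in> borel_measurable (lebesgue_on {r / 2<..<r})" by (simp add: \<eta>_def)
  \<comment> \<open>Q is measurable on G only; the factor \<open>indicator G\<close>, which is 1 on
    the ball, makes the product measurable on the whole space.\<close>
  have meas: "(\<lambda>x. Q x * indicator (S.mball z r) x) \<in> borel_measurable ?N"
  proof -
    have sN: "W \<in> sets ?N" if "open W" for W :: "'a set" using that sets_v by (intro sets_completionI_sets) auto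
    have [measurable]: "S.mball z r \<in> sets ?N" by (rule sN[OF S.open_mball])
    have "G \<inter> space ?N \<in> sets ?N" using sN[OF G(1)] by auto
    then have [measurable]: "(\<lambda>x. Q x * indicator G x) \<in> borel_measurable ?N"
      using Q(1) by (simp add: borel_measurable_restrict_space_iff_ennreal)
    have "(\<lambda>x. (Q x * indicator G x) * indicator (S.mball z r) x) \<in> borel_measurable ?N" by measurable
    moreover have "(\<lambda>x. (Q x * indicator G x) * indicator (S.mball z r) x) = (\<lambda>x. Q x * indicator (S.mball z r) x)"
      using Q(2) by (auto simp: fun_eq_iff indicator_def)
    ultimately show ?thesis by simp
  qed
  have "modulus T.gd v' p ((\<lambda>\<gamma>. f \<circ> \<gamma>) ` joining_paths S.gd (msphere S.gd z (r / 2)) (msphere S.gd z r) ?A)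
      \<le> (\<integral>\<^sup>+x\<in>?A. Q x * epowr (\<eta> (S.gd x z)) p \<partial>?N)"
    using f[unfolded ring_Q_mapping_def, rule_format, of "r / 2" r \<eta>] r one \<eta>m by simp
  also have "\<dots> \<le> (\<integral>\<^sup>+x. ennreal ((2 / r) powr p) * (Q x * indicator (S.mball z r) x) \<partial>?N)"
  proof (rule nn_integral_mono)
    fix x
    show "Q x * epowr (\<eta> (S.gd x z)) p * indicator ?A x \<le> ennreal ((2 / r) powr p) * (Q x * indicator (S.mball z r) x)"
      using r by (auto simp: \<eta>_def epowr_ennreal indicator_def ring_dom_def mult.commute S.commute)
  qed
  also have "\<dots> = ennreal ((2 / r) powr p) * (\<integral>\<^sup>+x\<in>S.mball z r. Q x \<partial>?N)"
    by (rule nn_integral_cmult[OF meas])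
  also have "ennreal ((2 / r) powr p) = ennreal (2 powr p) * ennreal (r powr (-p))"
  proof -
    have "(2 / r) powr p = 2 powr p * r powr (-p)"
      using r by (subst powr_divide) (auto simp: powr_minus divide_inverse)
    then show ?thesis by (simp add: ennreal_mult')
  qed
  also have "ennreal (2 powr p) * ennreal (r powr (-p)) * (\<integral>\<^sup>+x\<in>S.mball z r. Q x \<partial>?N) \<le> ennreal (2 powr p) * ennreal e"
    unfolding mult.assoc by (rule mult_left_mono[OF e]) simp
  also have "\<dots> = ennreal (2 powr p * e)" by (simp add: ennreal_mult')
  finally show ?thesis .
qed

text \<open>The radius r is chosen from Q, \<epsilon> and the constants of the target before any f
  appears, and r / 2 serves as \<delta> for the whole family. If f moved some x of the inner ball by
  \<epsilon> or more from the image of the centre, the image of a connected set joining the centre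
  to x inside the inner ball would push the modulus of the image of the ring above its upper
  bound.\<close>

lemma equicontinuous:
  fixes Q :: "'a \<Rightarrow> ennreal"
  assumes v: "is_volume_measure M v" and Q: "Q \<in> borel_measurable (restrict_space (completion v) G)"
    and fmo: "FMO S.gd v G (\<lambda>x. enn2ereal (Q x)) z" and r0: "0 < r0" "{x. S.gd x z < r0} \<subseteq> G" and \<epsilon>: "0 < \<epsilon>"
  shows "\<exists>\<delta>>0. \<forall>x\<in>G. S.gd x z < \<delta> \<longrightarrow>
           (\<forall>f\<in>ring_Q_homeos S.gd v T.gd v' r0 z p Q G. T.gd (f x) (f z) < \<epsilon>)"
proof -
  obtain C P \<tau> where L: "loewner_space T.gd v' CARD('n) p C P \<tau>" using T.loewner by blast
  interpret L: loewner_space T.gd v' "CARD('n)" p C P \<tau> by (rule L)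
  obtain \<rho>0 where \<rho>0: "\<rho>0 > 0" "\<And>\<rho>. \<rho> \<le> \<rho>0 \<Longrightarrow> compact (S.mcball z \<rho>)" using S.small_balls_compact[of z] by blast
  \<comment> \<open>Makes the upper bound \<open>2 powr p * e\<close> exactly half of the lower
    bound at distance \<epsilon>.\<close>
  define e where "e = L.c0 * \<epsilon> powr (real CARD('n) - p) / 2 / 2 powr p"
  have e: "0 < e" using L.c0_pos \<epsilon> by (simp add: e_def)
  \<comment> \<open>r has to lie in the range of the ring inequality and also in the range where
    closed balls are compact; the latter makes the image of the ball relatively compact.\<close>
  have r1: "0 < min r0 \<rho>0" "{x. S.gd x z < min r0 \<rho>0} \<subseteq> G" using r0 \<rho>0 by auto
  obtain r where r: "0 < r" "r < min r0 \<rho>0"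
    "ennreal (r powr (-p)) * (\<integral>\<^sup>+x\<in>S.mball z r. Q x \<partial>completion v) \<le> ennreal e"
    using S.FMO_imp_growth[OF v fmo r1 T.p(2) e] by blast
  have cG: "S.mcball z r \<subseteq> G"
  proof
    fix x assume "x \<in> S.mcball z r"
    then have "S.gd x z < r0" using r(2) by (simp add: S.commute)
    then show "x \<in> G" using r0(2) by blast
  qed
  have cpt: "compact (S.mcball z r)" using \<rho>0(2) r(2) by simp
  have bG: "S.mball z r \<subseteq> G" using cG by (auto simp: subset_eq)
  show ?thesis
  proof (intro exI[of _ "r / 2"] conjI ballI impI)
    show "0 < r / 2" using r by simp
    fix x f assume x: "x \<in> G" "S.gd x z < r / 2" and f: "f \<in> ring_Q_homeos S.gd v T.gd v' r0 z p Q G"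
    obtain g where g: "homeomorphism G (f ` G) f g" and fG: "open (f ` G)" and ring: "ring_Q_mapping S.gd v T.gd v' r0 z p Q f"
      using f by (auto simp: ring_Q_homeos_def)
    have fcont: "continuous_on G f" using g by (auto simp: homeomorphism_def)
    show "T.gd (f x) (f z) < \<epsilon>"
    proof (rule ccontr)
      assume "\<not> ?thesis"
      then have big: "\<epsilon> \<le> T.gd (f z) (f x)" by (simp add: T.commute)
      then have ne: "f z \<noteq> f x" using \<epsilon> by auto
      have zx: "S.gd z x < r / 2" using x(2) by (simp add: S.commute)
      obtain K where K: "compact K" "connected K" "z \<in> K" "x \<in> K" "\<And>y. y \<in> K \<Longrightarrow> S.gd z y < r / 2"
        using S.connected_joining_set[OF zx] by blast
      have KB: "K \<subseteq> S.mball z (r / 2)" using K(5) by auto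
      have hB: "S.mball z (r / 2) \<subseteq> S.mball z r" using r(1) by auto
      have KG: "K \<subseteq> G" using KB hB bG by blast
      \<comment> \<open>f is an open map onto its image, and the image of G is open in the target
        for every member of the family.\<close>
      have U: "open (f ` S.mball z r)"
      proof -
        have "openin (top_of_set G) (S.mball z r)" using bG S.open_mball by (simp add: openin_open_eq G(1))
        then have "openin (top_of_set (f ` G)) (f ` S.mball z r)" using homeomorphism_imp_open_map[OF g] by blast
        then show ?thesis using fG openin_open_trans by blast
      qed
      have fK: "compact (f ` K)" "connected (f ` K)"
        using K(1,2) by (auto intro!: compact_continuous_image connected_continuous_image continuous_on_subset[OF fcont KG])
      have "compact (f ` S.mcball z r)" by (intro compact_continuous_image continuous_on_subset[OF fcont cG] cpt)
      moreover have "closure (f ` S.mball z r) \<subseteq> f ` S.mcball z r"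
        by (rule closure_minimal) (use compact_imp_closed[OF calculation] in auto)
      ultimately have Ucpt: "compact (closure (f ` S.mball z r))"
        using compact_Int_closed[of "f ` S.mcball z r" "closure (f ` S.mball z r)"] by (simp add: Int_absorb1)
      let ?\<Gamma> = "(\<lambda>\<gamma>. f \<circ> \<gamma>) ` joining_paths S.gd (msphere S.gd z (r / 2)) (msphere S.gd z r) (ring_dom S.gd z (r / 2) r)"
      have "ennreal (L.c0 * T.gd (f z) (f x) powr (real CARD('n) - p)) \<le> modulus T.gd v' p ?\<Gamma>"
      proof (rule L.modulus_lower_bound[where E="f ` K" and U="f ` S.mball z r"])
        show "\<exists>\<gamma>\<in>?\<Gamma>. rectifiable T.gd \<gamma> \<and> (\<forall>\<rho>\<in>borel_measurable borel. path_integral T.gd \<rho> \<gamma> \<le> path_integral T.gd \<rho> c)"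
          if "rectifiable T.gd c" "c 0 \<in> f ` K" "c 1 \<notin> f ` S.mball z r" for c
          using image_path_family[OF g r(1) cpt cG that(1) _ that(3) U] that(2) KB by blast
        show "f ` K \<subseteq> f ` S.mball z r" using KB hB by blast
      qed (use T.length_space fK K U Ucpt ne compact_imp_closed in auto)
      also have "\<dots> \<le> ennreal (2 powr p * e)"
        by (rule ring_modulus_upper[OF ring r(1) _ Q bG _ r(3)]) (use r(2) v in \<open>auto simp: is_volume_measure_def\<close>)
      finally have "L.c0 * T.gd (f z) (f x) powr (real CARD('n) - p) \<le> 2 powr p * e"
        using e by (subst (asm) ennreal_le_iff) auto
      also have "\<dots> = L.c0 * \<epsilon> powr (real CARD('n) - p) / 2" by (simp add: e_def)
      also have "\<dots> < L.c0 * \<epsilon> powr (real CARD('n) - p)" using L.c0_pos \<epsilon> by simp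
      also have "\<dots> \<le> L.c0 * T.gd (f z) (f x) powr (real CARD('n) - p)"
        using L.c0_pos big \<epsilon> T.p(2) by (intro mult_left_mono powr_mono2) auto
      finally show False by simp
    qed
  qed
qed

end

theorem theorem4p1:
  fixes M :: "('a::{t2_space, second_countable_topology}, 'n::finite) riemannian"
    and M' :: "('b::{t2_space, second_countable_topology}, 'n) riemannian"
    and v :: "'a measure" and v' :: "'b measure"
    and G :: "'a set" and \<zeta>\<^sub>0 :: 'a and Q :: "'a \<Rightarrow> ennreal" and p r\<^sub>0 :: real
  assumes "CARD('n) \<ge> 2"
    and "riemannian_manifold M" and "connected (UNIV :: 'a set)"
    and "riemannian_manifold M'" and "connected (UNIV :: 'b set)"
    and "is_volume_measure M v" and "is_volume_measure M' v'"
    and "open G" and "connected G" and "\<zeta>\<^sub>0 \<in> G"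
    and "Q \<in> borel_measurable (restrict_space (completion v) G)" and "\<forall>x\<in>G. 0 < Q x"
    and "real CARD('n) - 1 < p" and "p < real CARD('n)"
    and "admissible_target CARD('n) p (geodesic_dist M') v'"
    and "proper_space (geodesic_dist M')"
    and "\<exists>c>0. \<forall>A. open A \<and> compact (closure A) \<and> smooth_boundary M' A \<longrightarrow>
           hausdorff_measure (geodesic_dist M') (real CARD('n) - 1) (frontier A)
             \<ge> ennreal (c / measure v' A powr (1 / real CARD('n) - 1))"
    and "FMO (geodesic_dist M) v G (\<lambda>x. enn2ereal (Q x)) \<zeta>\<^sub>0"
    and "0 < r\<^sub>0" and "{x. geodesic_dist M x \<zeta>\<^sub>0 < r\<^sub>0} \<subseteq> G"
  shows "\<forall>\<epsilon>>0. \<exists>\<delta>>0. \<forall>x\<in>G. geodesic_dist M x \<zeta>\<^sub>0 < \<delta> \<longrightarrow>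
           (\<forall>f\<in>ring_Q_homeos (geodesic_dist M) v (geodesic_dist M') v' r\<^sub>0 \<zeta>\<^sub>0 p Q G.
              geodesic_dist M' (f x) (f \<zeta>\<^sub>0) < \<epsilon>)"

proof (intro allI impI)
  fix \<epsilon> :: real assume \<epsilon>: "0 < \<epsilon>"
  interpret ring_setting M M' v' p G \<zeta>\<^sub>0
    by (unfold_locales; fact assms)
  show "\<exists>\<delta>>0. \<forall>x\<in>G. geodesic_dist M x \<zeta>\<^sub>0 < \<delta> \<longrightarrow>
           (\<forall>f\<in>ring_Q_homeos (geodesic_dist M) v (geodesic_dist M') v' r\<^sub>0 \<zeta>\<^sub>0 p Q G.
              geodesic_dist M' (f x) (f \<zeta>\<^sub>0) < \<epsilon>)"
    by (rule equicontinuous) fact+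
qed

end
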